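(* Under the model described in the context, for every $h\in\mathbb{T}$ the filtered indicator process $\hat I^h_t=\mathbb{E}[\mathbf 1_{[\Theta_t=h]}\mid\mathcal{F}^N_t]$, $t\in[0,T]$, satisfies the equation $$d\hat I^h_t=\sum_{r=1}^m k^{rh}\,\hat I^r_{t-}\,dt+\sum_{i\neq j}\left(\frac{\ell^{h,ij}\,\hat I^h_{t-}}{\sum_{r=1}^m\ell^{r,ij}\,\hat I^r_{t-}}-\hat I^h_{t-}\right)\left(dN^{ij}_t-Y^i_t\sum_{r=1}^m\ell^{r,ij}\,\hat I^r_{t-}\,dt\right),$$ where the second sum runs over all pairs $(i,j)\in\bar\Upsilon^2$ with $i\ne j$.
   Context: Let $T<\infty$ and let $(\Omega,\mathbf{A},\mathbf F=(\mathcal{F}_t)_{t\in[0,T]},\mathbb{P})$ be a filtered probability space satisfying the usual conditions, with $\mathbf A=\mathcal{F}_T$. All processes are $\mathbf F$-adapted and integrable on $[0,T]$. Hidden factor: $\Theta$ is a continuous-time Markov chain (relative to $\mathbf F$) with finite state space $\mathbb{T}=\{1,\dots,m\}$ and constant transition intensities $k^{rh}$, $r\ne h$, with $k^{rr}=-\sum_{l\ne r}k^{rl}$. Put $I^h_t=\mathbf 1_{[\Theta_t=h]}$. Ratings: the rating categories are $\bar\Upsilon=\{1,\dots,p\}$. There are finitely many bonds; bond $q$ is observed on $[s^q,u^q]$, $0\le s^q\le u^q\le T$, where $s^q,u^q$ are deterministic (non-informative censoring), and has rating process $Z^q=(Z^q_t)_{t\in[s^q,u^q]}$ with values in $\bar\Upsilon$.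 Conditionally on $\mathcal{F}^\Theta_T$ ($\mathbf F^\Theta$ being the natural filtration of $\Theta$), the processes $Z^q$ are independent Markov chains with the same (time-dependent) generator matrix, whose $(i,j)$ entry, $i\ne j$, at time $t$ is $\ell^{h,ij}\ge0$ when $\Theta_t=h$; i.e. $\mathbb{P}(Z^q_{t+dt}=j\mid Z^q_t=i,\Theta_t=h)\approx\ell^{h,ij}\,dt$. Aggregated processes: for $i\ne j$ in $\bar\Upsilon$, $N^{ij}_t$ is the number of jumps from $i$ to $j$ made up to time $t$ by bonds during their observation periods, i.e. $N^{ij}_0=0$ and $\Delta N^{ij}_t=\sum_{q:\,s^q\le t<u^q}\mathbf 1_{[Z^q_{t-}=i,\,Z^q_t=j]}$. The exposure process is $Y^i_t=\sum_{q:\,s^q\le t<u^q}\mathbf 1_{[Z^q_{t-}=i]}$ (with $Z^q_{s^q-}:=Z^q_{s^q}$). $\mathbf F^N=(\mathcal{F}^N_t)_{t\in[0,T]}$ is the natural filtration of $N=(N^{ij})_{i\ne j}$, completed with null sets. The processes $Y^i$ are $\mathbf F^N$-predictable. No two bonds jump at the same time, so that $\Delta N^{ij}_t\,\Delta N^{rk}_t=0$ for $(i,j)\ne(r,k)$ and $\Delta N_t^{ij}\in\{0,1\}$; moreover $N$ and $\Theta$ have no common jumps. The $\mathbf F$-intensity of $N^{ij}$ is $\nu^{ij}_t=Y^i_t\sum_{r\in\mathbb{T}}\ell^{r,ij}I^r_{t-}$. Conventions: $\hat I^h$ denotes the càdlàg version; a quotient with zero denominator is taken to be $0$. *)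

theory Defs
  imports "HOL-Probability.Probability"
begin

section \<open>Paths\<close>

definition cadlag_on :: "real \<Rightarrow> real \<Rightarrow> (real \<Rightarrow> 'b::topological_space) \<Rightarrow> bool" where
  "cadlag_on a b f \<longleftrightarrow>
     (\<forall>t\<in>{a..<b}. (f \<longlongrightarrow> f t) (at_right t)) \<and>
     (\<forall>t\<in>{a<..b}. \<exists>x. (f \<longlongrightarrow> x) (at_left t))"

text \<open>The left limit \<open>f (t-)\<close> of a path started at time \<open>a\<close>, with the convention
  \<open>f (a-) = f a\<close>.  On \<open>nat\<close> the topology is discrete, so for state-valued paths this is the
  state occupied just before \<open>t\<close>.\<close>

definition left_lim :: "real \<Rightarrow> (real \<Rightarrow> 'b::t2_space) \<Rightarrow> real \<Rightarrow> 'b" where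
  "left_lim a f t = (if t \<le> a then f a else Lim (at_left t) f)"

section \<open>Filtrations and processes on a bounded time interval\<close>

definition usual_conditions :: "'a measure \<Rightarrow> real \<Rightarrow> (real \<Rightarrow> 'a measure) \<Rightarrow> bool" where
  "usual_conditions M T F \<longleftrightarrow>
     complete_measure M \<and>
     (\<forall>t\<in>{0..T}. subalgebra M (F t)) \<and>
     (\<forall>v\<in>{0..T}. \<forall>t\<in>{v..T}. sets (F v) \<subseteq> sets (F t)) \<and>
     null_sets M \<subseteq> sets (F 0) \<and>
     (\<forall>t\<in>{0..<T}. sets (F t) = (\<Inter>v\<in>{t<..T}. sets (F v)))"

definition generated_by :: "'a measure \<Rightarrow> 'i set \<Rightarrow> ('i \<Rightarrow> 'a \<Rightarrow> nat) \<Rightarrow> 'a measure" where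
  "generated_by M I X = sigma (space M) {X i -` B \<inter> space M | i B. i \<in> I}"

definition sigma_join :: "'a measure \<Rightarrow> 'a measure \<Rightarrow> 'a measure" where
  "sigma_join G H = sigma (space G) (sets G \<union> sets H)"

definition predictable_sigma :: "'a measure \<Rightarrow> real \<Rightarrow> (real \<Rightarrow> 'a measure) \<Rightarrow> (real \<times> 'a) measure" where
  "predictable_sigma M T F = sigma ({0..T} \<times> space M)
     ({{0} \<times> A | A. A \<in> sets (F 0)} \<union>
      {{a<..b} \<times> A | a b A. 0 \<le> a \<and> a < b \<and> b \<le> T \<and> A \<in> sets (F a)})"

definition predictable :: "'a measure \<Rightarrow> real \<Rightarrow> (real \<Rightarrow> 'a measure) \<Rightarrow> (real \<Rightarrow> 'a \<Rightarrow> real) \<Rightarrow> bool" where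
  "predictable M T F X \<longleftrightarrow> (\<lambda>(t, \<omega>). X t \<omega>) \<in> borel_measurable (predictable_sigma M T F)"

definition martingale_on :: "'a measure \<Rightarrow> real \<Rightarrow> (real \<Rightarrow> 'a measure) \<Rightarrow> (real \<Rightarrow> 'a \<Rightarrow> real) \<Rightarrow> bool" where
  "martingale_on M T F X \<longleftrightarrow>
     (\<forall>t\<in>{0..T}. X t \<in> borel_measurable (F t) \<and> integrable M (X t)) \<and>
     (\<forall>v\<in>{0..T}. \<forall>t\<in>{v..T}. AE \<omega> in M. real_cond_exp M (F v) (X t) \<omega> = X v \<omega>)"

text \<open>The intensity of an integrable counting process, through its compensator.\<close>

definition has_intensity ::
  "'a measure \<Rightarrow> real \<Rightarrow> (real \<Rightarrow> 'a measure) \<Rightarrow> (real \<Rightarrow> 'a \<Rightarrow> nat) \<Rightarrow> (real \<Rightarrow> 'a \<Rightarrow> real) \<Rightarrow> bool" where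
  "has_intensity M T F N \<nu> \<longleftrightarrow>
     predictable M T F \<nu> \<and>
     (\<forall>\<omega>\<in>space M. (\<forall>t\<in>{0..T}. 0 \<le> \<nu> t \<omega>) \<and> set_integrable lborel {0..T} (\<lambda>t. \<nu> t \<omega>)) \<and>
     martingale_on M T F (\<lambda>t \<omega>. real (N t \<omega>) - (LINT v:{0..t}|lborel. \<nu> v \<omega>))"

section \<open>Markov chains with given transition intensities\<close>

definition intensity_matrix :: "nat set \<Rightarrow> (nat \<Rightarrow> nat \<Rightarrow> real) \<Rightarrow> bool" where
  "intensity_matrix S a \<longleftrightarrow>
     (\<forall>i\<in>S. \<forall>j\<in>S. i \<noteq> j \<longrightarrow> 0 \<le> a i j) \<and>
     (\<forall>i\<in>S. a i i = - (\<Sum>j\<in>S - {i}. a i j))"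

text \<open>\<open>P v t i j\<close> is the probability of being in state \<open>j\<close> at time \<open>t\<close>, given state \<open>i\<close> at time \<open>v\<close>.\<close>

definition transition_matrices ::
  "nat set \<Rightarrow> real \<Rightarrow> real \<Rightarrow> (real \<Rightarrow> real \<Rightarrow> nat \<Rightarrow> nat \<Rightarrow> real) \<Rightarrow> bool" where
  "transition_matrices S a b P \<longleftrightarrow>
     (\<forall>v\<in>{a..b}. \<forall>t\<in>{v..b}. \<forall>i\<in>S. (\<forall>j\<in>S. 0 \<le> P v t i j) \<and> (\<Sum>j\<in>S. P v t i j) = 1) \<and>
     (\<forall>t\<in>{a..b}. \<forall>i\<in>S. \<forall>j\<in>S. P t t i j = of_bool (i = j)) \<and>
     (\<forall>v\<in>{a..b}. \<forall>t\<in>{v..b}. \<forall>w\<in>{t..b}. \<forall>i\<in>S. \<forall>j\<in>S.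
        P v w i j = (\<Sum>r\<in>S. P v t i r * P t w r j)) \<and>
     (\<forall>v\<in>{a..b}. \<forall>i\<in>S. \<forall>j\<in>S. continuous_on {v..b} (\<lambda>t. P v t i j))"

text \<open>\<open>P t (t + dt) i j = of_bool (i = j) + A t i j * dt + o(dt)\<close>.\<close>

definition has_generator ::
  "nat set \<Rightarrow> real \<Rightarrow> real \<Rightarrow> (real \<Rightarrow> real \<Rightarrow> nat \<Rightarrow> nat \<Rightarrow> real) \<Rightarrow> (real \<Rightarrow> nat \<Rightarrow> nat \<Rightarrow> real) \<Rightarrow> bool" where
  "has_generator S a b P A \<longleftrightarrow>
     (\<forall>t\<in>{a..<b}. \<forall>i\<in>S. \<forall>j\<in>S.
        ((\<lambda>d. (P t (t + d) i j - of_bool (i = j)) / d) \<longlongrightarrow> A t i j) (at_right 0))"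

text \<open>A Markov chain on \<open>[a, b]\<close> relative to the filtration \<open>G\<close>, whose generator may be random but
  is known at time \<open>a\<close>.  With a deterministic \<open>A\<close> this is an ordinary Markov chain relative to
  \<open>G\<close>.  With \<open>A\<close> measurable for some \<open>H\<close> and \<open>G v\<close> generated by \<open>H\<close> and the past of \<open>X\<close> up
  to \<open>v\<close>, it says that \<open>X\<close> is, conditionally on \<open>H\<close>, a Markov chain with generator \<open>A\<close>.  The
  transition matrices are determined by the path \<open>A \<omega>\<close> whenever that path is a right-continuous
  step function.\<close>

definition markov_chain_on ::
  "'a measure \<Rightarrow> (real \<Rightarrow> 'a measure) \<Rightarrow> real \<Rightarrow> real \<Rightarrow> nat set \<Rightarrow>
   ('a \<Rightarrow> real \<Rightarrow> nat \<Rightarrow> nat \<Rightarrow> real) \<Rightarrow> (real \<Rightarrow> 'a \<Rightarrow> nat) \<Rightarrow> bool" where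
  "markov_chain_on M G a b S A X \<longleftrightarrow>
     (\<forall>t\<in>{a..b}. X t \<in> measurable (G t) (count_space UNIV)) \<and>
     (\<forall>\<omega>\<in>space M. (\<forall>t\<in>{a..b}. X t \<omega> \<in> S) \<and> cadlag_on a b (\<lambda>t. X t \<omega>)) \<and>
     (\<exists>P. (\<forall>\<omega>\<in>space M. transition_matrices S a b (P \<omega>) \<and> has_generator S a b (P \<omega>) (A \<omega>)) \<and>
          (\<forall>v\<in>{a..b}. \<forall>t\<in>{v..b}. \<forall>j\<in>S. AE \<omega> in M.
             real_cond_exp M (G v) (\<lambda>\<omega>'. of_bool (X t \<omega>' = j)) \<omega> = P \<omega> v t (X v \<omega>) j))"

text \<open>The trivial choice \<open>A q = space M\<close> is allowed, so this covers all subfamilies.\<close>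

definition cond_indep_on :: "'a measure \<Rightarrow> 'a measure \<Rightarrow> ('q \<Rightarrow> 'a measure) \<Rightarrow> 'q set \<Rightarrow> bool" where
  "cond_indep_on M H G Q \<longleftrightarrow>
     (\<forall>A. (\<forall>q\<in>Q. A q \<in> sets (G q)) \<longrightarrow>
        (AE \<omega> in M. real_cond_exp M H (\<lambda>\<omega>'. \<Prod>q\<in>Q. indicat_real (A q) \<omega>') \<omega>
                   = (\<Prod>q\<in>Q. real_cond_exp M H (indicat_real (A q)) \<omega>)))"

section \<open>Aggregated rating processes\<close>

text \<open>Bond \<open>q \<in> Q\<close> is observed on \<open>[s q, u q]\<close>.  Because of the convention in \<open>left_lim\<close>, no jump
  is counted at the start \<open>s q\<close> of the observation period.\<close>

definition jump_count ::
  "'q set \<Rightarrow> ('q \<Rightarrow> real) \<Rightarrow> ('q \<Rightarrow> real) \<Rightarrow> ('q \<Rightarrow> real \<Rightarrow> 'a \<Rightarrow> nat) \<Rightarrow>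
   nat \<Rightarrow> nat \<Rightarrow> real \<Rightarrow> 'a \<Rightarrow> nat" where
  "jump_count Q s u Z i j t \<omega> =
     (\<Sum>q\<in>Q. card {v\<in>{0<..t}. s q \<le> v \<and> v < u q \<and>
                      left_lim (s q) (\<lambda>w. Z q w \<omega>) v = i \<and> Z q v \<omega> = j})"

definition exposure ::
  "'q set \<Rightarrow> ('q \<Rightarrow> real) \<Rightarrow> ('q \<Rightarrow> real) \<Rightarrow> ('q \<Rightarrow> real \<Rightarrow> 'a \<Rightarrow> nat) \<Rightarrow>
   nat \<Rightarrow> real \<Rightarrow> 'a \<Rightarrow> real" where
  "exposure Q s u Z i t \<omega> =
     real (card {q\<in>Q. s q \<le> t \<and> t < u q \<and> left_lim (s q) (\<lambda>w. Z q w \<omega>) t = i})"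

definition observed_filtration ::
  "'a measure \<Rightarrow> nat \<Rightarrow> (nat \<Rightarrow> nat \<Rightarrow> real \<Rightarrow> 'a \<Rightarrow> nat) \<Rightarrow> real \<Rightarrow> 'a measure" where
  "observed_filtration M p N t = sigma (space M)
     ({N i j v -` B \<inter> space M | i j v B. i \<in> {1..p} \<and> j \<in> {1..p} \<and> i \<noteq> j \<and> v \<in> {0..t}}
      \<union> null_sets M)"

section \<open>The hidden factor model\<close>

locale hidden_factor_model = prob_space M
  for M :: "'a measure"
  and T :: real and F :: "real \<Rightarrow> 'a measure"
  and m :: nat and k :: "nat \<Rightarrow> nat \<Rightarrow> real" and \<Theta> :: "real \<Rightarrow> 'a \<Rightarrow> nat"
  and p :: nat and ell :: "nat \<Rightarrow> nat \<Rightarrow> nat \<Rightarrow> real"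
  and Q :: "'q set" and s u :: "'q \<Rightarrow> real" and Z :: "'q \<Rightarrow> real \<Rightarrow> 'a \<Rightarrow> nat" +
  assumes horizon: "0 \<le> T"
    and usual: "usual_conditions M T F"
    and terminal: "sets (F T) = sets M"
    and factor_rates: "intensity_matrix {1..m} k"
    and factor_chain: "markov_chain_on M F 0 T {1..m} (\<lambda>\<omega> t. k) \<Theta>"
    and rating_rates: "\<forall>h\<in>{1..m}. intensity_matrix {1..p} (ell h)"
    and finite_bonds: "finite Q"
    and observation: "\<forall>q\<in>Q. 0 \<le> s q \<and> s q \<le> u q \<and> u q \<le> T"
    and ratings_adapted:
      "\<forall>q\<in>Q. \<forall>t\<in>{s q..u q}. Z q t \<in> measurable (F t) (count_space UNIV)"
    and ratings_chain:
      "\<forall>q\<in>Q. markov_chain_on M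
         (\<lambda>v. sigma_join (generated_by M {0..T} \<Theta>) (generated_by M {s q..v} (Z q)))
         (s q) (u q) {1..p} (\<lambda>\<omega> t. ell (\<Theta> t \<omega>)) (Z q)"
    and ratings_cond_indep:
      "cond_indep_on M (generated_by M {0..T} \<Theta>) (\<lambda>q. generated_by M {s q..u q} (Z q)) Q"
    and exposure_predictable:
      "\<forall>i\<in>{1..p}. predictable M T (observed_filtration M p (jump_count Q s u Z)) (exposure Q s u Z i)"
    and no_simultaneous_rating_jumps:
      "AE \<omega> in M. \<forall>q\<in>Q. \<forall>q'\<in>Q. \<forall>t\<in>{s q..u q} \<inter> {s q'..u q'}. q \<noteq> q' \<longrightarrow>
         left_lim (s q) (\<lambda>w. Z q w \<omega>) t = Z q t \<omega> \<or>
         left_lim (s q') (\<lambda>w. Z q' w \<omega>) t = Z q' t \<omega>"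
    and no_common_jumps:
      "AE \<omega> in M. \<forall>i\<in>{1..p}. \<forall>j\<in>{1..p}. \<forall>t\<in>{0..T}. i \<noteq> j \<longrightarrow>
         left_lim 0 (\<lambda>w. jump_count Q s u Z i j w \<omega>) t = jump_count Q s u Z i j t \<omega> \<or>
         left_lim 0 (\<lambda>w. \<Theta> w \<omega>) t = \<Theta> t \<omega>"
    and intensity:
      "\<forall>i\<in>{1..p}. \<forall>j\<in>{1..p}. i \<noteq> j \<longrightarrow>
         has_intensity M T F (jump_count Q s u Z i j)
           (\<lambda>t \<omega>. exposure Q s u Z i t \<omega> *
              (\<Sum>r=1..m. ell r i j * of_bool (left_lim 0 (\<lambda>w. \<Theta> w \<omega>) t = r)))"

text \<open>A cadlag version of the process \<open>t \<mapsto> E[1[\<Theta> t = h] | G t]\<close> on \<open>[0, T]\<close>.\<close>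

definition filtered_indicator ::
  "'a measure \<Rightarrow> real \<Rightarrow> (real \<Rightarrow> 'a measure) \<Rightarrow> (real \<Rightarrow> 'a \<Rightarrow> nat) \<Rightarrow> nat \<Rightarrow>
   (real \<Rightarrow> 'a \<Rightarrow> real) \<Rightarrow> bool" where
  "filtered_indicator M T G \<Theta> h X \<longleftrightarrow>
     (\<forall>t\<in>{0..T}. AE \<omega> in M. X t \<omega> = real_cond_exp M (G t) (\<lambda>\<omega>'. of_bool (\<Theta> t \<omega>' = h)) \<omega>) \<and>
     (AE \<omega> in M. cadlag_on 0 T (\<lambda>t. X t \<omega>))"

end

(* Fix h, let X be the right-hand side of the equation and D = X - \<pi>, where \<pi> is the filter of
   the indicator I of [\<Theta> = h].  On the observed filtration F^N the intensity of N^ij becomes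
   Y^i * (sum over r of ell^r,ij * \<pi>^r-), hence the increments of X - I after time s are orthogonal
   to F^N_s.  No martingale representation is needed to conclude: an event A of F^N_t is a functional
   of the path of N up to t, so its indicator is a constant plus the sum, over the jumps of N up to
   t, of bounded F^N-predictable increments d.  Multiplying by X - I and summing by parts along finer
   and finer grids gives, since \<Theta> does not jump with N and by the choice of the jumps of X,
     E[1_A D_t] = sum over (i, j) of E[integral over v <= t of d_v * (intensity of N^ij)_v * D_v- dv].
   With A = [D_t > 0] and A = [D_t < 0] this bounds E|D_t| by C * (integral over v <= t of E|D_v|), and
   Gronwall's lemma yields D = 0. *)

theory Submission
  imports Defs
begin

section \<open>Real analysis\<close>

text \<open>Why I and not \<pi> stands in the expectation: at a jump of N the jump of \<pi> is
  exactly what has to be found, whereas I does not jump there, and over an event of F^N_t the two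
  have the same expectation. At a jump of type e = (i, j) the error X - I is therefore X_- + gain -
  I_-. Let lam be the sum over r of ell^r,e \<pi>^r_-. Compensating with the F-intensity and
  projecting on F^N turns X_- + gain into (X_- + gain) Y lam, and I_- into ell^h,e \<pi>_- Y,
  because I_-^h selects the rate of state h. The gain satisfies gain lam = ell^h,e \<pi>_- - \<pi>_-
  lam, so the difference is lam Y (X_- - \<pi>_-), in which the gain no longer occurs. Since X is
  built from \<pi> itself, no uniqueness theorem for the nonlinear equation is involved; the
  comparison of X with \<pi> is linear in D. The obstacle is integrability: only first moments of
  the counts are used, so every majorant has to be linear in the total number of jumps.\<close>

lemma right_derivative_zero_const:
  fixes h :: "real \<Rightarrow> real"
  assumes ab: "a \<le> b" and ch: "continuous_on {a..b} h"
    and dh: "\<And>t. t \<in> {a..<b} \<Longrightarrow> ((\<lambda>d. (h (t + d) - h t) / d) \<longlongrightarrow> 0) (at_right 0)"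
  shows "h b = h a"
proof -
  have *: "\<bar>h b - h a\<bar> \<le> \<epsilon> * (b - a)" if e: "\<epsilon> > 0" for \<epsilon>
  proof (rule ccontr)
    \<comment> \<open>Only right derivatives exist, so the mean value theorem is out of reach.
      Instead take the last time c at which the bound with slope \<epsilon> holds; the vanishing
      right derivative at c yields a later such time.\<close>
    define w where "w t = \<bar>h t - h a\<bar> - \<epsilon> * (t - a)" for t
    assume "\<not> ?thesis"
    then have wb: "w b > 0" by (simp add: w_def)
    have cw: "continuous_on {a..b} w" unfolding w_def by (intro continuous_intros ch)
    define S where "S = {t \<in> {a..b}. w t \<le> 0}"
    have "closed S" unfolding S_def
      by (intro continuous_on_closed_Collect_le cw continuous_intros)
    moreover have "bounded S" by (rule bounded_subset[of "{a..b}"]) (auto simp: S_def)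
    ultimately have "compact S" using compact_eq_bounded_closed by blast
    moreover have "a \<in> S" using ab by (simp add: S_def w_def)
    ultimately obtain c where c: "c \<in> S" "\<And>t. t \<in> S \<Longrightarrow> t \<le> c"
      using compact_attains_sup[of S] by auto
    have cb: "c < b" using c(1) wb by (cases "c = b") (auto simp: S_def)
    have ca: "a \<le> c" using c by (auto simp: S_def)
    have "\<forall>\<^sub>F d in at_right 0. dist ((h (c + d) - h c) / d) 0 < \<epsilon>"
      using dh[of c] cb ca e by (auto simp: tendsto_iff)
    moreover have "\<forall>\<^sub>F d in at_right (0::real). d \<in> {0<..<b - c}"
      by (rule eventually_at_right_less[THEN eventually_rev_mp])
        (use cb in \<open>auto simp: eventually_at_right_field intro: exI[of _ "b - c"]\<close>)
    ultimately have "\<forall>\<^sub>F d in at_right 0. dist ((h (c + d) - h c) / d) 0 < \<epsilon> \<and> d \<in> {0<..<b - c}"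
      by eventually_elim auto
    then obtain d where d: "dist ((h (c + d) - h c) / d) 0 < \<epsilon>" "0 < d" "d < b - c"
      by (metis (no_types, lifting) eventually_happens' greaterThanLessThan_iff trivial_limit_at_right_real)
    have "\<bar>h (c + d) - h c\<bar> < \<epsilon> * d"
      using d by (simp add: abs_divide pos_divide_less_eq)
    then have "w (c + d) \<le> 0" using c(1) unfolding S_def w_def
      using abs_triangle_ineq[of "h (c + d) - h c" "h c - h a"] by (simp add: algebra_simps)
    then have "c + d \<in> S" using d ca by (auto simp: S_def)
    then show False using c(2) d by fastforce
  qed
  show ?thesis
  proof (rule ccontr)
    assume ne: "h b \<noteq> h a"
    then have "a < b" using ab by (cases "a = b") auto
    then show False using *[of "\<bar>h b - h a\<bar> / (2 * (b - a))"] ne by (simp add: field_simps)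
  qed
qed

text \<open>\<open>has_generator\<close> speaks of right derivatives only. The integral of g has
  right derivative g as well, so its difference from f is constant by
  \<open>right_derivative_zero_const\<close>.\<close>

lemma right_derivative_FTC:
  fixes f g :: "real \<Rightarrow> real"
  assumes ab: "a \<le> b" and cf: "continuous_on {a..b} f" and cg: "continuous_on {a..b} g"
    and df: "\<And>t. t \<in> {a..<b} \<Longrightarrow> ((\<lambda>d. (f (t + d) - f t) / d) \<longlongrightarrow> g t) (at_right 0)"
  shows "f b - f a = (LINT v:{a..b}|lborel. g v)"
proof -
  define G where "G t = integral {a..t} g" for t
  have dG: "(G has_real_derivative g t) (at t within {a..b})" if "t \<in> {a..b}" for t
    unfolding G_def by (rule integral_has_real_derivative[OF cg that])
  have cG: "continuous_on {a..b} G"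
    using dG DERIV_continuous continuous_on_eq_continuous_within by blast
  have "((\<lambda>d. (G (t + d) - G t) / d) \<longlongrightarrow> g t) (at_right 0)" if t: "t \<in> {a..<b}" for t
  proof -
    have "(G has_real_derivative g t) (at t within {t..b})"
      by (rule DERIV_subset[OF dG]) (use t in auto)
    then have "(G has_real_derivative g t) (at_right t)"
      using t by (simp add: at_within_Icc_at_right)
    then have "((\<lambda>y. (G y - G t) / (y - t)) \<longlongrightarrow> g t) (at_right t)"
      by (simp add: has_field_derivative_iff)
    then show ?thesis
      by (subst (asm) at_right_to_0) (simp add: filterlim_filtermap algebra_simps)
  qed
  then have "f b - G b = f a - G a"
    using tendsto_diff[OF df]
    by (intro right_derivative_zero_const[OF ab continuous_on_diff[OF cf cG]])
      (fastforce simp: algebra_simps diff_divide_distrib add_divide_distrib)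
  moreover have "G a = 0" by (simp add: G_def)
  moreover have "(LINT v:{a..b}|lborel. g v) = G b"
    unfolding G_def by (intro set_borel_integral_eq_integral borel_integrable_atLeastAtMost') (rule cg)
  ultimately show ?thesis by simp
qed

text \<open>By completeness every part of the exceptional null set is a null set of M and so belongs
  to H. This makes a filter that is given up to null sets adapted.\<close>

lemma borel_measurable_AE_eq:
  fixes f g :: "'a \<Rightarrow> 'b::topological_space"
  assumes "complete_measure M" and sub: "subalgebra M H" and null: "null_sets M \<subseteq> sets H"
    and g: "g \<in> borel_measurable H" and ae: "AE \<omega> in M. f \<omega> = g \<omega>"
  shows "f \<in> borel_measurable H"
proof (rule measurableI)
  interpret complete_measure M by fact
  have sp: "space H = space M" using sub by (simp add: subalgebra_def)
  fix B :: "'b set" assume B: "B \<in> sets borel"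
  obtain K where K: "{\<omega> \<in> space M. f \<omega> \<noteq> g \<omega>} \<subseteq> K" "K \<in> null_sets M"
    using ae unfolding eventually_ae_filter by auto
  have "f -` B \<inter> K \<inter> space M \<in> sets H"
    using null null_sets_subset[OF K(2), of "f -` B \<inter> K \<inter> space M"] complete[of "f -` B \<inter> K \<inter> space M" K] K(2)
    by blast
  moreover have "g -` B \<inter> space H - K \<in> sets H"
    using measurable_sets[OF g B] K null by auto
  moreover have "f -` B \<inter> space H = (g -` B \<inter> space H - K) \<union> (f -` B \<inter> K \<inter> space M)"
    using K(1) by (auto simp: sp)
  ultimately show "f -` B \<inter> space H \<in> sets H" by auto
qed auto

text \<open>No continuity of u is known, so the proof avoids derivatives: in the supremum weighted
  by \<open>exp (- 2 * D * v)\<close> the integral inequality gains a factor 1/2, and a finite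
  nonnegative supremum W with W \<le> W / 2 vanishes.\<close>

lemma gronwall_zero:
  fixes u :: "real \<Rightarrow> real"
  assumes C: "C \<ge> 0" and meas: "set_borel_measurable borel {0..T} u"
    and bnd: "\<And>t. t \<in> {0..T} \<Longrightarrow> 0 \<le> u t \<and> u t \<le> B"
    and le: "\<And>t. t \<in> {0..T} \<Longrightarrow> u t \<le> C * (LINT v:{0..t}|lborel. u v)"
    and t: "t \<in> {0..T}"
  shows "u t = 0"
proof -
  \<comment> \<open>C may be 0; D is a positive bound of it, so that the exponential can be
    integrated with a division by D.\<close>
  define D where "D = C + 1"
  have D0: "D > 0" using C by (simp add: D_def)
  define w where "w v = exp (- 2 * D * v) * u v" for v
  define W where "W = (SUP v\<in>{0..T}. w v)"
  have B: "B \<ge> 0" using bnd[OF t] by auto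
  have wB: "w v \<le> B" if "v \<in> {0..T}" for v
  proof -
    have "exp (- 2 * D * v) \<le> 1" using mult_nonneg_nonneg[of D v] that D0 by simp
    then have "exp (- 2 * D * v) * u v \<le> 1 * u v" by (rule mult_right_mono) (use bnd[OF that] in auto)
    then show ?thesis using bnd[OF that] by (simp add: w_def)
  qed
  have bdd: "bdd_above (w ` {0..T})" using wB by (auto intro!: bdd_aboveI[where M = B])
  have wW: "w v \<le> W" if "v \<in> {0..T}" for v
    unfolding W_def by (rule cSUP_upper[OF that bdd])
  have w0: "w v \<ge> 0" if "v \<in> {0..T}" for v using bnd[OF that] by (simp add: w_def)
  have W0: "W \<ge> 0" using w0[OF t] wW[OF t] by simp
  have uW: "u v \<le> W * exp (2 * D * v)" if "v \<in> {0..T}" for v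
    using wW[OF that] by (simp add: w_def exp_minus field_simps)
  have key: "w v \<le> W / 2" if v: "v \<in> {0..T}" for v
  proof -
    have int_e: "set_integrable lborel {0..v} (\<lambda>x. W * exp (2 * D * x))"
      by (intro borel_integrable_atLeastAtMost' continuous_intros)
    have mu: "set_borel_measurable borel {0..v} u"
    proof -
      have "(\<lambda>x. indicator {0..v} x *\<^sub>R u x) = (\<lambda>x. indicator {0..v} x *\<^sub>R (indicator {0..T} x *\<^sub>R u x))"
        using v by (auto simp: indicator_def)
      then show ?thesis using meas unfolding set_borel_measurable_def by simp
    qed
    have int_u: "set_integrable lborel {0..v} u"
      unfolding set_integrable_def
      by (rule Bochner_Integration.integrable_bound[OF int_e[unfolded set_integrable_def]])
        (use mu bnd uW v in \<open>auto simp: set_borel_measurable_def indicator_def intro!: AE_I2 order.trans[OF uW] abs_ge_self\<close>)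
    have "(LINT x:{0..v}|lborel. u x) \<le> (LINT x:{0..v}|lborel. W * exp (2 * D * x))"
      by (rule set_integral_mono[OF int_u int_e]) (use uW v in auto)
    also have "\<dots> = W * exp (2 * D * v) / (2 * D) - W * exp (2 * D * 0) / (2 * D)"
      unfolding set_lebesgue_integral_def real_scaleR_def
    proof (subst mult.commute, rule integral_FTC_Icc_real)
      show "((\<lambda>x. W * exp (2 * D * x) / (2 * D)) has_real_derivative W * exp (2 * D * x)) (at x)" for x
        using D0 by (auto intro!: derivative_eq_intros)
    qed (use v in \<open>auto intro!: continuous_intros\<close>)
    also have "\<dots> \<le> W * exp (2 * D * v) / (2 * D)" using W0 C by (simp add: D_def)
    finally have le1: "(LINT x:{0..v}|lborel. u x) \<le> W * exp (2 * D * v) / (2 * D)" .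
    have "u v \<le> C * (W * exp (2 * D * v) / (2 * D))"
      using order.trans[OF le[OF v] mult_left_mono[OF le1 C]] .
    also have "\<dots> \<le> D * (W * exp (2 * D * v) / (2 * D))"
      using C W0 by (intro mult_right_mono) (auto simp: D_def)
    also have "\<dots> = W * exp (2 * D * v) / 2" using D0 by simp
    finally show ?thesis by (simp add: w_def exp_minus field_simps)
  qed
  have "W \<le> W / 2" unfolding W_def by (rule cSUP_least) (use t key in \<open>auto simp: W_def\<close>)
  then have "W = 0" using W0 by simp
  then show ?thesis using uW[OF t] bnd[OF t] by simp
qed

lemma set_integral_singleton: "(LINT v:{a}|lborel. g v) = (0 :: real)"
proof -
  have "(\<lambda>v. indicator {a} v *\<^sub>R g v) = (\<lambda>v. indicator {a} v *\<^sub>R g a)" by (auto simp: indicator_def)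
  then show ?thesis unfolding set_lebesgue_integral_def by simp
qed

lemma summation_by_parts:
  fixes g e :: "nat \<Rightarrow> real"
  shows "(\<Sum>k\<le>n. (g (Suc k) - g k) * e (Suc k))
    = g (Suc n) * e (Suc n) - g 0 * e 0 - (\<Sum>k\<le>n. g k * (e (Suc k) - e k))"
  by (induction n) (simp_all add: algebra_simps)

lemma sum_atMost_telescope:
  fixes f :: "nat \<Rightarrow> real"
  shows "(\<Sum>k\<le>n. f (Suc k) - f k) = f (Suc n) - f 0"
  by (induction n) simp_all

section \<open>Cadlag paths and predictable processes\<close>

definition filtration_on :: "'a measure \<Rightarrow> real \<Rightarrow> (real \<Rightarrow> 'a measure) \<Rightarrow> bool" where
  "filtration_on M T F \<longleftrightarrow>
     (\<forall>t\<in>{0..T}. subalgebra M (F t)) \<and>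
     (\<forall>v\<in>{0..T}. \<forall>t\<in>{v..T}. sets (F v) \<subseteq> sets (F t))"

abbreviation leb :: "real \<Rightarrow> real measure" where
  "leb t \<equiv> restrict_space lborel {0..t}"

definition predictable_rectangles ::
  "real \<Rightarrow> (real \<Rightarrow> 'a measure) \<Rightarrow> (real \<times> 'a) set set" where
  "predictable_rectangles T F =
     {{0} \<times> A | A. A \<in> sets (F 0)} \<union>
      {{a<..b} \<times> A | a b A. 0 \<le> a \<and> a < b \<and> b \<le> T \<and> A \<in> sets (F a)}"

lemma filtration_onD:
  assumes "filtration_on M T F"
  shows "\<And>t. 0 \<le> t \<Longrightarrow> t \<le> T \<Longrightarrow> subalgebra M (F t)"
    and "\<And>t. 0 \<le> t \<Longrightarrow> t \<le> T \<Longrightarrow> space (F t) = space M"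
    and "\<And>v t. 0 \<le> v \<Longrightarrow> v \<le> t \<Longrightarrow> t \<le> T \<Longrightarrow> sets (F v) \<subseteq> sets (F t)"
    and "\<And>t. 0 \<le> t \<Longrightarrow> t \<le> T \<Longrightarrow> sets (F t) \<subseteq> sets M"
  using assms by (auto simp: filtration_on_def subalgebra_def)

lemma filtration_on_measurable_mono:
  assumes "filtration_on M T F" "0 \<le> v" "v \<le> t" "t \<le> T" "f \<in> measurable (F v) N"
  shows "f \<in> measurable (F t) N"
  using assms(5) filtration_onD(2)[OF assms(1), of v] filtration_onD(2)[OF assms(1), of t]
    filtration_onD(3)[OF assms(1-4)] assms(2-4)
  by (auto simp: measurable_def)

lemma filtration_on_measurable:
  assumes "filtration_on M T F" "0 \<le> v" "v \<le> T" "f \<in> measurable (F v) N"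
  shows "f \<in> measurable M N"
  using measurable_from_subalg[OF filtration_onD(1)[OF assms(1-3)] assms(4)] .

lemma predictable_rectangles_subset:
  assumes "0 \<le> T" "filtration_on M T F"
  shows "predictable_rectangles T F \<subseteq> Pow ({0..T} \<times> space M)"
proof -
  have "A \<subseteq> space M" if "A \<in> sets (F a)" "0 \<le> a" "a \<le> T" for A a
    using that filtration_onD(4)[OF assms(2), of a] sets.sets_into_space by blast
  then show ?thesis using assms(1) unfolding predictable_rectangles_def by fastforce
qed

lemma sets_predictable_sigma:
  assumes "0 \<le> T" "filtration_on M T F"
  shows "sets (predictable_sigma M T F) =
    sigma_sets ({0..T} \<times> space M) (predictable_rectangles T F)"
    and space_predictable_sigma: "space (predictable_sigma M T F) = {0..T} \<times> space M"
  using predictable_rectangles_subset[OF assms]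
  unfolding predictable_sigma_def predictable_rectangles_def by auto

text \<open>Two windows meet in a window that starts at the larger left end, where both base events
  are known by monotonicity of the filtration.\<close>

lemma Int_stable_predictable_rectangles:
  assumes "0 \<le> T" "filtration_on M T F"
  shows "Int_stable (predictable_rectangles T F)"
proof (rule Int_stableI)
  fix R S assume R: "R \<in> predictable_rectangles T F" and S: "S \<in> predictable_rectangles T F"
  have empty: "{} \<in> predictable_rectangles T F"
    unfolding predictable_rectangles_def by (intro UnI1 CollectI exI[of _ "{}"]) simp
  have *: "({0} \<times> A) \<inter> U \<in> predictable_rectangles T F"
    if A: "A \<in> sets (F 0)" and U: "U \<in> predictable_rectangles T F" for A U
  proof -
    from U consider B where "U = {0} \<times> B" "B \<in> sets (F 0)"
      | a b B where "U = {a<..b} \<times> B" "0 \<le> a"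
      unfolding predictable_rectangles_def by blast
    then show ?thesis
    proof cases
      case (1 B)
      then have "({0} \<times> A) \<inter> U = {0} \<times> (A \<inter> B)" by auto
      moreover have "A \<inter> B \<in> sets (F 0)" using A 1 by auto
      ultimately show ?thesis unfolding predictable_rectangles_def by blast
    next
      case 2
      then have "({0} \<times> A) \<inter> U = {}" by auto
      then show ?thesis using empty by simp
    qed
  qed
  from R consider (zero) A where "A \<in> sets (F 0)" "R = {0} \<times> A"
    | (Ioc) a b A where "R = {a<..b} \<times> A" "0 \<le> a" "a < b" "b \<le> T" "A \<in> sets (F a)"
    unfolding predictable_rectangles_def by blast
  then show "R \<inter> S \<in> predictable_rectangles T F"
  proof cases
    case zero
    then show ?thesis using * \<open>S \<in> predictable_rectangles T F\<close> by simp
  next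
    case R: (Ioc a b A)
    from S consider (zero) A where "A \<in> sets (F 0)" "S = {0} \<times> A"
      | (Ioc) a b A where "S = {a<..b} \<times> A" "0 \<le> a" "a < b" "b \<le> T" "A \<in> sets (F a)"
      unfolding predictable_rectangles_def by blast
    then show ?thesis
    proof cases
      case zero
      then show ?thesis using * \<open>R \<in> predictable_rectangles T F\<close> by (simp add: Int_commute)
    next
      case S: (Ioc a' b' A')
      show ?thesis
      proof (cases "max a a' < min b b'")
        case True
        have "A \<in> sets (F (max a a'))"
          using R S filtration_onD(3)[OF assms(2), of a "max a a'"] True by auto
        moreover have "A' \<in> sets (F (max a a'))"
          using R S filtration_onD(3)[OF assms(2), of a' "max a a'"] True by auto
        ultimately have "A \<inter> A' \<in> sets (F (max a a'))" by (rule sets.Int)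
        moreover have "R \<inter> S = {max a a'<..min b b'} \<times> (A \<inter> A')"
          unfolding R(1) S(1) by auto
        moreover have "0 \<le> max a a'" "min b b' \<le> T" using R S by auto
        ultimately show ?thesis using True unfolding predictable_rectangles_def by blast
      next
        case False
        then have "R \<inter> S = {}" unfolding R(1) S(1) by auto
        then show ?thesis using empty by simp
      qed
    qed
  qed
qed

text \<open>Restricted to times up to t, a rectangle that starts by time t has its base in H, and
  one that starts later disappears. H may exceed \<open>F t\<close>: the choice t = T and H = M
  gives measurability on the product space.\<close>

lemma predictable_imp_progressive:
  assumes T: "0 \<le> T" and F: "filtration_on M T F" and t: "0 \<le> t" "t \<le> T"
    and H: "space H = space M" "\<And>v. 0 \<le> v \<Longrightarrow> v \<le> t \<Longrightarrow> sets (F v) \<subseteq> sets H"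
    and X: "X \<in> measurable (predictable_sigma M T F) N"
  shows "X \<in> measurable (leb t \<Otimes>\<^sub>M H) N"
proof -
  have sp: "space (leb t \<Otimes>\<^sub>M H) = {0..t} \<times> space M"
    by (simp add: space_pair_measure space_restrict_space H)
  have "(\<lambda>z. z) \<in> measurable (leb t \<Otimes>\<^sub>M H) (predictable_sigma M T F)"
    unfolding predictable_sigma_def predictable_rectangles_def[symmetric]
  proof (rule measurable_measure_of)
    show "predictable_rectangles T F \<subseteq> Pow ({0..T} \<times> space M)"
      by (rule predictable_rectangles_subset[OF T F])
    show "(\<lambda>z. z) \<in> space (leb t \<Otimes>\<^sub>M H) \<rightarrow> {0..T} \<times> space M"
      using t by (auto simp: sp)
    fix R assume "R \<in> predictable_rectangles T F"
    then have "\<exists>I A a. R = I \<times> A \<and> I \<in> sets borel \<and> A \<in> sets (F a) \<and> 0 \<le> a \<and> I \<subseteq> {a..} \<and> a \<le> T"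
      unfolding predictable_rectangles_def
    proof (elim UnE CollectE exE conjE)
      fix A assume "R = {0} \<times> A" "A \<in> sets (F 0)"
      then show ?thesis using T by (intro exI[of _ "{0}"] exI[of _ A] exI[of _ 0]) auto
    next
      fix a b A assume "R = {a<..b} \<times> A" "0 \<le> a" "a < b" "b \<le> T" "A \<in> sets (F a)"
      then show ?thesis by (intro exI[of _ "{a<..b}"] exI[of _ A] exI[of _ a]) auto
    qed
    then obtain I A a where R: "R = I \<times> A" "I \<in> sets borel" "A \<in> sets (F a)" "0 \<le> a" "I \<subseteq> {a..}" "a \<le> T"
      by blast
    show "(\<lambda>z. z) -` R \<inter> space (leb t \<Otimes>\<^sub>M H) \<in> sets (leb t \<Otimes>\<^sub>M H)"
    proof (cases "a \<le> t")
      case True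
      have A: "A \<in> sets H" using H(2)[of a] True R by auto
      have "I \<inter> {0..t} \<in> sets (leb t)" using R by (auto simp: sets_restrict_space)
      then have "(I \<inter> {0..t}) \<times> A \<in> sets (leb t \<Otimes>\<^sub>M H)" using A by auto
      moreover have "A \<subseteq> space M" using sets.sets_into_space[OF A] H by auto
      then have "(\<lambda>z. z) -` R \<inter> space (leb t \<Otimes>\<^sub>M H) = (I \<inter> {0..t}) \<times> A"
        by (auto simp: sp R)
      ultimately show ?thesis by simp
    next
      case False
      then have "(\<lambda>z. z) -` R \<inter> space (leb t \<Otimes>\<^sub>M H) = {}"
        using R by (auto simp: sp)
      then show ?thesis by (metis sets.empty_sets)
    qed
  qed
  from measurable_compose[OF this X] show ?thesis by simp
qed

text \<open>Up to time t the integrand is measurable on the product of [0, t] with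
  \<open>F t\<close>, and integrating out the time keeps \<open>F t\<close>.\<close>

lemma progressive_integral_measurable:
  fixes f :: "real \<times> 'a \<Rightarrow> real"
  assumes T: "0 \<le> T" and F: "filtration_on M T F" and t: "0 \<le> t" "t \<le> T"
    and f: "f \<in> borel_measurable (predictable_sigma M T F)"
  shows "(\<lambda>\<omega>. LINT v:{0..t}|lborel. f (v, \<omega>)) \<in> borel_measurable (F t)"
proof -
  have sf: "sigma_finite_measure (leb t)"
    by (rule sigma_finite_measure_restrict_space) (auto simp: lborel.sigma_finite_measure_axioms)
  have "f \<in> borel_measurable (leb t \<Otimes>\<^sub>M F t)"
    by (rule predictable_imp_progressive[OF T F t _ _ f])
      (use filtration_onD(2,3)[OF F] t in auto)
  then have "(\<lambda>(\<omega>, v). f (v, \<omega>)) \<in> borel_measurable (F t \<Otimes>\<^sub>M leb t)"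
    by (subst (asm) measurable_pair_swap_iff) (simp add: case_prod_beta')
  then have "(\<lambda>\<omega>. LINT v|leb t. f (v, \<omega>)) \<in> borel_measurable (F t)"
    using sigma_finite_measure.borel_measurable_lebesgue_integral[OF sf, of "\<lambda>\<omega> v. f (v, \<omega>)"] by simp
  then show ?thesis
    by (subst (asm) integral_restrict_space) (auto simp: set_lebesgue_integral_def)
qed

lemma predictable_mono:
  assumes T: "0 \<le> T" and F: "filtration_on M T F" and G: "filtration_on M T G"
    and sub: "\<And>t. 0 \<le> t \<Longrightarrow> t \<le> T \<Longrightarrow> sets (G t) \<subseteq> sets (F t)"
    and X: "X \<in> measurable (predictable_sigma M T G) N"
  shows "X \<in> measurable (predictable_sigma M T F) N"
proof -
  have "R \<in> predictable_rectangles T F" if "R \<in> predictable_rectangles T G" for R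
    using that unfolding predictable_rectangles_def
  proof (elim UnE CollectE exE conjE)
    fix A assume "R = {0} \<times> A" "A \<in> sets (G 0)"
    then show "R \<in> {{0} \<times> A | A. A \<in> sets (F 0)} \<union>
      {{a<..b} \<times> A | a b A. 0 \<le> a \<and> a < b \<and> b \<le> T \<and> A \<in> sets (F a)}"
      using sub[of 0] T by blast
  next
    fix a b A assume *: "R = {a<..b} \<times> A" "0 \<le> a" "a < b" "b \<le> T" "A \<in> sets (G a)"
    then have "A \<in> sets (F a)" using sub[of a] by auto
    with * show "R \<in> {{0} \<times> A | A. A \<in> sets (F 0)} \<union>
      {{a<..b} \<times> A | a b A. 0 \<le> a \<and> a < b \<and> b \<le> T \<and> A \<in> sets (F a)}"
      by blast
  qed
  then have "predictable_rectangles T G \<subseteq> predictable_rectangles T F" by blast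
  then have "sets (predictable_sigma M T G) \<subseteq> sets (predictable_sigma M T F)"
    unfolding sets_predictable_sigma[OF T F] sets_predictable_sigma[OF T G]
    by (rule sigma_sets_mono')
  then show ?thesis using X
    by (auto simp: measurable_def space_predictable_sigma[OF T F] space_predictable_sigma[OF T G])
qed

lemma predictable_Ioc:
  assumes T: "0 \<le> T" and F: "filtration_on M T F" and a: "0 \<le> a" "b \<le> T"
    and g: "g \<in> borel_measurable (F a)"
  shows "(\<lambda>(t, \<omega>). indicator {a<..b} t * g \<omega> :: real) \<in> borel_measurable (predictable_sigma M T F)"
proof (cases "a < b")
  case ab: True
  have spa: "space (F a) = space M" using filtration_onD(2)[OF F] a ab by auto
  have rect: "{a<..b} \<times> A \<in> sets (predictable_sigma M T F)" if "A \<in> sets (F a)" for A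
    unfolding sets_predictable_sigma[OF T F] using that a ab
    by (intro sigma_sets.Basic) (auto simp: predictable_rectangles_def)
  show ?thesis
  proof (rule measurableI)
    fix B :: "real set" assume B: "B \<in> sets borel"
    let ?Z = "{a<..b} \<times> (g -` B \<inter> space M)"
    let ?W = "({0..T} \<times> space M) - {a<..b} \<times> space M"
    have "?Z \<in> sets (predictable_sigma M T F)"
      by (rule rect) (use measurable_sets[OF g B] spa in auto)
    moreover have "?W \<in> sets (predictable_sigma M T F)"
      using rect[of "space M"] sets.top[of "F a"] sets.top[of "predictable_sigma M T F"]
      by (auto simp: spa space_predictable_sigma[OF T F])
    moreover have "(\<lambda>(t, \<omega>). indicator {a<..b} t * g \<omega>) -` B \<inter> space (predictable_sigma M T F)
       = (if 0 \<in> B then ?Z \<union> ?W else ?Z)"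
      using a ab by (auto simp: space_predictable_sigma[OF T F] indicator_def of_bool_def split: if_splits)
    ultimately show "(\<lambda>(t, \<omega>). indicator {a<..b} t * g \<omega>) -` B \<inter> space (predictable_sigma M T F)
      \<in> sets (predictable_sigma M T F)" by auto
  qed auto
next
  case False
  then have "(\<lambda>(t, \<omega>). indicator {a<..b} t * g \<omega>) = (\<lambda>_. 0)" by auto
  then show ?thesis by simp
qed

lemma predictable_zero:
  assumes T: "0 \<le> T" and F: "filtration_on M T F"
    and g: "g \<in> borel_measurable (F 0)"
  shows "(\<lambda>(t, \<omega>). indicator {0} t * g \<omega> :: real) \<in> borel_measurable (predictable_sigma M T F)"
proof -
  have spa: "space (F 0) = space M" using filtration_onD(2)[OF F] T by auto
  have rect: "{0} \<times> A \<in> sets (predictable_sigma M T F)" if "A \<in> sets (F 0)" for A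
    unfolding sets_predictable_sigma[OF T F] using that
    by (intro sigma_sets.Basic) (auto simp: predictable_rectangles_def)
  show ?thesis
  proof (rule measurableI)
    fix B :: "real set" assume B: "B \<in> sets borel"
    let ?Z = "{0} \<times> (g -` B \<inter> space M)"
    let ?W = "({0..T} \<times> space M) - {0} \<times> space M"
    have "?Z \<in> sets (predictable_sigma M T F)"
      by (rule rect) (use measurable_sets[OF g B] spa in auto)
    moreover have "?W \<in> sets (predictable_sigma M T F)"
      using rect[of "space M"] sets.top[of "F 0"] sets.top[of "predictable_sigma M T F"]
      by (auto simp: spa space_predictable_sigma[OF T F])
    moreover have "(\<lambda>(t, \<omega>). indicator {0} t * g \<omega>) -` B \<inter> space (predictable_sigma M T F)
       = (if 0 \<in> B then ?Z \<union> ?W else ?Z)"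
      using T by (auto simp: space_predictable_sigma[OF T F] indicator_def of_bool_def split: if_splits)
    ultimately show "(\<lambda>(t, \<omega>). indicator {0} t * g \<omega>) -` B \<inter> space (predictable_sigma M T F)
      \<in> sets (predictable_sigma M T F)" by auto
  qed auto
qed

section \<open>Uniform grids and approximation by step processes\<close>

text \<open>Index of the grid cell that contains t, for n + 1 cells of equal length. Cells are open
  on the left and closed on the right, like the generators of the predictable sets, so a grid point
  belongs to the cell that it ends.\<close>

definition cell :: "real \<Rightarrow> nat \<Rightarrow> real \<Rightarrow> nat" where
  "cell T n t = nat (\<lceil>t * real (Suc n) / T\<rceil> - 1)"

lemma cell_eq_iff:
  assumes t: "0 < t" "t \<le> T"
  shows "k = cell T n t \<longleftrightarrow> t \<in> {real k * T / real (Suc n)<..real (Suc k) * T / real (Suc n)}"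
proof -
  have T: "T > 0" using t by simp
  define x where "x = t * real (Suc n) / T"
  have "x > 0" using t by (simp add: x_def)
  then have "k = nat (\<lceil>x\<rceil> - 1) \<longleftrightarrow> real k < x \<and> x \<le> real (Suc k)" by linarith
  also have "real k < x \<longleftrightarrow> real k * T / real (Suc n) < t"
    using T by (simp add: x_def field_simps del: of_nat_Suc)
  also have "x \<le> real (Suc k) \<longleftrightarrow> t \<le> real (Suc k) * T / real (Suc n)"
    using T by (simp add: x_def field_simps del: of_nat_Suc)
  finally show ?thesis by (simp add: cell_def x_def)
qed

lemma cell_bounds:
  assumes t: "0 < t" "t \<le> T"
  shows "real (cell T n t) * T / real (Suc n) < t" "t \<le> real (Suc (cell T n t)) * T / real (Suc n)"
    "t - T / real (Suc n) \<le> real (cell T n t) * T / real (Suc n)"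
    "real (Suc (cell T n t)) * T / real (Suc n) < t + T / real (Suc n)"
    "cell T n t \<le> n"
proof -
  have T: "T > 0" using t by simp
  show 1: "real (cell T n t) * T / real (Suc n) < t" and 2: "t \<le> real (Suc (cell T n t)) * T / real (Suc n)"
    using cell_eq_iff[OF t, of "cell T n t" n] by auto
  show "t - T / real (Suc n) \<le> real (cell T n t) * T / real (Suc n)"
    and "real (Suc (cell T n t)) * T / real (Suc n) < t + T / real (Suc n)"
    using 1 2 by (auto simp: add_divide_distrib distrib_right)
  have "real (cell T n t) * T / real (Suc n) < T" using 1 t by simp
  then have "real (cell T n t) < real (Suc n)" using T by (simp add: field_simps del: of_nat_Suc)
  then show "cell T n t \<le> n" by linarith
qed

lemma cell_sum:
  fixes a :: "nat \<Rightarrow> real"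
  assumes t: "0 < t" "t \<le> T"
  shows "(\<Sum>k\<le>n. indicator {real k * T / real (Suc n)<..real (Suc k) * T / real (Suc n)} t * a k)
    = a (cell T n t)"
proof -
  have "(\<Sum>k\<le>n. indicator {real k * T / real (Suc n)<..real (Suc k) * T / real (Suc n)} t * a k)
    = (\<Sum>k\<le>n. if k = cell T n t then a k else 0)"
    by (rule sum.cong) (auto simp: cell_eq_iff[OF t] indicator_def simp del: of_nat_Suc)
  then show ?thesis using cell_bounds(5)[OF t] by simp
qed

lemma cell_not_neg: "0 \<le> T \<Longrightarrow> \<not> real k * T / real (Suc n) < 0"
  by (simp add: not_less del: of_nat_Suc)

lemma grid_step_tendsto: "(\<lambda>n. T / real (Suc n)) \<longlonglongrightarrow> 0"
  by (rule LIMSEQ_Suc[OF lim_const_over_n])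

lemma cell_left_tendsto:
  assumes t: "0 < t" "t \<le> T"
  shows "filterlim (\<lambda>n. real (cell T n t) * T / real (Suc n)) (at_left t) sequentially"
  unfolding filterlim_at
proof (intro conjI eventuallyI)
  show "(\<lambda>n. real (cell T n t) * T / real (Suc n)) \<longlonglongrightarrow> t"
  proof (rule tendsto_sandwich)
    show "(\<lambda>n. t - T / real (Suc n)) \<longlonglongrightarrow> t"
      using tendsto_diff[OF tendsto_const grid_step_tendsto] by simp
    show "(\<lambda>n. t) \<longlonglongrightarrow> t" by simp
  qed (use cell_bounds[OF t] in \<open>auto intro!: always_eventually less_imp_le\<close>)
qed (use cell_bounds[OF t] in \<open>auto simp: less_imp_neq simp del: of_nat_Suc\<close>)

lemma cell_right_tendsto:
  fixes f :: "real \<Rightarrow> 'b::metric_space"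
  assumes t: "0 < t" "t \<le> T" and f: "t < T \<Longrightarrow> (f \<longlongrightarrow> f t) (at_right t)"
  shows "(\<lambda>n. f (real (Suc (cell T n t)) * T / real (Suc n))) \<longlonglongrightarrow> f t"
\<comment> \<open>At T no right limit is available; there the right end of the cell is T
  itself.\<close>
proof (cases "t = T")
  case True
  have "real (Suc (cell T n t)) * T / real (Suc n) = T" for n
  proof -
    have "cell T n t = n" using cell_eq_iff[OF t, of n n] t by (auto simp: True divide_simps)
    then show ?thesis by (simp del: of_nat_Suc)
  qed
  then show ?thesis using True by simp
next
  case False
  have lim: "(\<lambda>n. real (Suc (cell T n t)) * T / real (Suc n)) \<longlonglongrightarrow> t"
  proof (rule tendsto_sandwich)
    show "(\<lambda>n. t) \<longlonglongrightarrow> t" by simp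
    show "(\<lambda>n. t + T / real (Suc n)) \<longlonglongrightarrow> t"
      using tendsto_add[OF tendsto_const grid_step_tendsto] by simp
  qed (use cell_bounds(2)[OF t] less_imp_le[OF cell_bounds(4)[OF t]] in \<open>auto simp del: of_nat_Suc\<close>)
  \<comment> \<open>The right end of the cell may coincide with t, which \<open>at_right t\<close>
    does not see; this is why the final case distinction is made.\<close>
  show ?thesis
  proof (rule tendstoI)
    fix e :: real assume e: "e > 0"
    have "\<forall>\<^sub>F x in at_right t. dist (f x) (f t) < e" using f False t e by (auto simp: tendsto_iff)
    then obtain d where d: "d > t" "\<And>x. t < x \<Longrightarrow> x < d \<Longrightarrow> dist (f x) (f t) < e"
      by (auto simp: eventually_at_right_field)
    have "\<forall>\<^sub>F n in sequentially. real (Suc (cell T n t)) * T / real (Suc n) < d"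
      by (rule order_tendstoD(2)[OF lim d(1)])
    then show "\<forall>\<^sub>F n in sequentially. dist (f (real (Suc (cell T n t)) * T / real (Suc n))) (f t) < e"
    proof eventually_elim
      case (elim n)
      then show ?case using d(2)[OF _ elim] cell_bounds(2)[OF t, of n] e
        by (cases "real (Suc (cell T n t)) * T / real (Suc n) = t") (auto simp del: of_nat_Suc)
    qed
  qed
qed

text \<open>Holding the value at the left end of each cell until the cell ends gives elementary
  predictable processes. The left end approaches t strictly from below, so they converge to the left
  limit at every point.\<close>

lemma predictable_left_lim:
  assumes T: "0 \<le> T" and F: "filtration_on M T F"
    and g: "\<And>v. 0 \<le> v \<Longrightarrow> v \<le> T \<Longrightarrow> g v \<in> borel_measurable (F v)"
    and lim: "\<And>\<omega> t. \<omega> \<in> space M \<Longrightarrow> 0 < t \<Longrightarrow> t \<le> T \<Longrightarrow> \<exists>x. ((\<lambda>v. g v \<omega>) \<longlongrightarrow> x) (at_left t)"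
  shows "(\<lambda>(t, \<omega>). left_lim 0 (\<lambda>v. g v \<omega> :: real) t) \<in> borel_measurable (predictable_sigma M T F)"
proof (rule borel_measurable_LIMSEQ_real)
  let ?f = "\<lambda>n (t, \<omega>). indicator {0} t * g 0 \<omega> +
    (\<Sum>k\<le>n. indicator {real k * T / real (Suc n)<..real (Suc k) * T / real (Suc n)} t * g (real k * T / real (Suc n)) \<omega>)"
  show "?f n \<in> borel_measurable (predictable_sigma M T F)" for n
  proof -
    have le: "real (Suc k) * T / real (Suc n) \<le> T" "real k * T / real (Suc n) \<le> T" if "k \<le> n" for k
      using T that mult_right_mono[of "real (Suc k)" "real (Suc n)" T] mult_right_mono[of "real k" "real (Suc n)" T]
      by (auto simp: pos_divide_le_eq mult.commute simp del: of_nat_Suc)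
    have "(\<lambda>z. (\<lambda>(t, \<omega>). indicator {0} t * g 0 \<omega>) z + (\<Sum>k\<le>n. (\<lambda>(t, \<omega>). indicator {real k * T / real (Suc n)<..real (Suc k) * T / real (Suc n)} t * g (real k * T / real (Suc n)) \<omega>) z)) \<in> borel_measurable (predictable_sigma M T F)"
      by (intro borel_measurable_add borel_measurable_sum predictable_zero[OF T F] predictable_Ioc[OF T F] g)
        (use T le in \<open>auto simp del: of_nat_Suc\<close>)
    then show ?thesis by (simp add: case_prod_beta')
  qed
  fix z assume "z \<in> space (predictable_sigma M T F)"
  then obtain t \<omega> where z: "z = (t, \<omega>)" "0 \<le> t" "t \<le> T" "\<omega> \<in> space M"
    by (auto simp: space_predictable_sigma[OF T F])
  show "(\<lambda>n. ?f n z) \<longlonglongrightarrow> (case z of (t, \<omega>) \<Rightarrow> left_lim 0 (\<lambda>v. g v \<omega>) t)"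
  proof (cases "t = 0")
    case True
    then have "?f n z = g 0 \<omega>" for n by (simp add: z cell_not_neg[OF T] del: of_nat_Suc)
    then show ?thesis using True by (simp add: z left_lim_def)
  next
    case False
    then have t: "0 < t" "t \<le> T" using z by auto
    obtain x where x: "((\<lambda>v. g v \<omega>) \<longlongrightarrow> x) (at_left t)" using lim[OF z(4) t] by auto
    have "left_lim 0 (\<lambda>v. g v \<omega>) t = x"
      using t tendsto_Lim[OF _ x] by (simp add: left_lim_def)
    moreover have "?f n z = g (real (cell T n t) * T / real (Suc n)) \<omega>" for n
      using False cell_sum[OF t, of n "\<lambda>k. g (real k * T / real (Suc n)) \<omega>"] by (simp add: z)
    ultimately show ?thesis
      using filterlim_compose[OF x cell_left_tendsto[OF t]] by (simp add: z)
  qed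
qed

text \<open>Here each cell takes the value at its right end. This looks into the future, so the step
  processes are merely jointly measurable; they converge by right continuity.\<close>

lemma right_continuous_imp_jointly_measurable:
  assumes T: "0 \<le> T"
    and g: "\<And>v. 0 \<le> v \<Longrightarrow> v \<le> T \<Longrightarrow> g v \<in> borel_measurable M"
    and lim: "\<And>\<omega> t. \<omega> \<in> space M \<Longrightarrow> 0 \<le> t \<Longrightarrow> t < T \<Longrightarrow> ((\<lambda>v. g v \<omega>) \<longlongrightarrow> g t \<omega>) (at_right t)"
  shows "(\<lambda>(t, \<omega>). g t \<omega> :: real) \<in> borel_measurable (leb T \<Otimes>\<^sub>M M)"
proof (rule borel_measurable_LIMSEQ_real)
  let ?f = "\<lambda>n (t, \<omega>). indicator {0} t * g 0 \<omega> +
    (\<Sum>k\<le>n. indicator {real k * T / real (Suc n)<..real (Suc k) * T / real (Suc n)} t * g (real (Suc k) * T / real (Suc n)) \<omega>)"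
  show "?f n \<in> borel_measurable (leb T \<Otimes>\<^sub>M M)" for n
  proof -
    have le: "real (Suc k) * T / real (Suc n) \<le> T" if "k \<le> n" for k
      using T that mult_right_mono[of "real (Suc k)" "real (Suc n)" T] mult_right_mono[of "real k" "real (Suc n)" T]
      by (auto simp: pos_divide_le_eq mult.commute simp del: of_nat_Suc)
    have [measurable]: "g (real (Suc k) * T / real (Suc n)) \<in> borel_measurable M" if "k \<le> n" for k
      using le[OF that] T by (intro g) auto
    have [measurable]: "g 0 \<in> borel_measurable M" using T by (intro g) auto
    have [measurable]: "fst \<in> borel_measurable (leb T \<Otimes>\<^sub>M M)"
      by (rule measurable_compose[OF measurable_fst]) (auto intro: measurable_restrict_space1)
    have "(\<lambda>z. indicator {0} (fst z) * g 0 (snd z) +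
    (\<Sum>k\<in>{..n}. indicator {real k * T / real (Suc n)<..real (Suc k) * T / real (Suc n)} (fst z) * g (real (Suc k) * T / real (Suc n)) (snd z)))
       \<in> borel_measurable (leb T \<Otimes>\<^sub>M M)"
      by (intro borel_measurable_add borel_measurable_sum) measurable
    then show ?thesis by (simp add: case_prod_beta')
  qed
  fix z assume "z \<in> space (leb T \<Otimes>\<^sub>M M)"
  then obtain t \<omega> where z: "z = (t, \<omega>)" "0 \<le> t" "t \<le> T" "\<omega> \<in> space M"
    by (auto simp: space_pair_measure space_restrict_space)
  show "(\<lambda>n. ?f n z) \<longlonglongrightarrow> (case z of (t, \<omega>) \<Rightarrow> g t \<omega>)"
  proof (cases "t = 0")
    case True
    then have "?f n z = g 0 \<omega>" for n by (simp add: z cell_not_neg[OF T] del: of_nat_Suc)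
    then show ?thesis using True by (simp add: z)
  next
    case False
    then have t: "0 < t" "t \<le> T" using z by auto
    have "?f n z = g (real (Suc (cell T n t)) * T / real (Suc n)) \<omega>" for n
      using False cell_sum[OF t, of n "\<lambda>k. g (real (Suc k) * T / real (Suc n)) \<omega>"] by (simp add: z)
    then show ?thesis
      using cell_right_tendsto[OF t, of "\<lambda>v. g v \<omega>"] lim[OF z(4)] t by (simp add: z)
  qed
qed

lemma predictable_time:
  assumes T: "0 \<le> T" and F: "filtration_on M T F"
  shows "fst \<in> borel_measurable (predictable_sigma M T F)"
proof -
  have "(\<lambda>(t, \<omega>::'a). left_lim 0 (\<lambda>v. v) t :: real) \<in> borel_measurable (predictable_sigma M T F)"
    by (rule predictable_left_lim[OF T F, of "\<lambda>v \<omega>. v"]) auto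
  also have "?this \<longleftrightarrow> ?thesis"
  proof (rule measurable_cong)
    fix z assume "z \<in> space (predictable_sigma M T F)"
    then show "(case z of (t, \<omega>::'a) \<Rightarrow> left_lim 0 (\<lambda>v. v) t) = fst z"
      by (auto simp: space_predictable_sigma[OF T F] left_lim_def intro!: tendsto_Lim)
  qed
  finally show ?thesis .
qed

section \<open>Jumps of cadlag paths\<close>

text \<open>Infinitely many such jumps would accumulate at some t. On either side of t the path
  stays within e / 4 of its one-sided limit, and there both a left limit and a value are too close
  together to differ by e.\<close>

lemma cadlag_on_finite_jumps:
  fixes f :: "real \<Rightarrow> 'b::metric_space"
  assumes f: "cadlag_on a b f" and e: "e > 0"
  shows "finite {v\<in>{a<..b}. dist (left_lim a f v) (f v) \<ge> e}"
proof (rule ccontr)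
  let ?J = "{v\<in>{a<..b}. dist (left_lim a f v) (f v) \<ge> e}"
  assume "infinite ?J"
  moreover have "?J \<subseteq> {a..b}" by auto
  ultimately obtain t where t: "t \<in> {a..b}" "t islimpt ?J"
    using Heine_Borel_imp_Bolzano_Weierstrass[OF compact_Icc, of ?J a b] by blast
  have lim: "left_lim a f v = y" if "a < v" "(f \<longlongrightarrow> y) (at_left v)" for v y
    using that tendsto_Lim[of "at_left v" f y] by (simp add: left_lim_def)
  have small: "v \<notin> ?J" if v: "v \<in> {c<..<d}" "a \<le> c" "d \<le> b" and cd: "\<And>x. x \<in> {c<..<d} \<Longrightarrow> dist (f x) y < e / 4" for v c d y
  proof -
    obtain l where l: "(f \<longlongrightarrow> l) (at_left v)"
      using f v unfolding cadlag_on_def by force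
    have "dist l y \<le> e / 4"
    proof (rule tendsto_upperbound)
      show "((\<lambda>x. dist (f x) y) \<longlongrightarrow> dist l y) (at_left v)" by (intro tendsto_intros l)
      show "\<forall>\<^sub>F x in at_left v. dist (f x) y \<le> e / 4"
        using v cd by (auto simp: eventually_at_left_field intro!: exI[of _ c] less_imp_le)
    qed auto
    moreover have "dist (f v) y < e / 4" using cd v by auto
    ultimately have "dist l (f v) < e" using dist_triangle2[of l "f v" y] e by linarith
    then show ?thesis using lim[OF _ l] v by auto
  qed
  obtain d where d: "d > t" "\<And>v. t < v \<Longrightarrow> v < d \<Longrightarrow> v \<notin> ?J"
  proof (cases "t < b")
    case True
    then have "(f \<longlongrightarrow> f t) (at_right t)" using f t by (auto simp: cadlag_on_def)
    then have "\<forall>\<^sub>F x in at_right t. dist (f x) (f t) < e / 4" by (rule tendstoD) (use e in simp)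
    then obtain d where "d > t" "\<And>x. t < x \<Longrightarrow> x < d \<Longrightarrow> dist (f x) (f t) < e / 4"
      by (auto simp: eventually_at_right_field)
    then show ?thesis using small[of _ t "min d b" "f t"] t True by (intro that[of "min d b"]) auto
  next
    case False
    then show ?thesis using t by (intro that[of "t + 1"]) auto
  qed
  obtain c where c: "c < t" "\<And>v. c < v \<Longrightarrow> v < t \<Longrightarrow> v \<notin> ?J"
  proof (cases "a < t")
    case True
    then obtain y where "(f \<longlongrightarrow> y) (at_left t)"
      using f t unfolding cadlag_on_def by (meson atLeastAtMost_iff greaterThanAtMost_iff)
    then have "\<forall>\<^sub>F x in at_left t. dist (f x) y < e / 4" by (rule tendstoD) (use e in simp)
    then obtain c where "c < t" "\<And>x. c < x \<Longrightarrow> x < t \<Longrightarrow> dist (f x) y < e / 4"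
      by (auto simp: eventually_at_left_field)
    then show ?thesis using small[of _ "max c a" t y] t True by (intro that[of "max c a"]) auto
  next
    case False
    then show ?thesis using t by (intro that[of "t - 1"]) auto
  qed
  obtain v where "v \<in> ?J" "v \<in> {c<..<d}" "v \<noteq> t"
    using t(2)[unfolded islimpt_def, rule_format, of "{c<..<d}"] c(1) d(1) by auto
  then show False using c(2)[of v] d(2)[of v] by (cases "v < t") auto
qed

lemma cadlag_on_countable_jumps:
  fixes f :: "real \<Rightarrow> 'b::metric_space"
  assumes f: "cadlag_on a b f"
  shows "countable {v\<in>{a..b}. left_lim a f v \<noteq> f v}"
proof -
  have "{v\<in>{a..b}. left_lim a f v \<noteq> f v} \<subseteq>
      (\<Union>n. {v\<in>{a<..b}. dist (left_lim a f v) (f v) \<ge> inverse (real (Suc n))})"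
  proof
    fix v assume v: "v \<in> {v\<in>{a..b}. left_lim a f v \<noteq> f v}"
    then have "v \<noteq> a" by (auto simp: left_lim_def)
    moreover obtain n where "inverse (real (Suc n)) < dist (left_lim a f v) (f v)"
      using reals_Archimedean[of "dist (left_lim a f v) (f v)"] v by auto
    ultimately show "v \<in> (\<Union>n. {v\<in>{a<..b}. dist (left_lim a f v) (f v) \<ge> inverse (real (Suc n))})"
      using v by (intro UN_I[of n]) auto
  qed
  moreover have "countable (\<Union>n. {v\<in>{a<..b}. dist (left_lim a f v) (f v) \<ge> inverse (real (Suc n))})"
    by (rule countable_UN, simp, rule countable_finite, rule cadlag_on_finite_jumps[OF f], simp)
  ultimately show ?thesis by (rule countable_subset)
qed

lemma cadlag_on_left_lim_tendsto:
  assumes "cadlag_on a b f" "a < t" "t \<le> b"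
  shows "(f \<longlongrightarrow> left_lim a f t) (at_left t)"
proof -
  obtain x where "(f \<longlongrightarrow> x) (at_left t)" using assms unfolding cadlag_on_def by (meson greaterThanAtMost_iff)
  then show ?thesis using assms tendsto_Lim[of "at_left t" f x] by (simp add: left_lim_def)
qed

text \<open>Distinct naturals are at distance at least 1, so every jump of the corresponding real
  path is a large one.\<close>

lemma cadlag_on_nat_finite_jumps:
  fixes f :: "real \<Rightarrow> nat"
  assumes f: "cadlag_on a b f"
  shows "finite {v\<in>{a<..b}. left_lim a f v \<noteq> f v}"
proof -
  let ?g = "\<lambda>v. real (f v)"
  have real_lim: "((\<lambda>v. real (f v)) \<longlongrightarrow> real x) F" if "(f \<longlongrightarrow> x) F" for x and F :: "real filter"
    by (rule tendsto_eventually) (use that in \<open>auto simp: tendsto_discrete elim: eventually_mono\<close>)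
  have "cadlag_on a b ?g" using f real_lim unfolding cadlag_on_def by blast
  from cadlag_on_finite_jumps[OF this, of 1]
  have fin: "finite {v\<in>{a<..b}. 1 \<le> dist (left_lim a ?g v) (?g v)}" by simp
  have ge: "1 \<le> dist (left_lim a ?g v) (?g v)" if v: "v \<in> {a<..b}" "left_lim a f v \<noteq> f v" for v
  proof -
    have "left_lim a ?g v = real (left_lim a f v)"
      using real_lim[OF cadlag_on_left_lim_tendsto[OF f, of v]] v by (simp add: left_lim_def tendsto_Lim)
    then show ?thesis using v(2) by (auto simp: dist_real_def)
  qed
  show ?thesis by (rule finite_subset[OF _ fin]) (use ge in blast)
qed

text \<open>A value outside the interval would persist to the right of t and hence be taken at some
  rational. T is listed apart because right continuity gives nothing there.\<close>

lemma cadlag_on_rational_bounds: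
  fixes f :: "real \<Rightarrow> real"
  assumes f: "cadlag_on 0 T f" and q: "\<And>q. q \<in> \<rat> \<Longrightarrow> 0 \<le> q \<Longrightarrow> q \<le> T \<Longrightarrow> f q \<in> {a..b}" and T: "f T \<in> {a..b}"
    and t: "0 \<le> t" "t \<le> T"
  shows "f t \<in> {a..b}"
proof (rule ccontr)
  assume nt: "f t \<notin> {a..b}"
  then have tT: "t < T" using T t by (cases "t = T") auto
  then have "(f \<longlongrightarrow> f t) (at_right t)" using f t by (simp add: cadlag_on_def)
  then have "\<forall>\<^sub>F v in at_right t. f v \<in> - {a..b}"
    by (rule topological_tendstoD) (use nt in auto)
  then obtain d where d: "t < d" "\<And>v. t < v \<Longrightarrow> v < d \<Longrightarrow> f v \<in> - {a..b}"
    by (auto simp: eventually_at_right_field)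
  obtain x where "x \<in> \<rat>" "t < x" "x < min d T"
    using Rats_dense_in_real[of t "min d T"] d(1) tT by auto
  then show False using d(2)[of x] q[of x] t by auto
qed

text \<open>Monotone class argument tailored to sums over jumps: disjoint unions are derived from
  \<open>add\<close> and \<open>seq\<close>, so that among sets an application has to treat
  rectangles and complements only.\<close>

lemma predictable_nn_induct[consumes 3, case_names cong rectangle compl mult add seq]:
  fixes f :: "real \<times> 'a \<Rightarrow> ennreal"
  assumes T: "0 \<le> T" and F: "filtration_on M T F"
    and f: "f \<in> borel_measurable (predictable_sigma M T F)"
    and cong: "\<And>f g. (\<And>t \<omega>. 0 \<le> t \<Longrightarrow> t \<le> T \<Longrightarrow> \<omega> \<in> space M \<Longrightarrow> f (t, \<omega>) = g (t, \<omega>)) \<Longrightarrow> P f \<Longrightarrow> P g"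
    and rectangle: "\<And>R. R \<in> predictable_rectangles T F \<Longrightarrow> P (indicator R)"
    and compl: "\<And>A. A \<in> sets (predictable_sigma M T F) \<Longrightarrow> P (indicator A) \<Longrightarrow>
      P (indicator ({0..T} \<times> space M - A))"
    and mult: "\<And>u c. u \<in> borel_measurable (predictable_sigma M T F) \<Longrightarrow> P u \<Longrightarrow> P (\<lambda>z. c * u z)"
    and add: "\<And>u v. u \<in> borel_measurable (predictable_sigma M T F) \<Longrightarrow> P u \<Longrightarrow>
      v \<in> borel_measurable (predictable_sigma M T F) \<Longrightarrow> P v \<Longrightarrow> P (\<lambda>z. u z + v z)"
    and seq: "\<And>U. (\<And>i. U i \<in> borel_measurable (predictable_sigma M T F)) \<Longrightarrow> (\<And>i::nat. P (U i)) \<Longrightarrow>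
      incseq U \<Longrightarrow> P (\<lambda>z. SUP i. U i z)"
  shows "P f"
proof -
  let ?Pr = "predictable_sigma M T F"
  have empty: "P (indicator {})"
    by (rule rectangle) (auto simp: predictable_rectangles_def)
  have sets_P: "P (indicator A)" if A: "A \<in> sets ?Pr" for A
    using Int_stable_predictable_rectangles[OF T F] predictable_rectangles_subset[OF T F]
      A[unfolded sets_predictable_sigma[OF T F]]
  proof (induction rule: sigma_sets_induct_disjoint)
    case (basic A)
    then show ?case by (rule rectangle)
  next
    case empty
    show ?case by fact
  next
    case (compl A)
    then show ?case by (intro assms(6)) (auto simp: sets_predictable_sigma[OF T F])
  next
    case (union A)
    have meas: "A i \<in> sets ?Pr" for i using union(2) by (auto simp: sets_predictable_sigma[OF T F])
    \<comment> \<open>The indicator of a disjoint union is the increasing limit of partial sums of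
      indicators.\<close>
    have fin: "P (\<lambda>z. \<Sum>i<n. indicator (A i) z)" for n
    proof (induction n)
      case 0
      have "indicator {} = (\<lambda>z :: real \<times> 'a. 0 :: ennreal)" by auto
      then show ?case using empty by simp
    next
      case (Suc n)
      have "P (\<lambda>z. (\<Sum>i<n. indicator (A i) z) + indicator (A n) z)"
        by (rule add) (use meas Suc union in auto)
      then show ?case by simp
    qed
    have "P (\<lambda>z. SUP n. \<Sum>i<n. indicator (A i) z)"
      by (rule seq) (use meas fin in \<open>auto intro!: borel_measurable_sum incseq_SucI simp: le_fun_def\<close>)
    moreover have "(\<lambda>z. SUP n. \<Sum>i<n. indicator (A i) z :: ennreal) = indicator (\<Union>i. A i)"
      by (rule ext) (simp only: suminf_eq_SUP[symmetric] suminf_indicator[OF union(1)])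
    ultimately show ?case by simp
  qed
  show ?thesis
    using f
  proof (induction rule: borel_measurable_induct)
    case (cong f g)
    show ?case by (rule assms(4)[of g]) (use cong in \<open>auto simp: space_predictable_sigma[OF T F]\<close>)
  next
    case (set A)
    then show ?case by (rule sets_P)
  next
    case (mult u c)
    then show ?case by (intro assms(7))
  next
    case (add u v)
    then show ?case by (intro assms(8))
  next
    case (seq U)
    then have "P (\<lambda>z. SUP i. U i z)" by (intro assms(9)) auto
    then show ?case by (simp add: image_image SUP_apply[abs_def])
  qed
qed

lemma nn_integral_count_space_cmult_indicator:
  assumes "finite A" "S \<subseteq> A"
  shows "(\<integral>\<^sup>+x. c * indicator S x \<partial>count_space A) = c * ennreal (real (card S))"
proof -
  have "(\<integral>\<^sup>+x. c * indicator S x \<partial>count_space A) = c * emeasure (count_space A) S"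
    by (rule nn_integral_cmult_indicator) (use assms in simp)
  also have "emeasure (count_space A) S = of_nat (card S)"
    by (rule emeasure_count_space_finite) (use assms finite_subset in auto)
  finally show ?thesis unfolding ennreal_of_nat_eq_real_of_nat .
qed

section \<open>Counting measures and Markov chains\<close>

text \<open>A jump is a pair of a label and a time. The label, a bond in the application, keeps
  jumps at equal times apart in the cardinality.\<close>

definition jumps_upto :: "('q \<times> real) set \<Rightarrow> real \<Rightarrow> nat" where
  "jumps_upto J t = card {x \<in> J. snd x \<le> t}"

lemma jumps_upto_mono:
  assumes "finite J" "s \<le> t" shows "jumps_upto J s \<le> jumps_upto J t"
  unfolding jumps_upto_def by (rule card_mono) (use assms in auto)

lemma jumps_upto_diff:
  assumes "finite J" "s \<le> t"
  shows "real (card {x \<in> J. s < snd x \<and> snd x \<le> t}) = real (jumps_upto J t) - real (jumps_upto J s)"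
proof -
  have "{x \<in> J. snd x \<le> t} = {x \<in> J. snd x \<le> s} \<union> {x \<in> J. s < snd x \<and> snd x \<le> t}" using assms by auto
  then have "jumps_upto J t = jumps_upto J s + card {x \<in> J. s < snd x \<and> snd x \<le> t}"
    unfolding jumps_upto_def using assms by (simp add: card_Un_disjoint disjoint_iff)
  then show ?thesis by simp
qed

text \<open>The filter equation is stated with Stieltjes measures of counting paths. Such a measure
  is the image of the counting measure on the jumps, because both are finite and have the same
  distribution function.\<close>

lemma interval_measure_jumps:
  fixes J :: "('q \<times> real) set"
  assumes J: "finite J"
  shows "interval_measure (\<lambda>w. real (jumps_upto J w)) = distr (count_space J) borel snd"
proof (rule cdf_unique')
  let ?F = "\<lambda>w. real (jumps_upto J w)"
  have mono: "?F x \<le> ?F y" if "x \<le> y" for x y using jumps_upto_mono[OF J that] by simp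
  have right: "continuous (at_right a) ?F" for a
  proof -
    have "\<forall>\<^sub>F v in at_right a. \<forall>x\<in>{x\<in>J. a < snd x}. v < snd x"
    proof (rule eventually_ball_finite)
      show "finite {x\<in>J. a < snd x}" using J by auto
      show "\<forall>x\<in>{x \<in> J. a < snd x}. \<forall>\<^sub>F v in at_right a. v < snd x"
        by (auto simp: eventually_at_right_field intro!: exI)
    qed
    moreover have "\<forall>\<^sub>F v in at_right a. a < v" by (simp add: eventually_at_filter)
    ultimately have "\<forall>\<^sub>F v in at_right a. ?F v = ?F a"
    proof eventually_elim
      case (elim v)
      then have "{x \<in> J. snd x \<le> v} = {x \<in> J. snd x \<le> a}" by force
      then show ?case by (simp add: jumps_upto_def)
    qed
    then show ?thesis by (auto simp: continuous_within intro: tendsto_eventually)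
  qed
  obtain B where B: "\<And>x. x \<in> J \<Longrightarrow> \<bar>snd x\<bar> \<le> B"
    using finite_imp_bounded[OF finite_imageI[OF J, of snd]] by (auto simp: bounded_iff)
  have bot: "(?F \<longlongrightarrow> 0) at_bot"
  proof (rule tendsto_eventually)
    show "\<forall>\<^sub>F w in at_bot. ?F w = 0"
      unfolding eventually_at_bot_dense
    proof (intro exI allI impI)
      fix w assume w: "w < - B"
      have "{x \<in> J. snd x \<le> w} = {}" using B w by fastforce
      then show "?F w = 0" unfolding jumps_upto_def by (simp only: card.empty of_nat_0)
    qed
  qed
  have top: "(?F \<longlongrightarrow> real (card J)) at_top"
  proof (rule tendsto_eventually)
    show "\<forall>\<^sub>F w in at_top. ?F w = real (card J)"
      unfolding eventually_at_top_dense
    proof (intro exI allI impI)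
      fix w assume w: "B < w"
      have "{x \<in> J. snd x \<le> w} = J" using B w by fastforce
      then show "?F w = real (card J)" unfolding jumps_upto_def by (simp only:)
    qed
  qed
  show "finite_borel_measure (interval_measure ?F)"
    by (rule finite_borel_measure_interval_measure[OF mono right bot top]) simp_all
  interpret C: finite_measure "count_space J" by (rule finite_measure_count_space[OF J])
  have snd: "snd \<in> measurable (count_space J) borel" by simp
  interpret D: finite_measure "distr (count_space J) borel snd" by (rule C.finite_measure_distr[OF snd])
  show "finite_borel_measure (distr (count_space J) borel snd)" by unfold_locales simp
  show "cdf (interval_measure ?F) = cdf (distr (count_space J) borel snd)"
  proof
    fix w
    have "cdf (distr (count_space J) borel snd) w = measure (count_space J) (snd -` {..w} \<inter> J)"
      unfolding cdf_def by (subst measure_distr) auto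
    also have "\<dots> = real (card {x \<in> J. snd x \<le> w})"
    proof -
      have "snd -` {..w} \<inter> J = {x \<in> J. snd x \<le> w}" by auto
      then show ?thesis using J by (simp add: measure_count_space)
    qed
    also have "\<dots> = cdf (interval_measure ?F) w"
      unfolding cdf_def by (subst measure_interval_measure_Iic[OF mono right bot]) (auto simp: jumps_upto_def)
    finally show "cdf (interval_measure ?F) w = cdf (distr (count_space J) borel snd) w" by simp
  qed
qed

lemma integral_interval_measure_jumps:
  fixes J :: "('q \<times> real) set" and f :: "real \<Rightarrow> real"
  assumes J: "finite J" "\<And>x. x \<in> J \<Longrightarrow> 0 < snd x"
    and f: "(\<lambda>v. indicator {0<..t} v * f v) \<in> borel_measurable borel"
  shows "(LINT v:{0<..t}|interval_measure (\<lambda>w. real (jumps_upto J w)). f v) = (\<Sum>x\<in>{x\<in>J. snd x \<le> t}. f (snd x))"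
proof -
  have "(LINT v:{0<..t}|interval_measure (\<lambda>w. real (jumps_upto J w)). f v)
    = (LINT x|count_space J. indicator {0<..t} (snd x) * f (snd x))"
    unfolding set_lebesgue_integral_def interval_measure_jumps[OF J(1)] real_scaleR_def
    by (rule integral_distr) (use f in auto)
  also have "\<dots> = (\<Sum>x\<in>J. indicator {0<..t} (snd x) * f (snd x))"
    by (rule lebesgue_integral_count_space_finite[OF J(1)])
  also have "\<dots> = (\<Sum>x\<in>{x\<in>J. snd x \<le> t}. f (snd x))"
    by (rule sum.mono_neutral_cong_right) (use J in \<open>auto simp: indicator_def\<close>)
  finally show ?thesis .
qed

section \<open>Transition matrices and the forward equation\<close>

lemma transition_matricesD:
  assumes P: "transition_matrices S a b P"
  shows "\<And>v t i j. a \<le> v \<Longrightarrow> v \<le> t \<Longrightarrow> t \<le> b \<Longrightarrow> i \<in> S \<Longrightarrow> j \<in> S \<Longrightarrow> 0 \<le> P v t i j"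
    and "\<And>v t i. a \<le> v \<Longrightarrow> v \<le> t \<Longrightarrow> t \<le> b \<Longrightarrow> i \<in> S \<Longrightarrow> (\<Sum>j\<in>S. P v t i j) = 1"
    and "\<And>t i j. a \<le> t \<Longrightarrow> t \<le> b \<Longrightarrow> i \<in> S \<Longrightarrow> j \<in> S \<Longrightarrow> P t t i j = of_bool (i = j)"
    and "\<And>v t w i j. a \<le> v \<Longrightarrow> v \<le> t \<Longrightarrow> t \<le> w \<Longrightarrow> w \<le> b \<Longrightarrow> i \<in> S \<Longrightarrow> j \<in> S \<Longrightarrow>
      P v w i j = (\<Sum>r\<in>S. P v t i r * P t w r j)"
    and "\<And>v i j. a \<le> v \<Longrightarrow> v \<le> b \<Longrightarrow> i \<in> S \<Longrightarrow> j \<in> S \<Longrightarrow> continuous_on {v..b} (\<lambda>t. P v t i j)"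
proof -
  note d = P[unfolded transition_matrices_def]
  note 1 = conjunct1[OF d] and 2 = conjunct1[OF conjunct2[OF d]]
    and 3 = conjunct1[OF conjunct2[OF conjunct2[OF d]]] and 4 = conjunct2[OF conjunct2[OF conjunct2[OF d]]]
  show "0 \<le> P v t i j" if "a \<le> v" "v \<le> t" "t \<le> b" "i \<in> S" "j \<in> S" for v t i j using 1 that by simp
  show "(\<Sum>j\<in>S. P v t i j) = 1" if "a \<le> v" "v \<le> t" "t \<le> b" "i \<in> S" for v t i using 1 that by simp
  show "P t t i j = of_bool (i = j)" if "a \<le> t" "t \<le> b" "i \<in> S" "j \<in> S" for t i j using 2 that by simp
  show "P v w i j = (\<Sum>r\<in>S. P v t i r * P t w r j)"
    if "a \<le> v" "v \<le> t" "t \<le> w" "w \<le> b" "i \<in> S" "j \<in> S" for v t w i j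
    by (rule 3[rule_format]) (use that in auto)
  show "continuous_on {v..b} (\<lambda>t. P v t i j)" if "a \<le> v" "v \<le> b" "i \<in> S" "j \<in> S" for v i j using 4 that by simp
qed

lemma transition_matrices_le_1:
  assumes P: "transition_matrices S a b P" and "a \<le> v" "v \<le> t" "t \<le> b" "i \<in> S" "j \<in> S" "finite S"
  shows "P v t i j \<le> 1"
  using member_le_sum[of j S "P v t i"] transition_matricesD(1,2)[OF P assms(2-5)] assms(6,7) by simp

text \<open>By Chapman-Kolmogorov, going on from u to u + d multiplies by
  \<open>P u (u + d)\<close>, so the right derivative at u is \<open>P v u\<close> times the
  generator. As probabilities are at most 1, it is bounded by a column sum of the absolute rates.
  The bound is uniform over transition matrices, hence over \<omega>, and serves as the dominating
  constant in the forward equation.\<close>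

lemma transition_increment_bound:
  assumes P: "transition_matrices S a b P" and gen: "has_generator S a b P (\<lambda>t. k)" and S: "finite S"
    and v: "a \<le> v" "v \<le> t" "t \<le> b" and ij: "i \<in> S" "j \<in> S"
  shows "\<bar>P v t i j - of_bool (i = j)\<bar> \<le> (\<Sum>r\<in>S. \<bar>k r j\<bar>) * (t - v)"
proof -
  let ?g = "\<lambda>u. \<Sum>r\<in>S. P v u i r * k r j"
  have cont: "continuous_on {v..t} (\<lambda>u. P v u i r)" if "r \<in> S" for r
  proof (rule continuous_on_subset)
    show "continuous_on {v..b} (\<lambda>u. P v u i r)"
      by (rule transition_matricesD(5)[OF P]) (use v ij that in auto)
  qed (use v in auto)
  have deriv: "((\<lambda>d. (P v (u + d) i j - P v u i j) / d) \<longlongrightarrow> ?g u) (at_right 0)" if u: "u \<in> {v..<t}" for u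
  proof -
    have "((\<lambda>d. \<Sum>r\<in>S. P v u i r * ((P u (u + d) r j - of_bool (r = j)) / d)) \<longlongrightarrow> ?g u) (at_right 0)"
      using gen u v ij unfolding has_generator_def by (intro tendsto_sum tendsto_mult tendsto_const) auto
    moreover have "\<forall>\<^sub>F d in at_right 0. d \<in> {0<..<t - u}"
      by (rule eventually_at_rightI[of _ "t - u"]) (use u in auto)
    then have "\<forall>\<^sub>F d in at_right 0. (\<Sum>r\<in>S. P v u i r * ((P u (u + d) r j - of_bool (r = j)) / d)) = (P v (u + d) i j - P v u i j) / d"
    proof eventually_elim
      case (elim d)
      have "P v (u + d) i j = (\<Sum>r\<in>S. P v u i r * P u (u + d) r j)"
        by (rule transition_matricesD(4)[OF P]) (use u v ij elim in auto)
      moreover have "P v u i j = (\<Sum>r\<in>S. P v u i r * of_bool (r = j))"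
        using ij S by (simp add: of_bool_def if_distrib sum.delta' cong: if_cong)
      ultimately have "P v (u + d) i j - P v u i j = (\<Sum>r\<in>S. P v u i r * (P u (u + d) r j - of_bool (r = j)))"
        by (simp only: right_diff_distrib sum_subtractf)
      then show ?case by (simp only: times_divide_eq_right sum_divide_distrib)
    qed
    ultimately show ?thesis by (rule Lim_transform_eventually)
  qed
  have cg: "continuous_on {v..t} ?g" by (intro continuous_on_sum continuous_on_mult continuous_on_const cont)
  have "P v t i j - P v v i j = (LINT u:{v..t}|lborel. ?g u)"
    by (rule right_derivative_FTC[OF v(2) cont[OF ij(2)] cg deriv])
  moreover have "P v v i j = of_bool (i = j)" by (rule transition_matricesD(3)[OF P]) (use v ij in auto)
  moreover have "\<bar>LINT u:{v..t}|lborel. ?g u\<bar> \<le> (\<Sum>r\<in>S. \<bar>k r j\<bar>) * (t - v)"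
  proof -
    have "\<bar>LINT u:{v..t}|lborel. ?g u\<bar> \<le> (LINT u:{v..t}|lborel. \<bar>?g u\<bar>)"
      using set_integral_norm_bound[OF borel_integrable_atLeastAtMost'[OF cg]] by simp
    also have "\<dots> \<le> (LINT u:{v..t}|lborel. (\<Sum>r\<in>S. \<bar>k r j\<bar>))"
    proof (rule set_integral_mono)
      show "set_integrable lborel {v..t} (\<lambda>u. \<bar>?g u\<bar>)"
        by (intro borel_integrable_atLeastAtMost' continuous_on_rabs cg)
      show "set_integrable lborel {v..t} (\<lambda>u. \<Sum>r\<in>S. \<bar>k r j\<bar>)"
        by (intro borel_integrable_atLeastAtMost' continuous_on_const)
      fix u assume u: "u \<in> {v..t}"
      show "\<bar>?g u\<bar> \<le> (\<Sum>r\<in>S. \<bar>k r j\<bar>)"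
      proof (rule order.trans[OF sum_abs sum_mono])
        fix r assume "r \<in> S"
        then show "\<bar>P v u i r * k r j\<bar> \<le> \<bar>k r j\<bar>"
          using transition_matricesD(1)[OF P v(1) _ _ ij(1), of u r]
            transition_matrices_le_1[OF P v(1) _ _ ij(1) _ S, of u r] u v
          by (auto simp: abs_mult intro: mult_left_le_one_le)
      qed
    qed
    also have "\<dots> = (\<Sum>r\<in>S. \<bar>k r j\<bar>) * (t - v)"
      using v by (simp add: set_lebesgue_integral_def)
    finally show ?thesis .
  qed
  ultimately show ?thesis by simp
qed

text \<open>Only the one-sided difference quotients of the transition matrices are controlled, so the
  forward equation is derived for the expectations, by dominated convergence along decreasing
  sequences of time increments.\<close>

lemma markov_chain_forward:
  fixes k :: "nat \<Rightarrow> nat \<Rightarrow> real"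
  assumes "prob_space M" and F: "filtration_on M T F" and mc: "markov_chain_on M F 0 T S (\<lambda>\<omega> t. k) \<Theta>"
    and S: "finite S" and h: "h \<in> S" and st: "0 \<le> s" "s \<le> t" "t \<le> T" and A: "A \<in> sets (F s)"
  shows "(LINT \<omega>|M. indicator A \<omega> * of_bool (\<Theta> t \<omega> = h)) - (LINT \<omega>|M. indicator A \<omega> * of_bool (\<Theta> s \<omega> = h)) =
      (LINT v:{s..t}|lborel. (\<Sum>r\<in>S. k r h * (LINT \<omega>|M. indicator A \<omega> * of_bool (\<Theta> v \<omega> = r))))"
proof -
  interpret prob_space M by fact
  define C where "C j = (\<Sum>r\<in>S. \<bar>k r j\<bar>)" for j
  have C0: "0 \<le> C j" for j unfolding C_def by (rule sum_nonneg) simp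
  define \<phi> where "\<phi> j u = (LINT \<omega>|M. indicator A \<omega> * of_bool (\<Theta> u \<omega> = j) :: real)" for j u
  note d = mc[unfolded markov_chain_on_def]
  obtain P where P': "(\<forall>\<omega>\<in>space M. transition_matrices S 0 T (P \<omega>) \<and> has_generator S 0 T (P \<omega>) (\<lambda>t. k)) \<and>
      (\<forall>v\<in>{0..T}. \<forall>t\<in>{v..T}. \<forall>j\<in>S. AE \<omega> in M.
         real_cond_exp M (F v) (\<lambda>\<omega>'. of_bool (\<Theta> t \<omega>' = j)) \<omega> = P \<omega> v t (\<Theta> v \<omega>) j)"
    by (rule exE[OF conjunct2[OF conjunct2[OF d]]])
  have P: "transition_matrices S 0 T (P \<omega>)" "has_generator S 0 T (P \<omega>) (\<lambda>t. k)" if "\<omega> \<in> space M" for \<omega>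
    using bspec[OF conjunct1[OF P'] that] by (rule conjunct1, rule conjunct2)
  have ce: "AE \<omega> in M. real_cond_exp M (F v) (\<lambda>\<omega>'. of_bool (\<Theta> u \<omega>' = j)) \<omega> = P \<omega> v u (\<Theta> v \<omega>) j"
    if "0 \<le> v" "v \<le> u" "u \<le> T" "j \<in> S" for v u j
    by (rule conjunct2[OF P', rule_format]) (use that in auto)
  have meas: "\<Theta> u \<in> measurable (F u) (count_space UNIV)" if "0 \<le> u" "u \<le> T" for u
    by (rule bspec[OF conjunct1[OF d]]) (use that in simp)
  have state: "\<Theta> u \<omega> \<in> S" if "0 \<le> u" "u \<le> T" "\<omega> \<in> space M" for u \<omega>
    by (rule bspec[OF conjunct1[OF bspec[OF conjunct1[OF conjunct2[OF d]] that(3)]]]) (use that in simp)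
  have Im: "(\<lambda>\<omega>. of_bool (\<Theta> u \<omega> = j) :: real) \<in> borel_measurable M" if "0 \<le> u" "u \<le> T" for u j
    by (rule measurable_compose[OF filtration_on_measurable[OF F that meas[OF that]]]) simp
  have AM: "A \<in> sets M" using A filtration_onD(4)[OF F, of s] st by auto
  have Iint: "integrable M (\<lambda>\<omega>. indicator A \<omega> * of_bool (\<Theta> u \<omega> = j) :: real)" if "0 \<le> u" "u \<le> T" for u j
    by (rule integrable_const_bound[of _ 1]) (use Im[OF that] AM in \<open>auto simp: indicator_def\<close>)
  define ce' where "ce' v u j \<omega> = real_cond_exp M (F v) (\<lambda>\<omega>'. of_bool (\<Theta> u \<omega>' = j)) \<omega>" for v u j \<omega>
  have ce'_meas: "ce' v u j \<in> borel_measurable M" for v u j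
    unfolding ce'_def by simp
  have ce'_bound: "AE \<omega> in M. \<bar>ce' v u j \<omega> - of_bool (\<Theta> v \<omega> = j)\<bar> \<le> C j * (u - v)"
    if v: "0 \<le> v" "v \<le> u" "u \<le> T" "j \<in> S" for v u j
    using ce[OF v] AE_space
  proof eventually_elim
    case (elim \<omega>)
    then show ?case
      using transition_increment_bound[OF P(1) P(2) S v(1-3) state[of v \<omega>] v(4)] v unfolding ce'_def C_def by simp
  qed
  have inc: "\<phi> j u - \<phi> j v = (LINT \<omega>|M. indicator A \<omega> * (ce' v u j \<omega> - of_bool (\<Theta> v \<omega> = j)))"
    "integrable M (\<lambda>\<omega>. indicator A \<omega> * ce' v u j \<omega>)"
    if v: "s \<le> v" "v \<le> u" "u \<le> T" "j \<in> S" for v u j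
  proof -
    have v0: "0 \<le> v" "v \<le> T" "0 \<le> u" using v st by auto
    interpret sub: finite_measure_subalgebra M "F v"
      by unfold_locales (rule filtration_onD(1)[OF F v0(1,2)])
    have ind: "(indicator A :: 'a \<Rightarrow> real) \<in> borel_measurable (F v)"
      using filtration_onD(3)[OF F st(1) v(1) v0(2)] A by auto
    note ci = sub.real_cond_exp_intg[OF Iint[OF v0(3) v(3)] ind Im[OF v0(3) v(3)]]
    show i: "integrable M (\<lambda>\<omega>. indicator A \<omega> * ce' v u j \<omega>)" unfolding ce'_def by (rule ci(1))
    show "\<phi> j u - \<phi> j v = (LINT \<omega>|M. indicator A \<omega> * (ce' v u j \<omega> - of_bool (\<Theta> v \<omega> = j)))"
      unfolding right_diff_distrib Bochner_Integration.integral_diff[OF i Iint[OF v0(1,2)]]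
      unfolding \<phi>_def ce'_def ci(2) ..
  qed
  \<comment> \<open>The bound is uniform in \<omega>, so it passes to expectations; it gives the
    continuity that \<open>right_derivative_FTC\<close> asks for.\<close>
  have lip: "\<bar>\<phi> j u - \<phi> j v\<bar> \<le> C j * (u - v)" if v: "s \<le> v" "v \<le> u" "u \<le> T" "j \<in> S" for v u j
  proof -
    have "\<bar>\<phi> j u - \<phi> j v\<bar> \<le> (LINT \<omega>|M. \<bar>indicator A \<omega> * (ce' v u j \<omega> - of_bool (\<Theta> v \<omega> = j))\<bar>)"
      unfolding inc(1)[OF v] by (rule integral_abs_bound)
    also have "\<dots> \<le> (LINT \<omega>|M. C j * (u - v))"
    proof (rule integral_mono_AE)
      have "integrable M (\<lambda>\<omega>. indicator A \<omega> * ce' v u j \<omega> - indicator A \<omega> * of_bool (\<Theta> v \<omega> = j))"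
        using inc(2)[OF v] Iint[of v j] v st by simp
      then show "integrable M (\<lambda>\<omega>. \<bar>indicator A \<omega> * (ce' v u j \<omega> - of_bool (\<Theta> v \<omega> = j))\<bar>)"
        unfolding right_diff_distrib by (rule integrable_abs)
      have "AE \<omega> in M. \<bar>ce' v u j \<omega> - of_bool (\<Theta> v \<omega> = j)\<bar> \<le> C j * (u - v)"
        using v st by (intro ce'_bound) auto
      then show "AE \<omega> in M. \<bar>indicator A \<omega> * (ce' v u j \<omega> - of_bool (\<Theta> v \<omega> = j))\<bar> \<le> C j * (u - v)"
        by eventually_elim (use C0[of j] v in \<open>auto simp: indicator_def\<close>)
    qed simp
    finally show ?thesis by (simp add: prob_space)
  qed
  have cont: "continuous_on {s..t} (\<phi> j)" if j: "j \<in> S" for j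
  proof (rule lipschitz_on_continuous_on[of "C j"], rule lipschitz_onI[OF _ C0])
    fix x y assume xy: "x \<in> {s..t}" "y \<in> {s..t}"
    show "dist (\<phi> j x) (\<phi> j y) \<le> C j * dist x y"
      using lip[of x y j] lip[of y x j] xy st j by (cases "x \<le> y") (auto simp: dist_real_def abs_minus_commute)
  qed
  have deriv: "((\<lambda>d. (\<phi> h (u + d) - \<phi> h u) / d) \<longlongrightarrow> (\<Sum>r\<in>S. k r h * \<phi> r u)) (at_right 0)" if u: "u \<in> {s..<t}" for u
  proof (rule tendsto_at_right_sequentially[of 0 "t - u"])
    show "0 < t - u" using u by simp
    fix D :: "nat \<Rightarrow> real" assume D: "\<And>n. 0 < D n" "\<And>n. D n < t - u" "D \<longlonglongrightarrow> 0"
    have u0: "0 \<le> u" "u < T" "s \<le> u" "u \<le> T" using u st by auto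
    have uD: "s \<le> u" "u \<le> u + D n" "u + D n \<le> T" for n using D(1,2)[of n] u st by auto
    have D_right: "filterlim D (at_right 0) sequentially"
    proof -
      have "D n \<noteq> 0" for n using D(1)[of n] by simp
      then show ?thesis unfolding filterlim_at using D(1,3) by auto
    qed
    have eq: "(\<phi> h (u + D n) - \<phi> h u) / D n = (LINT \<omega>|M. indicator A \<omega> * ((ce' u (u + D n) h \<omega> - of_bool (\<Theta> u \<omega> = h)) / D n))" for n
      unfolding inc(1)[OF uD h] times_divide_eq_right by (rule integral_divide_zero[symmetric])
    have "(\<lambda>n. LINT \<omega>|M. indicator A \<omega> * ((ce' u (u + D n) h \<omega> - of_bool (\<Theta> u \<omega> = h)) / D n))
      \<longlonglongrightarrow> (LINT \<omega>|M. (\<Sum>r\<in>S. k r h * (indicator A \<omega> * of_bool (\<Theta> u \<omega> = r))))"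
    proof (rule integral_dominated_convergence[where w = "\<lambda>\<omega>. C h"])
      show "(\<lambda>\<omega>. \<Sum>r\<in>S. k r h * (indicator A \<omega> * of_bool (\<Theta> u \<omega> = r))) \<in> borel_measurable M"
        by (intro borel_measurable_sum borel_measurable_times borel_measurable_const borel_measurable_integrable[OF Iint[OF u0(1,4)]] Im u0 borel_measurable_indicator AM)
      show "(\<lambda>\<omega>. indicator A \<omega> * ((ce' u (u + D n) h \<omega> - of_bool (\<Theta> u \<omega> = h)) / D n)) \<in> borel_measurable M" for n
        by (intro borel_measurable_times borel_measurable_divide borel_measurable_diff borel_measurable_const ce'_meas Im u0 borel_measurable_indicator AM)
      show "integrable M (\<lambda>\<omega>. C h)" by simp
      show "AE \<omega> in M. norm (indicator A \<omega> * ((ce' u (u + D n) h \<omega> - of_bool (\<Theta> u \<omega> = h)) / D n)) \<le> C h" for n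
        using ce'_bound[OF u0(1) uD(2)[of n] uD(3)[of n] h]
      proof eventually_elim
        case (elim \<omega>)
        then have "\<bar>(ce' u (u + D n) h \<omega> - of_bool (\<Theta> u \<omega> = h)) / D n\<bar> \<le> C h"
          using D(1)[of n] by (simp add: abs_divide divide_le_eq)
        then show ?case using C0[of h] by (auto simp: indicator_def)
      qed
      \<comment> \<open>The exceptional null set depends on the increment; for a sequence of
        increments fixed beforehand there is a common one.\<close>
      have "AE \<omega> in M. \<forall>n. ce' u (u + D n) h \<omega> = P \<omega> u (u + D n) (\<Theta> u \<omega>) h"
        unfolding AE_all_countable ce'_def by (intro allI ce u0 uD h)
      then show "AE \<omega> in M. (\<lambda>n. indicator A \<omega> * ((ce' u (u + D n) h \<omega> - of_bool (\<Theta> u \<omega> = h)) / D n))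
         \<longlonglongrightarrow> (\<Sum>r\<in>S. k r h * (indicator A \<omega> * of_bool (\<Theta> u \<omega> = r)))"
        using AE_space
      proof eventually_elim
        case (elim \<omega>)
        have th: "\<Theta> u \<omega> \<in> S" by (rule state[OF u0(1,4) elim(2)])
        have "((\<lambda>d. (P \<omega> u (u + d) (\<Theta> u \<omega>) h - of_bool (\<Theta> u \<omega> = h)) / d) \<longlongrightarrow> k (\<Theta> u \<omega>) h) (at_right 0)"
          using P(2)[OF elim(2)] th h u0 unfolding has_generator_def by auto
        from filterlim_compose[OF this D_right]
        have "(\<lambda>n. indicator A \<omega> * ((ce' u (u + D n) h \<omega> - of_bool (\<Theta> u \<omega> = h)) / D n)) \<longlonglongrightarrow> indicator A \<omega> * k (\<Theta> u \<omega>) h"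
          using elim(1) by (intro tendsto_mult tendsto_const) simp
        also have "indicator A \<omega> * k (\<Theta> u \<omega>) h = (\<Sum>r\<in>S. if r = \<Theta> u \<omega> then k r h * indicator A \<omega> else 0)"
          using th S by simp
        also have "\<dots> = (\<Sum>r\<in>S. k r h * (indicator A \<omega> * of_bool (\<Theta> u \<omega> = r)))"
          by (rule sum.cong) auto
        finally show ?case .
      qed
    qed
    also have "(LINT \<omega>|M. (\<Sum>r\<in>S. k r h * (indicator A \<omega> * of_bool (\<Theta> u \<omega> = r)))) = (\<Sum>r\<in>S. k r h * \<phi> r u)"
      unfolding \<phi>_def by (subst Bochner_Integration.integral_sum) (use Iint[OF u0(1,4)] in auto)
    finally show "(\<lambda>n. (\<phi> h (u + D n) - \<phi> h u) / D n) \<longlonglongrightarrow> (\<Sum>r\<in>S. k r h * \<phi> r u)" unfolding eq .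
  qed
  have "\<phi> h t - \<phi> h s = (LINT v:{s..t}|lborel. (\<Sum>r\<in>S. k r h * \<phi> r v))"
    by (rule right_derivative_FTC[OF st(2) cont[OF h] _ deriv]) (intro continuous_on_sum continuous_on_mult continuous_on_const cont)
  then show ?thesis unfolding \<phi>_def .
qed

section \<open>Filtering a chain observed through counting processes\<close>

text \<open>The filtering argument sees the model only through these facts. The generator of the
  chain and the intensities enter in integrated form, tested on events of \<open>F s\<close>. E is
  the set of jump types, and \<pi> is a version of the filter that is cadlag and [0, 1]-valued on
  every path, which keeps null sets out of the pathwise statements.\<close>

locale counting_filter = prob_space M for M :: "'a measure" +
  fixes T :: real and F G :: "real \<Rightarrow> 'a measure" and m :: nat and k :: "nat \<Rightarrow> nat \<Rightarrow> real"
    and \<Theta> :: "real \<Rightarrow> 'a \<Rightarrow> nat" and E :: "'e set" and ell :: "nat \<Rightarrow> 'e \<Rightarrow> real"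
    and Y :: "'e \<Rightarrow> real \<Rightarrow> 'a \<Rightarrow> real" and K :: real
    and J :: "'e \<Rightarrow> 'a \<Rightarrow> ('q \<times> real) set" and \<pi> :: "nat \<Rightarrow> real \<Rightarrow> 'a \<Rightarrow> real"
  assumes horizon: "0 \<le> T" and filtration: "filtration_on M T F"
    and null_sets: "null_sets M \<subseteq> sets (F 0)"
    and finite_types: "finite E"
    and finite_jumps: "\<And>\<omega> e. \<omega> \<in> space M \<Longrightarrow> e \<in> E \<Longrightarrow> finite (J e \<omega>)"
    and jump_times: "\<And>\<omega> e x. \<omega> \<in> space M \<Longrightarrow> e \<in> E \<Longrightarrow> x \<in> J e \<omega> \<Longrightarrow> 0 < snd x \<and> snd x \<le> T"
    and sets_obs: "\<And>t. 0 \<le> t \<Longrightarrow> t \<le> T \<Longrightarrow> sets (G t) = sigma_sets (space M)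
      ({(\<lambda>\<omega>. jumps_upto (J e \<omega>) v) -` B \<inter> space M | e v B. e \<in> E \<and> 0 \<le> v \<and> v \<le> t} \<union> null_sets M)"
    and space_obs: "\<And>t. space (G t) = space M"
    and obs_filtration: "filtration_on M T G"
    and obs_sub: "\<And>t. 0 \<le> t \<Longrightarrow> t \<le> T \<Longrightarrow> sets (G t) \<subseteq> sets (F t)"
    and exposure_predictable: "\<And>e. e \<in> E \<Longrightarrow> (\<lambda>(t, \<omega>). Y e t \<omega>) \<in> borel_measurable (predictable_sigma M T G)"
    and exposure_bounds: "\<And>e t \<omega>. e \<in> E \<Longrightarrow> \<omega> \<in> space M \<Longrightarrow> 0 \<le> t \<Longrightarrow> t \<le> T \<Longrightarrow> 0 \<le> Y e t \<omega> \<and> Y e t \<omega> \<le> K"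
    and ell_nonneg: "\<And>e r. e \<in> E \<Longrightarrow> r \<in> {1..m} \<Longrightarrow> 0 \<le> ell r e"
    and factor_adapted: "\<And>t. 0 \<le> t \<Longrightarrow> t \<le> T \<Longrightarrow> \<Theta> t \<in> measurable (F t) (count_space UNIV)"
    and factor_states: "\<And>t \<omega>. 0 \<le> t \<Longrightarrow> t \<le> T \<Longrightarrow> \<omega> \<in> space M \<Longrightarrow> \<Theta> t \<omega> \<in> {1..m}"
    and factor_cadlag: "\<And>\<omega>. \<omega> \<in> space M \<Longrightarrow> cadlag_on 0 T (\<lambda>t. \<Theta> t \<omega>)"
    and factor_chain: "\<And>h s t A. h \<in> {1..m} \<Longrightarrow> 0 \<le> s \<Longrightarrow> s \<le> t \<Longrightarrow> t \<le> T \<Longrightarrow> A \<in> sets (F s) \<Longrightarrow>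
      (LINT \<omega>|M. indicator A \<omega> * of_bool (\<Theta> t \<omega> = h)) - (LINT \<omega>|M. indicator A \<omega> * of_bool (\<Theta> s \<omega> = h)) =
      (LINT v:{s..t}|lborel. \<Sum>r=1..m. k r h * (LINT \<omega>|M. indicator A \<omega> * of_bool (\<Theta> v \<omega> = r)))"
    and integrable_count: "\<And>e. e \<in> E \<Longrightarrow> integrable M (\<lambda>\<omega>. real (jumps_upto (J e \<omega>) T))"
    and count_intensity: "\<And>e s t A. e \<in> E \<Longrightarrow> 0 \<le> s \<Longrightarrow> s \<le> t \<Longrightarrow> t \<le> T \<Longrightarrow> A \<in> sets (F s) \<Longrightarrow>
      (LINT \<omega>|M. indicator A \<omega> * (real (jumps_upto (J e \<omega>) t) - real (jumps_upto (J e \<omega>) s))) =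
      (LINT \<omega>|M. indicator A \<omega> * (LINT v:{s..t}|lborel.
         Y e v \<omega> * (\<Sum>r=1..m. ell r e * of_bool (left_lim 0 (\<lambda>w. \<Theta> w \<omega>) v = r))))"
    and no_simultaneous: "AE \<omega> in M. \<forall>e\<in>E. \<forall>e'\<in>E. \<forall>x\<in>J e \<omega>. \<forall>x'\<in>J e' \<omega>. snd x = snd x' \<longrightarrow> e = e' \<and> x = x'"
    and no_common: "AE \<omega> in M. \<forall>e\<in>E. \<forall>x\<in>J e \<omega>. left_lim 0 (\<lambda>w. \<Theta> w \<omega>) (snd x) = \<Theta> (snd x) \<omega>"
    and filter_adapted: "\<And>h t. h \<in> {1..m} \<Longrightarrow> 0 \<le> t \<Longrightarrow> t \<le> T \<Longrightarrow> \<pi> h t \<in> borel_measurable (G t)"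
    and filter_cond_exp: "\<And>h t. h \<in> {1..m} \<Longrightarrow> 0 \<le> t \<Longrightarrow> t \<le> T \<Longrightarrow>
      AE \<omega> in M. \<pi> h t \<omega> = real_cond_exp M (G t) (\<lambda>\<omega>. of_bool (\<Theta> t \<omega> = h)) \<omega>"
    and filter_cadlag: "\<And>h \<omega>. h \<in> {1..m} \<Longrightarrow> \<omega> \<in> space M \<Longrightarrow> cadlag_on 0 T (\<lambda>t. \<pi> h t \<omega>)"
    and filter_bounds: "\<And>h t \<omega>. h \<in> {1..m} \<Longrightarrow> \<omega> \<in> space M \<Longrightarrow> 0 \<le> t \<Longrightarrow> t \<le> T \<Longrightarrow> 0 \<le> \<pi> h t \<omega> \<and> \<pi> h t \<omega> \<le> 1"
begin

section \<open>Indicators, filters and intensities as processes\<close>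

abbreviation N :: "'e \<Rightarrow> real \<Rightarrow> 'a \<Rightarrow> nat" where
  "N e t \<omega> \<equiv> jumps_upto (J e \<omega>) t"

definition I :: "nat \<Rightarrow> real \<Rightarrow> 'a \<Rightarrow> real" where
  "I h t \<omega> = of_bool (\<Theta> t \<omega> = h)"

definition I_left :: "nat \<Rightarrow> real \<Rightarrow> 'a \<Rightarrow> real" where
  "I_left h t \<omega> = of_bool (left_lim 0 (\<lambda>w. \<Theta> w \<omega>) t = h)"

definition pi_left :: "nat \<Rightarrow> real \<Rightarrow> 'a \<Rightarrow> real" where
  "pi_left h t \<omega> = left_lim 0 (\<lambda>v. \<pi> h v \<omega>) t"

text \<open>The observed intensity is \<open>Y e * lam e\<close>. The exposure is kept apart because
  it cancels in the ratio that determines the jumps of the filter.\<close>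

definition lam :: "'e \<Rightarrow> real \<Rightarrow> 'a \<Rightarrow> real" where
  "lam e t \<omega> = (\<Sum>r=1..m. ell r e * pi_left r t \<omega>)"

definition nu :: "'e \<Rightarrow> real \<Rightarrow> 'a \<Rightarrow> real" where
  "nu e t \<omega> = Y e t \<omega> * (\<Sum>r=1..m. ell r e * I_left r t \<omega>)"

abbreviation P2 :: "(real \<times> 'a) measure" where
  "P2 \<equiv> leb T \<Otimes>\<^sub>M M"

abbreviation Pred :: "(real \<times> 'a) measure" where
  "Pred \<equiv> predictable_sigma M T F"

abbreviation PredG :: "(real \<times> 'a) measure" where
  "PredG \<equiv> predictable_sigma M T G"

definition ell_max :: real where
  "ell_max = (\<Sum>e\<in>E. \<Sum>r=1..m. ell r e)"

lemma PredG_imp_Pred: "X \<in> measurable PredG L \<Longrightarrow> X \<in> measurable Pred L"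
  by (rule predictable_mono[OF horizon filtration obs_filtration obs_sub])

lemma Pred_imp_P2: "X \<in> measurable Pred L \<Longrightarrow> X \<in> measurable P2 L"
  by (rule predictable_imp_progressive[OF horizon filtration horizon order_refl])
    (use filtration_onD[OF filtration] in auto)

lemma PredG_imp_P2: "X \<in> measurable PredG L \<Longrightarrow> X \<in> measurable P2 L"
  by (intro Pred_imp_P2 PredG_imp_Pred)

lemma sigma_finite_leb: "sigma_finite_measure (leb t)"
  by (rule sigma_finite_measure_restrict_space) (auto simp: lborel.sigma_finite_measure_axioms)

lemma finite_leb: "finite_measure (leb t)"
  by (rule finite_measureI) (simp add: emeasure_restrict_space space_restrict_space emeasure_lborel_Icc_eq)

sublocale P2: pair_sigma_finite "leb T" M
  by (intro pair_sigma_finite.intro sigma_finite_leb sigma_finite_measure_axioms)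

lemma finite_P2: "finite_measure P2"
  by (intro finite_measure_pair_measure finite_leb finite_measure_axioms)

lemma space_P2: "space P2 = {0..T} \<times> space M"
  by (simp add: space_pair_measure space_restrict_space)

lemma space_Pred: "space Pred = {0..T} \<times> space M" "space PredG = {0..T} \<times> space M"
  using space_predictable_sigma[OF horizon filtration] space_predictable_sigma[OF horizon obs_filtration] by auto

text \<open>Passes from integrals over closed intervals, as in the statement, to integrals on
  \<open>leb T\<close> over the windows \<open>{s<..t}\<close> of the predictable rectangles; the
  two domains differ by a point.\<close>

lemma leb_integral_Ioc:
  fixes g :: "real \<Rightarrow> real"
  assumes "0 \<le> s" "t \<le> T" and g: "g \<in> borel_measurable (leb T)"
  shows "(LINT v:{s..t}|lborel. g v) = (LINT v|leb T. indicator {s<..t} v * g v)"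
proof -
  have "(LINT v|leb T. indicator {s<..t} v * g v) = (LINT v:{0..T}|lborel. indicator {s<..t} v * g v)"
    by (subst integral_restrict_space) (auto simp: set_lebesgue_integral_def)
  also have "\<dots> = (LINT v|lborel. indicator {s<..t} v * g v)"
    unfolding set_lebesgue_integral_def
    by (rule Bochner_Integration.integral_cong) (use assms in \<open>auto simp: indicator_def\<close>)
  also have "\<dots> = (LINT v:{s<..t}|lborel. g v)" by (simp add: set_lebesgue_integral_def)
  also have "\<dots> = (LINT v:{s..t}|lborel. g v)"
  proof -
    have gm: "(\<lambda>v. indicator {0..T} v *\<^sub>R g v) \<in> borel_measurable borel"
      using g by (subst (asm) borel_measurable_restrict_space_iff) auto
    have m: "(\<lambda>v. indicator S v *\<^sub>R g v) \<in> borel_measurable lborel" if "S \<subseteq> {0..T}" "S \<in> sets borel" for S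
    proof -
      have "(\<lambda>v. indicator S v *\<^sub>R g v) = (\<lambda>v. indicator S v * (indicator {0..T} v *\<^sub>R g v))"
        by (rule ext) (use that in \<open>auto simp: indicator_def\<close>)
      then show ?thesis using gm that by simp
    qed
    show ?thesis
      unfolding set_lebesgue_integral_def
      by (intro integral_cong_AE m)
        (use AE_lborel_singleton[of s] assms in \<open>auto simp: indicator_def elim: eventually_mono\<close>)
  qed
  finally show ?thesis by simp
qed

lemma I_bounds: "0 \<le> I h t \<omega>" "I h t \<omega> \<le> 1" "0 \<le> I_left h t \<omega>" "I_left h t \<omega> \<le> 1"
  by (auto simp: I_def I_left_def)

lemma I_adapted: "0 \<le> t \<Longrightarrow> t \<le> T \<Longrightarrow> I h t \<in> borel_measurable (F t)"
  unfolding I_def[abs_def]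
  by (rule measurable_compose[OF factor_adapted]) auto

lemma factor_tendsto_left:
  assumes "\<omega> \<in> space M" "0 < t" "t \<le> T"
  shows "\<forall>\<^sub>F v in at_left t. \<Theta> v \<omega> = left_lim 0 (\<lambda>w. \<Theta> w \<omega>) t"
  using cadlag_on_left_lim_tendsto[OF factor_cadlag[OF assms(1)] assms(2,3)] by (simp add: tendsto_discrete)

lemma I_tendsto_left:
  assumes "\<omega> \<in> space M" "0 < t" "t \<le> T"
  shows "((\<lambda>v. I h v \<omega>) \<longlongrightarrow> I_left h t \<omega>) (at_left t)"
  by (rule tendsto_eventually) (use factor_tendsto_left[OF assms] in \<open>auto simp: I_def I_left_def elim: eventually_mono\<close>)

lemma I_tendsto_right:
  assumes "\<omega> \<in> space M" "0 \<le> t" "t < T"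
  shows "((\<lambda>v. I h v \<omega>) \<longlongrightarrow> I h t \<omega>) (at_right t)"
proof (rule tendsto_eventually)
  have "((\<lambda>v. \<Theta> v \<omega>) \<longlongrightarrow> \<Theta> t \<omega>) (at_right t)"
    using factor_cadlag[OF assms(1)] assms by (simp add: cadlag_on_def)
  then show "\<forall>\<^sub>F v in at_right t. I h v \<omega> = I h t \<omega>"
    by (auto simp: tendsto_discrete I_def elim: eventually_mono)
qed

lemma I_left_eq:
  assumes "\<omega> \<in> space M" "0 \<le> t" "t \<le> T"
  shows "I_left h t \<omega> = left_lim 0 (\<lambda>v. I h v \<omega>) t"
proof (cases "t = 0")
  case True
  then show ?thesis by (simp add: I_left_def I_def left_lim_def)
next
  case False
  then show ?thesis using tendsto_Lim[OF _ I_tendsto_left[OF assms(1), of t h]] assms by (simp add: left_lim_def)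
qed

lemma I_left_predictable: "(\<lambda>(t, \<omega>). I_left h t \<omega>) \<in> borel_measurable Pred"
proof -
  have "(\<lambda>(t, \<omega>). left_lim 0 (\<lambda>v. I h v \<omega>) t) \<in> borel_measurable Pred"
    using I_tendsto_left by (intro predictable_left_lim[OF horizon filtration] I_adapted) blast+
  also have "?this \<longleftrightarrow> ?thesis"
    by (rule measurable_cong) (auto simp: space_Pred I_left_eq)
  finally show ?thesis .
qed

lemma pi_left_predictable:
  assumes "h \<in> {1..m}" shows "(\<lambda>(t, \<omega>). pi_left h t \<omega>) \<in> borel_measurable PredG"
  unfolding pi_left_def
  using cadlag_on_left_lim_tendsto[OF filter_cadlag[OF assms]]
  by (intro predictable_left_lim[OF horizon obs_filtration] filter_adapted assms) blast+

lemma pi_left_bounds: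
  assumes "h \<in> {1..m}" "\<omega> \<in> space M" "0 \<le> t" "t \<le> T"
  shows "0 \<le> pi_left h t \<omega>" "pi_left h t \<omega> \<le> 1"
proof -
  have "0 \<le> pi_left h t \<omega> \<and> pi_left h t \<omega> \<le> 1"
  proof (cases "t = 0")
    case True
    then show ?thesis using filter_bounds[OF assms] by (simp add: pi_left_def left_lim_def)
  next
    case False
    then have lim: "((\<lambda>v. \<pi> h v \<omega>) \<longlongrightarrow> pi_left h t \<omega>) (at_left t)"
      unfolding pi_left_def using cadlag_on_left_lim_tendsto[OF filter_cadlag[OF assms(1,2)]] assms by simp
    have ev: "\<forall>\<^sub>F v in at_left t. 0 \<le> \<pi> h v \<omega> \<and> \<pi> h v \<omega> \<le> 1"
      using False assms filter_bounds[OF assms(1,2)] by (auto simp: eventually_at_left_field intro!: exI[of _ 0])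
    show ?thesis
      by (intro conjI tendsto_lowerbound[OF lim] tendsto_upperbound[OF lim])
        (use ev in \<open>auto elim: eventually_mono\<close>)
  qed
  then show "0 \<le> pi_left h t \<omega>" "pi_left h t \<omega> \<le> 1" by auto
qed

lemma lam_predictable: "(\<lambda>(t, \<omega>). lam e t \<omega>) \<in> borel_measurable PredG"
  unfolding lam_def using pi_left_predictable
  by (auto simp: case_prod_beta' intro!: borel_measurable_sum borel_measurable_times)

lemma nu_predictable: "e \<in> E \<Longrightarrow> (\<lambda>(t, \<omega>). nu e t \<omega>) \<in> borel_measurable Pred"
  unfolding nu_def using I_left_predictable PredG_imp_Pred[OF exposure_predictable]
  by (auto simp: case_prod_beta' intro!: borel_measurable_sum borel_measurable_times)

lemma ell_max_nonneg: "0 \<le> ell_max"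
  unfolding ell_max_def by (intro sum_nonneg ell_nonneg)

lemma ell_sum_le:
  assumes e: "e \<in> E" and q: "\<And>r. r \<in> {1..m} \<Longrightarrow> 0 \<le> q r \<and> q r \<le> 1"
  shows "0 \<le> (\<Sum>r=1..m. ell r e * q r)" "(\<Sum>r=1..m. ell r e * q r) \<le> ell_max"
proof -
  show "0 \<le> (\<Sum>r=1..m. ell r e * q r)" by (intro sum_nonneg mult_nonneg_nonneg ell_nonneg) (use e q in auto)
  have "(\<Sum>r=1..m. ell r e * q r) \<le> (\<Sum>r=1..m. ell r e)"
    by (intro sum_mono) (use ell_nonneg[OF e] q in \<open>auto intro: mult_left_le\<close>)
  also have "\<dots> \<le> ell_max"
    unfolding ell_max_def
    by (rule member_le_sum[OF e]) (auto intro!: sum_nonneg ell_nonneg finite_types)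
  finally show "(\<Sum>r=1..m. ell r e * q r) \<le> ell_max" .
qed

lemma K_nonneg: assumes "e \<in> E" shows "0 \<le> K"
  using exposure_bounds[OF assms, of _ 0] horizon not_empty by force

lemma nu_bounds:
  assumes "e \<in> E" "\<omega> \<in> space M" "0 \<le> t" "t \<le> T"
  shows "0 \<le> nu e t \<omega>" "nu e t \<omega> \<le> K * ell_max"
  unfolding nu_def using exposure_bounds[OF assms] ell_sum_le[OF assms(1), of "\<lambda>r. I_left r t \<omega>"] I_bounds
  by (auto intro!: mult_mono mult_nonneg_nonneg)

lemma lam_bounds:
  assumes "e \<in> E" "\<omega> \<in> space M" "0 \<le> t" "t \<le> T"
  shows "0 \<le> lam e t \<omega>" "lam e t \<omega> \<le> ell_max"
  unfolding lam_def using ell_sum_le[OF assms(1), of "\<lambda>r. pi_left r t \<omega>"] pi_left_bounds[OF _ assms(2-4)]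
  by auto

lemma N_obs_measurable:
  assumes "e \<in> E" "0 \<le> v" "v \<le> t" "t \<le> T"
  shows "(\<lambda>\<omega>. N e v \<omega>) \<in> measurable (G t) (count_space UNIV)"
proof (rule measurableI)
  fix B :: "nat set"
  show "(\<lambda>\<omega>. N e v \<omega>) -` B \<inter> space (G t) \<in> sets (G t)"
    using assms unfolding space_obs by (subst sets_obs) (auto intro!: sigma_sets.Basic)
qed auto

lemma N_obs_measurable_real:
  assumes "e \<in> E" "0 \<le> v" "v \<le> t" "t \<le> T"
  shows "(\<lambda>\<omega>. real (N e v \<omega>)) \<in> borel_measurable (G t)"
  by (rule measurable_compose[OF N_obs_measurable[OF assms]]) simp

section \<open>Sums over jumps and their compensators\<close>

text \<open>On a rectangle the sum is an increment of the count times the indicator of the base. H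
  is a parameter because adaptedness is wanted with respect to F and with respect to the observed
  filtration.\<close>

lemma jump_sum_measurable_nn:
  fixes f :: "real \<times> 'a \<Rightarrow> ennreal"
  assumes H: "filtration_on M T H" and N: "\<And>t. 0 \<le> t \<Longrightarrow> t \<le> T \<Longrightarrow> (\<lambda>\<omega>. real (N e t \<omega>)) \<in> borel_measurable (H t)"
    and e: "e \<in> E" and t: "0 \<le> t" "t \<le> T"
    and f: "f \<in> borel_measurable (predictable_sigma M T H)"
  shows "(\<lambda>\<omega>. \<integral>\<^sup>+x. f (snd x, \<omega>) \<partial>count_space {x\<in>J e \<omega>. snd x \<le> t}) \<in> borel_measurable (H t)"
  using horizon H f
proof (induction rule: predictable_nn_induct)
  case (cong f g)
  have "(\<integral>\<^sup>+x. f (snd x, \<omega>) \<partial>count_space {x\<in>J e \<omega>. snd x \<le> t}) = (\<integral>\<^sup>+x. g (snd x, \<omega>) \<partial>count_space {x\<in>J e \<omega>. snd x \<le> t})"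
    if "\<omega> \<in> space (H t)" for \<omega>
    using that filtration_onD(2)[OF H t]
    by (intro nn_integral_cong cong(1)) (auto dest: jump_times[OF _ e] intro: less_imp_le)
  then show ?case using cong(2) by (subst measurable_cong[symmetric]) auto
next
  case (rectangle R)
  then show ?case unfolding predictable_rectangles_def
  proof (elim UnE CollectE exE conjE)
    fix A assume "R = {0} \<times> A" "A \<in> sets (H 0)"
    then have "(\<integral>\<^sup>+x. indicator R (snd x, \<omega>) \<partial>count_space {x\<in>J e \<omega>. snd x \<le> t}) = 0" if "\<omega> \<in> space (H t)" for \<omega>
    proof -
      have "(\<integral>\<^sup>+x. indicator R (snd x, \<omega>) \<partial>count_space {x\<in>J e \<omega>. snd x \<le> t})
        = (\<integral>\<^sup>+x. 0 \<partial>count_space {x\<in>J e \<omega>. snd x \<le> t})"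
        using that filtration_onD(2)[OF H t] \<open>R = {0} \<times> A\<close>
        by (intro nn_integral_cong) (auto simp: indicator_def dest: jump_times[OF _ e])
      then show ?thesis by simp
    qed
    then show ?thesis by (subst measurable_cong) auto
  next
    fix a b A assume R: "R = {a<..b} \<times> A" "0 \<le> a" "a < b" "b \<le> T" "A \<in> sets (H a)"
    have *: "(\<integral>\<^sup>+x. indicator R (snd x, \<omega>) \<partial>count_space {x\<in>J e \<omega>. snd x \<le> t})
      = indicator A \<omega> * ennreal (real (N e (min b t) \<omega>) - real (N e (min a t) \<omega>))" if w: "\<omega> \<in> space (H t)" for \<omega>
    proof -
      have fin: "finite (J e \<omega>)" using w finite_jumps[OF _ e] filtration_onD(2)[OF H t] by auto
      have "(\<integral>\<^sup>+x. indicator R (snd x, \<omega>) \<partial>count_space {x\<in>J e \<omega>. snd x \<le> t})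
        = (\<integral>\<^sup>+x. indicator A \<omega> * indicator {x\<in>J e \<omega>. min a t < snd x \<and> snd x \<le> min b t} x \<partial>count_space {x\<in>J e \<omega>. snd x \<le> t})"
        by (rule nn_integral_cong) (auto simp: R indicator_def)
      also have "\<dots> = indicator A \<omega> * ennreal (real (card {x\<in>J e \<omega>. min a t < snd x \<and> snd x \<le> min b t}))"
        by (rule nn_integral_count_space_cmult_indicator) (use fin in auto)
      also have "\<dots> = indicator A \<omega> * ennreal (real (N e (min b t) \<omega>) - real (N e (min a t) \<omega>))"
        by (subst jumps_upto_diff[OF fin]) (use R in auto)
      finally show ?thesis .
    qed
    show ?thesis
    proof (subst measurable_cong[OF *])
      have [measurable]: "(\<lambda>\<omega>. real (N e (min b t) \<omega>)) \<in> borel_measurable (H t)" "(\<lambda>\<omega>. real (N e (min a t) \<omega>)) \<in> borel_measurable (H t)"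
        using R t by (auto intro!: filtration_on_measurable_mono[OF H _ _ _ N])
      show "(\<lambda>\<omega>. indicator A \<omega> * ennreal (real (N e (min b t) \<omega>) - real (N e (min a t) \<omega>))) \<in> borel_measurable (H t)"
      \<comment> \<open>If the window starts after t, its base need not belong to
        \<open>H t\<close>, but then the increment is 0.\<close>
      proof (cases "a \<le> t")
        case True
        then have [measurable]: "A \<in> sets (H t)" using R t filtration_onD(3)[OF H, of a t] by auto
        show ?thesis by measurable
      next
        case False
        then have "min b t = min a t" using R by auto
        then show ?thesis by simp
      qed
    qed
  qed
next
  case (compl A)
  have "(\<integral>\<^sup>+x. indicator ({0..T} \<times> space M - A) (snd x, \<omega>) \<partial>count_space {x\<in>J e \<omega>. snd x \<le> t})
     = ennreal (real (N e t \<omega>)) - (\<integral>\<^sup>+x. indicator A (snd x, \<omega>) \<partial>count_space {x\<in>J e \<omega>. snd x \<le> t})"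
    (is "?l = _ - ?r") if w: "\<omega> \<in> space (H t)" for \<omega>
  proof -
    have wM: "\<omega> \<in> space M" using w filtration_onD(2)[OF H t] by auto
    have fin: "finite (J e \<omega>)" using finite_jumps[OF wM e] .
    have "?l + ?r = (\<integral>\<^sup>+x. 1 \<partial>count_space {x\<in>J e \<omega>. snd x \<le> t})"
      by (subst nn_integral_add[symmetric], simp, simp, rule nn_integral_cong)
        (use jump_times[OF wM e] wM in \<open>auto simp: indicator_def intro: less_imp_le\<close>)
    also have "\<dots> = ennreal (real (N e t \<omega>))" using fin by (simp add: jumps_upto_def ennreal_of_nat_eq_real_of_nat)
    finally have sum: "?l + ?r = ennreal (real (N e t \<omega>))" .
    then have "?l + ?r \<noteq> \<top>" by (simp only: ennreal_neq_top not_False_eq_True)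
    then have ne: "?r \<noteq> \<top>" unfolding ennreal_add_eq_top by blast
    show ?thesis
      by (subst sum[symmetric], subst ennreal_add_diff_cancel_right[OF ne]) (rule refl)
  qed
  moreover have "(\<lambda>\<omega>. ennreal (real (N e t \<omega>)) - (\<integral>\<^sup>+x. indicator A (snd x, \<omega>) \<partial>count_space {x\<in>J e \<omega>. snd x \<le> t})) \<in> borel_measurable (H t)"
    using N[OF t] compl by measurable
  ultimately show ?case by (subst measurable_cong) auto
next
  case (mult u c)
  then show ?case by (simp add: nn_integral_cmult)
next
  case (add u v)
  then show ?case by (simp add: nn_integral_add)
next
  case (seq U)
  have "(\<integral>\<^sup>+x. (SUP i. U i (snd x, \<omega>)) \<partial>count_space {x\<in>J e \<omega>. snd x \<le> t})
     = (SUP i. \<integral>\<^sup>+x. U i (snd x, \<omega>) \<partial>count_space {x\<in>J e \<omega>. snd x \<le> t})" for \<omega>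
    by (intro nn_integral_monotone_convergence_SUP)
      (auto simp: incseq_def le_fun_def intro!: le_funD[OF incseqD[OF \<open>incseq U\<close>]])
  moreover have "(\<lambda>\<omega>. SUP i. \<integral>\<^sup>+x. U i (snd x, \<omega>) \<partial>count_space {x\<in>J e \<omega>. snd x \<le> t}) \<in> borel_measurable (H t)"
    by (rule borel_measurable_SUP) (use seq in auto)
  ultimately show ?case by (simp only:)
qed

lemma N_measurable:
  assumes "e \<in> E" "0 \<le> t" "t \<le> T"
  shows "(\<lambda>\<omega>. real (N e t \<omega>)) \<in> borel_measurable (F t)"
  using measurable_mono[OF order_refl refl obs_sub[OF assms(2,3)], of borel] N_obs_measurable_real[OF assms(1,2) order_refl assms(3)]
    filtration_onD(2)[OF filtration assms(2,3)] space_obs by auto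

lemma jump_sum_measurable_M:
  fixes f :: "real \<times> 'a \<Rightarrow> ennreal"
  assumes "e \<in> E" "f \<in> borel_measurable Pred"
  shows "(\<lambda>\<omega>. \<integral>\<^sup>+x. f (snd x, \<omega>) \<partial>count_space {x\<in>J e \<omega>. snd x \<le> T}) \<in> borel_measurable M"
  by (rule filtration_on_measurable[OF filtration horizon order_refl])
    (rule jump_sum_measurable_nn[OF filtration N_measurable assms(1) horizon order_refl assms(2)],
      use assms in auto)

lemma jump_sum_nonneg:
  fixes f :: "real \<times> 'a \<Rightarrow> real"
  assumes "e \<in> E" "\<omega> \<in> space M" "\<And>z. 0 \<le> f z"
  shows "(\<integral>\<^sup>+x. ennreal (f (snd x, \<omega>)) \<partial>count_space {x\<in>J e \<omega>. snd x \<le> t})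
    = ennreal (\<Sum>x\<in>{x\<in>J e \<omega>. snd x \<le> t}. f (snd x, \<omega>))"
  using finite_jumps[OF assms(2,1)] assms(3) by (subst nn_integral_count_space_finite) auto

lemma sum_pos_neg_parts:
  fixes f :: "'i \<Rightarrow> real"
  shows "sum f S = (\<Sum>x\<in>S. max 0 (f x)) - (\<Sum>x\<in>S. max 0 (- f x))"
  by (subst sum_subtractf[symmetric], rule sum.cong) auto

lemma jump_sum_measurable:
  fixes f :: "real \<times> 'a \<Rightarrow> real"
  assumes H: "filtration_on M T H" and N: "\<And>t. 0 \<le> t \<Longrightarrow> t \<le> T \<Longrightarrow> (\<lambda>\<omega>. real (N e t \<omega>)) \<in> borel_measurable (H t)"
    and e: "e \<in> E" and t: "0 \<le> t" "t \<le> T"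
    and f[measurable]: "f \<in> borel_measurable (predictable_sigma M T H)"
  shows "(\<lambda>\<omega>. \<Sum>x\<in>{x\<in>J e \<omega>. snd x \<le> t}. f (snd x, \<omega>)) \<in> borel_measurable (H t)"
proof -
  have *: "(\<lambda>\<omega>. enn2real (\<integral>\<^sup>+x. ennreal (g (snd x, \<omega>)) \<partial>count_space {x\<in>J e \<omega>. snd x \<le> t})) \<in> borel_measurable (H t)"
    if "g \<in> borel_measurable (predictable_sigma M T H)" for g :: "real \<times> 'a \<Rightarrow> real"
    using jump_sum_measurable_nn[OF H N e t, of "\<lambda>z. ennreal (g z)"] that by measurable
  have "(\<lambda>\<omega>. enn2real (\<integral>\<^sup>+x. ennreal (max 0 (f (snd x, \<omega>))) \<partial>count_space {x\<in>J e \<omega>. snd x \<le> t})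
    - enn2real (\<integral>\<^sup>+x. ennreal (max 0 (- f (snd x, \<omega>))) \<partial>count_space {x\<in>J e \<omega>. snd x \<le> t})) \<in> borel_measurable (H t)"
    using *[of "\<lambda>z. max 0 (f z)"] *[of "\<lambda>z. max 0 (- f z)"] by measurable
  also have "?this \<longleftrightarrow> ?thesis"
    using filtration_onD(2)[OF H t] jump_sum_nonneg[OF e, of _ "\<lambda>z. max 0 (f z)"] jump_sum_nonneg[OF e, of _ "\<lambda>z. max 0 (- f z)"]
    by (intro measurable_cong) (auto simp: sum_nonneg sum_pos_neg_parts[of "\<lambda>x. f (snd x, _)"])
  finally show ?thesis .
qed

lemma integrable_P2_bounded:
  fixes f :: "real \<times> 'a \<Rightarrow> real"
  assumes "f \<in> borel_measurable P2" "\<And>t \<omega>. 0 \<le> t \<Longrightarrow> t \<le> T \<Longrightarrow> \<omega> \<in> space M \<Longrightarrow> \<bar>f (t, \<omega>)\<bar> \<le> B"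
  shows "integrable P2 f"
  by (rule finite_measure.integrable_const_bound[OF finite_P2, of _ B])
    (use assms in \<open>auto simp: space_P2 intro!: AE_I2\<close>)

text \<open>Countable sets of times are Lebesgue null, so Fubini applies. Since cadlag paths have
  countably many jumps, this identifies left limits with values almost everywhere on the product
  space.\<close>

lemma AE_P2I:
  assumes Q: "{z \<in> space P2. Q z} \<in> sets P2"
    and c: "\<And>\<omega>. \<omega> \<in> space M \<Longrightarrow> countable {v\<in>{0..T}. \<not> Q (v, \<omega>)}"
  shows "AE z in P2. Q z"
proof (rule P2.AE_pair_measure[OF Q])
  have "AE \<omega> in M. AE v in leb T. Q (v, \<omega>)"
  proof (rule AE_I2)
    fix \<omega> assume "\<omega> \<in> space M"
    then have "{v\<in>{0..T}. \<not> Q (v, \<omega>)} \<in> null_sets lborel"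
      by (intro countable_imp_null_set_lborel c)
    then have "AE v in lborel. v \<notin> {v\<in>{0..T}. \<not> Q (v, \<omega>)}" by (rule AE_not_in)
    then show "AE v in leb T. Q (v, \<omega>)"
      by (subst AE_restrict_space_iff) (auto elim: eventually_mono)
  qed
  then show "AE v in leb T. AE \<omega> in M. Q (v, \<omega>)"
    by (subst P2.AE_commute) (use Q in auto)
qed

text \<open>Both sides are 0: jumps happen at positive times, and a single time has Lebesgue measure
  0.\<close>

lemma jump_compensator_zero:
  assumes e: "e \<in> E" and R: "R = {0} \<times> A" "A \<in> sets (F 0)"
  shows "(\<integral>\<^sup>+\<omega>. (\<integral>\<^sup>+x. indicator R (snd x, \<omega>) \<partial>count_space {x\<in>J e \<omega>. snd x \<le> T}) \<partial>M)
    = (\<integral>\<^sup>+z. indicator R z * ennreal (nu e (fst z) (snd z)) \<partial>P2)"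
proof -
  have A: "A \<in> sets M" using R filtration_onD(4)[OF filtration, of 0] horizon by auto
  have "(\<integral>\<^sup>+\<omega>. (\<integral>\<^sup>+x. indicator R (snd x, \<omega>) \<partial>count_space {x\<in>J e \<omega>. snd x \<le> T}) \<partial>M) =
    (\<integral>\<^sup>+\<omega>. (\<integral>\<^sup>+x. 0 \<partial>count_space {x\<in>J e \<omega>. snd x \<le> T}) \<partial>M)"
    by (intro nn_integral_cong) (auto simp: R indicator_def dest: jump_times[OF _ e])
  moreover have "R \<in> null_sets P2"
  proof
    have "{0} \<in> sets (leb T)" using horizon by (auto simp: sets_restrict_space image_iff)
    then show "R \<in> sets P2" "emeasure P2 R = 0"
      using A horizon unfolding R(1) by (auto simp: emeasure_pair_measure_Times emeasure_restrict_space)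
  qed
  then have "(\<integral>\<^sup>+z. indicator R z * ennreal (nu e (fst z) (snd z)) \<partial>P2) = (\<integral>\<^sup>+z. 0 \<partial>P2)"
    by (intro nn_integral_cong_AE) (auto dest!: AE_not_in elim!: eventually_mono)
  ultimately show ?thesis by simp
qed

text \<open>On a window the jump sum is an increment of the count, and the claim is
  \<open>count_intensity\<close> followed by Fubini.\<close>

lemma jump_compensator_Ioc:
  assumes e: "e \<in> E" and R: "R = {a<..b} \<times> A" "0 \<le> a" "a \<le> b" "b \<le> T" "A \<in> sets (F a)"
  shows "(\<integral>\<^sup>+\<omega>. (\<integral>\<^sup>+x. indicator R (snd x, \<omega>) \<partial>count_space {x\<in>J e \<omega>. snd x \<le> T}) \<partial>M)
    = (\<integral>\<^sup>+z. indicator R z * ennreal (nu e (fst z) (snd z)) \<partial>P2)"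
proof -
  have A[measurable]: "A \<in> sets M" using R filtration_onD(4)[OF filtration, of a] by auto
  have N[measurable]: "(\<lambda>\<omega>. real (N e t \<omega>)) \<in> borel_measurable M" if "0 \<le> t" "t \<le> T" for t
    by (rule filtration_on_measurable[OF filtration that N_measurable[OF e that]])
  have Ndiff: "0 \<le> real (N e b \<omega>) - real (N e a \<omega>)" "real (N e b \<omega>) - real (N e a \<omega>) \<le> real (N e T \<omega>)"
    if "\<omega> \<in> space M" for \<omega>
    using jumps_upto_mono[OF finite_jumps[OF that e]] R by (simp, smt (verit) of_nat_0_le_iff of_nat_mono)
  have int1: "integrable M (\<lambda>\<omega>. indicator A \<omega> * (real (N e b \<omega>) - real (N e a \<omega>)))"
    by (rule Bochner_Integration.integrable_bound[OF integrable_count[OF e]])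
      (use N[of a] N[of b] Ndiff R in \<open>auto simp: indicator_def intro!: AE_I2\<close>)
  have "(\<integral>\<^sup>+\<omega>. (\<integral>\<^sup>+x. indicator R (snd x, \<omega>) \<partial>count_space {x\<in>J e \<omega>. snd x \<le> T}) \<partial>M)
    = (\<integral>\<^sup>+\<omega>. ennreal (indicator A \<omega> * (real (N e b \<omega>) - real (N e a \<omega>))) \<partial>M)"
  proof (rule nn_integral_cong)
    fix \<omega> assume w: "\<omega> \<in> space M"
    have fin: "finite (J e \<omega>)" using finite_jumps[OF w e] .
    have "(\<integral>\<^sup>+x. indicator R (snd x, \<omega>) \<partial>count_space {x\<in>J e \<omega>. snd x \<le> T})
      = (\<integral>\<^sup>+x. indicator A \<omega> * indicator {x\<in>J e \<omega>. a < snd x \<and> snd x \<le> b} x \<partial>count_space {x\<in>J e \<omega>. snd x \<le> T})"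
      by (rule nn_integral_cong) (auto simp: R indicator_def)
    also have "\<dots> = indicator A \<omega> * ennreal (real (card {x\<in>J e \<omega>. a < snd x \<and> snd x \<le> b}))"
      by (rule nn_integral_count_space_cmult_indicator) (use fin R in auto)
    also have "\<dots> = indicator A \<omega> * ennreal (real (N e b \<omega>) - real (N e a \<omega>))"
      using jumps_upto_diff[OF fin, of a b] R by simp
    also have "\<dots> = ennreal (indicator A \<omega> * (real (N e b \<omega>) - real (N e a \<omega>)))"
      by (simp add: indicator_def)
    finally show "(\<integral>\<^sup>+x. indicator R (snd x, \<omega>) \<partial>count_space {x\<in>J e \<omega>. snd x \<le> T}) = \<dots>" .
  qed
  also have "\<dots> = ennreal (LINT \<omega>|M. indicator A \<omega> * (real (N e b \<omega>) - real (N e a \<omega>)))"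
    by (rule nn_integral_eq_integral[OF int1]) (use Ndiff in \<open>auto simp: indicator_def intro!: AE_I2\<close>)
  also have "(LINT \<omega>|M. indicator A \<omega> * (real (N e b \<omega>) - real (N e a \<omega>)))
    = (LINT \<omega>|M. LINT v|leb T. indicator {a<..b} v * indicator A \<omega> * nu e v \<omega>)"
  proof -
    have "indicator A \<omega> * (LINT v:{a..b}|lborel. nu e v \<omega>)
      = (LINT v|leb T. indicator {a<..b} v * indicator A \<omega> * nu e v \<omega>)" if "\<omega> \<in> space M" for \<omega>
    proof -
      have "(\<lambda>v. nu e v \<omega>) \<in> borel_measurable (leb T)"
        using measurable_Pair1[OF Pred_imp_P2[OF nu_predictable[OF e]] that] by simp
      then have "(LINT v:{a..b}|lborel. nu e v \<omega>) = (LINT v|leb T. indicator {a<..b} v * nu e v \<omega>)"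
        by (intro leb_integral_Ioc) (use R in auto)
      then show ?thesis by (simp add: mult_ac flip: integral_mult_right_zero)
    qed
    then show ?thesis
      using count_intensity[OF e R(2-5)] unfolding nu_def[symmetric] I_left_def[symmetric]
      by (simp cong: Bochner_Integration.integral_cong)
  qed
  also have int2: "integrable P2 (\<lambda>(v, \<omega>). indicator {a<..b} v * indicator A \<omega> * nu e v \<omega>)"
    (is "integrable P2 ?g")
  proof (rule integrable_P2_bounded)
    have "(\<lambda>(t, \<omega>). indicator {a<..b} t * indicator A \<omega> :: real) \<in> borel_measurable Pred"
      by (rule predictable_Ioc[OF horizon filtration]) (use R in auto)
    then show "?g \<in> borel_measurable P2"
      using nu_predictable[OF e] by (intro Pred_imp_P2) (simp add: case_prod_beta')
    show "\<bar>?g (t, \<omega>)\<bar> \<le> K * ell_max" if "0 \<le> t" "t \<le> T" "\<omega> \<in> space M" for t \<omega>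
      using nu_bounds[OF e that(3,1,2)] K_nonneg[OF e] ell_max_nonneg by (auto simp: indicator_def)
  qed
  then have "(LINT \<omega>|M. LINT v|leb T. indicator {a<..b} v * indicator A \<omega> * nu e v \<omega>) = (LINT z|P2. ?g z)"
    by (rule P2.integral_snd)
  also have "ennreal (LINT z|P2. ?g z) = (\<integral>\<^sup>+z. ennreal (?g z) \<partial>P2)"
    by (rule nn_integral_eq_integral[OF int2, symmetric])
      (use nu_bounds[OF e] in \<open>auto simp: space_P2 intro!: AE_I2\<close>)
  also have "\<dots> = (\<integral>\<^sup>+z. indicator R z * ennreal (nu e (fst z) (snd z)) \<partial>P2)"
  proof (rule nn_integral_cong)
    fix z
    show "ennreal (?g z) = indicator R z * ennreal (nu e (fst z) (snd z))"
      by (cases z; cases "fst z \<in> {a<..b} \<and> snd z \<in> A") (auto simp: R)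
  qed
  finally show ?thesis .
qed

lemma jump_sum_add:
  fixes f g :: "real \<times> 'a \<Rightarrow> ennreal"
  assumes e: "e \<in> E" and f: "f \<in> borel_measurable Pred" and g: "g \<in> borel_measurable Pred"
  shows "(\<integral>\<^sup>+\<omega>. (\<integral>\<^sup>+x. f (snd x, \<omega>) + g (snd x, \<omega>) \<partial>count_space {x\<in>J e \<omega>. snd x \<le> T}) \<partial>M)
    = (\<integral>\<^sup>+\<omega>. (\<integral>\<^sup>+x. f (snd x, \<omega>) \<partial>count_space {x\<in>J e \<omega>. snd x \<le> T}) \<partial>M)
    + (\<integral>\<^sup>+\<omega>. (\<integral>\<^sup>+x. g (snd x, \<omega>) \<partial>count_space {x\<in>J e \<omega>. snd x \<le> T}) \<partial>M)"
  using jump_sum_measurable_M[OF e f] jump_sum_measurable_M[OF e g]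
  by (subst nn_integral_add[symmetric]) (simp_all add: nn_integral_add)

lemma nu_measurable_nn: "e \<in> E \<Longrightarrow> (\<lambda>z. ennreal (nu e (fst z) (snd z))) \<in> borel_measurable P2"
  using Pred_imp_P2[OF nu_predictable] by (simp add: case_prod_beta')

lemma nu_integral_add:
  fixes f g :: "real \<times> 'a \<Rightarrow> ennreal"
  assumes e: "e \<in> E" and f: "f \<in> borel_measurable Pred" and g: "g \<in> borel_measurable Pred"
  shows "(\<integral>\<^sup>+z. (f z + g z) * ennreal (nu e (fst z) (snd z)) \<partial>P2)
    = (\<integral>\<^sup>+z. f z * ennreal (nu e (fst z) (snd z)) \<partial>P2) + (\<integral>\<^sup>+z. g z * ennreal (nu e (fst z) (snd z)) \<partial>P2)"
  unfolding distrib_right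
  by (rule nn_integral_add)
    (intro borel_measurable_times_ennreal Pred_imp_P2[OF f] Pred_imp_P2[OF g] nu_measurable_nn[OF e])+

text \<open>The defining property of the compensator, known for windows, extends to all nonnegative
  predictable integrands by the monotone class argument, since both sides are additive and
  continuous along increasing sequences.\<close>

lemma jump_compensator_nn:
  fixes f :: "real \<times> 'a \<Rightarrow> ennreal"
  assumes e: "e \<in> E" and f: "f \<in> borel_measurable Pred"
  shows "(\<integral>\<^sup>+\<omega>. (\<integral>\<^sup>+x. f (snd x, \<omega>) \<partial>count_space {x\<in>J e \<omega>. snd x \<le> T}) \<partial>M)
    = (\<integral>\<^sup>+z. f z * ennreal (nu e (fst z) (snd z)) \<partial>P2)"
  using horizon filtration f
proof (induction rule: predictable_nn_induct)
  case (cong f g)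
  have 1: "(\<integral>\<^sup>+\<omega>. (\<integral>\<^sup>+x. f (snd x, \<omega>) \<partial>count_space {x\<in>J e \<omega>. snd x \<le> T}) \<partial>M)
    = (\<integral>\<^sup>+\<omega>. (\<integral>\<^sup>+x. g (snd x, \<omega>) \<partial>count_space {x\<in>J e \<omega>. snd x \<le> T}) \<partial>M)"
    by (intro nn_integral_cong cong(1)) (auto dest: jump_times[OF _ e] intro: less_imp_le)
  have 2: "(\<integral>\<^sup>+z. f z * ennreal (nu e (fst z) (snd z)) \<partial>P2) = (\<integral>\<^sup>+z. g z * ennreal (nu e (fst z) (snd z)) \<partial>P2)"
  proof (rule nn_integral_cong)
    fix z assume "z \<in> space P2"
    then have "f z = g z" using cong(1)[of "fst z" "snd z"] by (cases z) (simp add: space_P2)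
    then show "f z * ennreal (nu e (fst z) (snd z)) = g z * ennreal (nu e (fst z) (snd z))" by (simp only:)
  qed
  show ?case by (rule trans[OF 1[symmetric] trans[OF cong(2) 2]])
next
  case (rectangle R)
  then show ?case unfolding predictable_rectangles_def
  proof (elim UnE CollectE exE conjE)
    fix A assume "R = {0} \<times> A" "A \<in> sets (F 0)"
    then show ?thesis by (rule jump_compensator_zero[OF e])
  next
    fix a b A assume "R = {a<..b} \<times> A" "0 \<le> a" "a < b" "b \<le> T" "A \<in> sets (F a)"
    then show ?thesis by (intro jump_compensator_Ioc[OF e _ _ less_imp_le])
  qed
next
  case (compl A)
  let ?S = "\<lambda>f. (\<integral>\<^sup>+\<omega>. (\<integral>\<^sup>+x. f (snd x, \<omega>) \<partial>count_space {x\<in>J e \<omega>. snd x \<le> T}) \<partial>M)"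
  let ?R = "\<lambda>f. (\<integral>\<^sup>+z. f z * ennreal (nu e (fst z) (snd z)) \<partial>P2)"
  let ?A = "indicator A :: real \<times> 'a \<Rightarrow> ennreal" and ?C = "indicator ({0..T} \<times> space M - A) :: real \<times> 'a \<Rightarrow> ennreal"
  have sp: "{0..T} \<times> space M \<in> sets Pred" using sets.top[of Pred] by (simp add: space_Pred)
  have [measurable]: "?A \<in> borel_measurable Pred" "?C \<in> borel_measurable Pred" using compl(1) sp by auto
  have split: "?A (t, \<omega>) + ?C (t, \<omega>) = 1" if "0 \<le> t" "t \<le> T" "\<omega> \<in> space M" for t \<omega>
    using that by (auto simp: indicator_def)
  have S1: "?S ?A + ?S ?C = ?S (\<lambda>z. 1)"
    unfolding jump_sum_add[OF e \<open>?A \<in> _\<close> \<open>?C \<in> _\<close>, symmetric]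
    by (intro nn_integral_cong split) (auto dest: jump_times[OF _ e] intro: less_imp_le)
  have R1: "?R ?A + ?R ?C = ?R (\<lambda>z. 1)"
    unfolding nu_integral_add[OF e \<open>?A \<in> _\<close> \<open>?C \<in> _\<close>, symmetric]
  proof (rule nn_integral_cong)
    fix z assume "z \<in> space P2"
    then have "?A z + ?C z = 1" using split[of "fst z" "snd z"] by (cases z) (simp add: space_P2)
    then show "(?A z + ?C z) * ennreal (nu e (fst z) (snd z)) = 1 * ennreal (nu e (fst z) (snd z))" by simp
  qed
  have tot: "?S (\<lambda>z. 1) = (\<integral>\<^sup>+\<omega>. ennreal (real (N e T \<omega>)) \<partial>M)"
    by (intro nn_integral_cong) (use finite_jumps[OF _ e] in \<open>auto simp: jumps_upto_def ennreal_of_nat_eq_real_of_nat\<close>)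
  \<comment> \<open>The constant 1 differs from the indicator of the window \<open>{0<..T}\<close>
    only at time 0, which carries neither jumps nor Lebesgue mass.\<close>
  have full: "?S (\<lambda>z. 1) = ?R (\<lambda>z. 1)"
  proof -
    let ?I = "indicator ({0<..T} \<times> space M) :: real \<times> 'a \<Rightarrow> ennreal"
    have F0: "space M \<in> sets (F 0)"
      using filtration_onD(2)[OF filtration, of 0] horizon sets.top[of "F 0"] by simp
    have "?S (\<lambda>z. 1) = ?S ?I"
      by (intro nn_integral_cong) (auto dest: jump_times[OF _ e] simp: indicator_def)
    also have "\<dots> = ?R ?I"
      by (rule jump_compensator_Ioc[OF e refl]) (use F0 horizon in auto)
    also have "\<dots> = ?R (\<lambda>z. 1)"
    proof (rule nn_integral_cong_AE)
      have "AE z in P2. fst z \<noteq> 0"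
      proof (rule AE_P2I)
        show "countable {v \<in> {0..T}. \<not> fst (v, \<omega>) \<noteq> 0}" for \<omega> :: 'a
          by (rule countable_subset[of _ "{0}"]) auto
        have "fst \<in> borel_measurable P2" by (rule Pred_imp_P2[OF predictable_time[OF horizon filtration]])
        then show "{z \<in> space P2. fst z \<noteq> 0} \<in> sets P2" by measurable
      qed
      then show "AE z in P2. ?I z * ennreal (nu e (fst z) (snd z)) = 1 * ennreal (nu e (fst z) (snd z))"
        using AE_space by eventually_elim (auto simp: space_P2 indicator_def)
    qed
    finally show ?thesis .
  qed
  \<comment> \<open>Cancelling the part over A in \<open>ennreal\<close> requires it to be finite;
    the expected number of jumps is finite by \<open>integrable_count\<close>.\<close>
  have "?S ?A \<le> ?S (\<lambda>z. 1)" unfolding S1[symmetric] by simp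
  also have "\<dots> < \<infinity>" unfolding tot using integrable_count[OF e] by (simp add: real_integrable_def less_top)
  finally have "?S ?A \<noteq> \<top>" by simp
  moreover have "?S ?A + ?S ?C = ?S ?A + ?R ?C"
    by (rule trans[OF S1 trans[OF full trans[OF R1[symmetric]]]]) (simp only: compl(2))
  ultimately show ?case unfolding ennreal_add_left_cancel infinity_ennreal_def by blast
next
  case (mult u c)
  have "(\<integral>\<^sup>+\<omega>. (\<integral>\<^sup>+x. c * u (snd x, \<omega>) \<partial>count_space {x\<in>J e \<omega>. snd x \<le> T}) \<partial>M)
    = c * (\<integral>\<^sup>+\<omega>. (\<integral>\<^sup>+x. u (snd x, \<omega>) \<partial>count_space {x\<in>J e \<omega>. snd x \<le> T}) \<partial>M)"
    by (subst nn_integral_cmult, simp, rule nn_integral_cmult, rule jump_sum_measurable_M[OF e mult(1)])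
  moreover have "(\<integral>\<^sup>+z. c * u z * ennreal (nu e (fst z) (snd z)) \<partial>P2)
    = c * (\<integral>\<^sup>+z. u z * ennreal (nu e (fst z) (snd z)) \<partial>P2)"
    unfolding mult.assoc
    by (intro nn_integral_cmult borel_measurable_times_ennreal Pred_imp_P2[OF mult(1)] nu_measurable_nn[OF e])
  ultimately show ?case using mult(2) by (simp only:)
next
  case (add u v)
  have "u \<in> borel_measurable Pred" "v \<in> borel_measurable Pred" by (rule add)+
  from jump_sum_add[OF e this] nu_integral_add[OF e this] show ?case
    using add by (simp only:)
next
  case (seq U)
  have U: "U i \<in> borel_measurable Pred" for i by (rule seq)
  have [measurable]: "U i \<in> borel_measurable P2" for i by (rule Pred_imp_P2[OF U])
  have [measurable]: "(\<lambda>z. ennreal (nu e (fst z) (snd z))) \<in> borel_measurable P2"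
    using Pred_imp_P2[OF nu_predictable[OF e]] by (simp add: case_prod_beta')
  have mono: "U i z \<le> U j z" if "i \<le> j" for i j z
    by (rule le_funD[OF incseqD[OF \<open>incseq U\<close> that]])
  have "(\<integral>\<^sup>+\<omega>. (\<integral>\<^sup>+x. (SUP i. U i (snd x, \<omega>)) \<partial>count_space {x\<in>J e \<omega>. snd x \<le> T}) \<partial>M)
    = (\<integral>\<^sup>+\<omega>. (SUP i. \<integral>\<^sup>+x. U i (snd x, \<omega>) \<partial>count_space {x\<in>J e \<omega>. snd x \<le> T}) \<partial>M)"
    by (intro nn_integral_cong nn_integral_monotone_convergence_SUP) (auto simp: incseq_def le_fun_def intro!: mono)
  also have "\<dots> = (SUP i. \<integral>\<^sup>+\<omega>. (\<integral>\<^sup>+x. U i (snd x, \<omega>) \<partial>count_space {x\<in>J e \<omega>. snd x \<le> T}) \<partial>M)"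
    by (intro nn_integral_monotone_convergence_SUP jump_sum_measurable_M[OF e] U)
      (auto simp: incseq_def le_fun_def intro!: nn_integral_mono mono)
  also have "\<dots> = (SUP i. \<integral>\<^sup>+z. U i z * ennreal (nu e (fst z) (snd z)) \<partial>P2)" by (rule SUP_cong[OF refl], rule seq)
  also have "\<dots> = (\<integral>\<^sup>+z. (SUP i. U i z * ennreal (nu e (fst z) (snd z))) \<partial>P2)"
    by (intro nn_integral_monotone_convergence_SUP[symmetric])
      (auto simp: incseq_def le_fun_def intro!: mult_right_mono mono)
  also have "\<dots> = (\<integral>\<^sup>+z. (SUP i. U i z) * ennreal (nu e (fst z) (snd z)) \<partial>P2)"
    by (simp add: SUP_mult_right_ennreal)
  finally show ?case .
qed

definition jump_sum :: "'e \<Rightarrow> (real \<times> 'a \<Rightarrow> real) \<Rightarrow> real \<Rightarrow> 'a \<Rightarrow> real" where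
  "jump_sum e f t \<omega> = (\<Sum>x\<in>{x\<in>J e \<omega>. snd x \<le> t}. f (snd x, \<omega>))"

lemma nu_measurable: "e \<in> E \<Longrightarrow> (\<lambda>z. nu e (fst z) (snd z)) \<in> borel_measurable P2"
  using Pred_imp_P2[OF nu_predictable] by (simp add: case_prod_beta')

lemma jump_sum_obs_measurable:
  assumes "e \<in> E" "0 \<le> t" "t \<le> T" "f \<in> borel_measurable PredG"
  shows "jump_sum e f t \<in> borel_measurable (G t)"
  unfolding jump_sum_def[abs_def]
  by (rule jump_sum_measurable[OF obs_filtration N_obs_measurable_real])
    (use assms in auto)

lemma jump_sum_measurable_T:
  assumes "e \<in> E" "f \<in> borel_measurable Pred"
  shows "jump_sum e f T \<in> borel_measurable M"
  unfolding jump_sum_def[abs_def]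
  by (rule filtration_on_measurable[OF filtration horizon order_refl])
    (rule jump_sum_measurable[OF filtration N_measurable assms(1) horizon order_refl assms(2)],
      use assms in auto)

lemma jump_compensator_nonneg:
  assumes e: "e \<in> E" and f: "f \<in> borel_measurable Pred" and f0: "\<And>z. 0 \<le> f z"
    and int: "integrable P2 (\<lambda>z. f z * nu e (fst z) (snd z))"
  shows "integrable M (jump_sum e f T)"
    and "(LINT \<omega>|M. jump_sum e f T \<omega>) = (LINT z|P2. f z * nu e (fst z) (snd z))"
proof -
  have js0: "0 \<le> jump_sum e f T \<omega>" for \<omega>
    unfolding jump_sum_def by (intro sum_nonneg f0)
  have R0: "0 \<le> (LINT z|P2. f z * nu e (fst z) (snd z))"
    by (rule Bochner_Integration.integral_nonneg) (use nu_bounds[OF e] f0 in \<open>auto simp: space_P2\<close>)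
  have "(\<integral>\<^sup>+\<omega>. ennreal (jump_sum e f T \<omega>) \<partial>M)
    = (\<integral>\<^sup>+\<omega>. (\<integral>\<^sup>+x. ennreal (f (snd x, \<omega>)) \<partial>count_space {x\<in>J e \<omega>. snd x \<le> T}) \<partial>M)"
    unfolding jump_sum_def by (intro nn_integral_cong jump_sum_nonneg[symmetric] e f0)
  also have "\<dots> = (\<integral>\<^sup>+z. ennreal (f z) * ennreal (nu e (fst z) (snd z)) \<partial>P2)"
    by (rule jump_compensator_nn[OF e]) (use f in measurable)
  also have "\<dots> = (\<integral>\<^sup>+z. ennreal (f z * nu e (fst z) (snd z)) \<partial>P2)"
    by (intro nn_integral_cong ennreal_mult[symmetric] f0) (use nu_bounds[OF e] in \<open>auto simp: space_P2\<close>)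
  also have "\<dots> = ennreal (LINT z|P2. f z * nu e (fst z) (snd z))"
    by (rule nn_integral_eq_integral[OF int]) (use nu_bounds[OF e] f0 in \<open>auto simp: space_P2\<close>)
  finally have nn: "(\<integral>\<^sup>+\<omega>. ennreal (jump_sum e f T \<omega>) \<partial>M) = ennreal (LINT z|P2. f z * nu e (fst z) (snd z))" .
  show "integrable M (jump_sum e f T)"
    by (rule integrableI_nn_integral_finite[OF jump_sum_measurable_T[OF e f] _ nn]) (use js0 R0 in auto)
  show "(LINT \<omega>|M. jump_sum e f T \<omega>) = (LINT z|P2. f z * nu e (fst z) (snd z))"
    by (rule integral_eq_nn_integral[OF jump_sum_measurable_T[OF e f], THEN trans])
      (use js0 R0 nn in auto)
qed

lemma jump_compensator:
  assumes e: "e \<in> E" and f: "f \<in> borel_measurable Pred"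
    and int: "integrable P2 (\<lambda>z. f z * nu e (fst z) (snd z))"
  shows "integrable M (jump_sum e f T)"
    and "(LINT \<omega>|M. jump_sum e f T \<omega>) = (LINT z|P2. f z * nu e (fst z) (snd z))"
proof -
  let ?p = "\<lambda>z. max 0 (f z)" and ?n = "\<lambda>z. max 0 (- f z)"
  have m: "?p \<in> borel_measurable Pred" "?n \<in> borel_measurable Pred" using f by measurable
  have ip: "integrable P2 (\<lambda>z. ?p z * nu e (fst z) (snd z))"
    by (rule Bochner_Integration.integrable_bound[OF int])
      (use Pred_imp_P2[OF m(1)] nu_measurable[OF e] in \<open>auto simp: abs_mult intro!: AE_I2 mult_right_mono\<close>)
  have "in": "integrable P2 (\<lambda>z. ?n z * nu e (fst z) (snd z))"
    by (rule Bochner_Integration.integrable_bound[OF int])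
      (use Pred_imp_P2[OF m(2)] nu_measurable[OF e] in \<open>auto simp: abs_mult intro!: AE_I2 mult_right_mono\<close>)
  note p = jump_compensator_nonneg[OF e m(1) _ ip] and n = jump_compensator_nonneg[OF e m(2) _ "in"]
  have eq: "jump_sum e f T = (\<lambda>\<omega>. jump_sum e ?p T \<omega> - jump_sum e ?n T \<omega>)"
    unfolding jump_sum_def by (rule ext) (rule sum_pos_neg_parts)
  show "integrable M (jump_sum e f T)"
    unfolding eq by (intro Bochner_Integration.integrable_diff p n) auto
  have "(LINT \<omega>|M. jump_sum e f T \<omega>) = (LINT \<omega>|M. jump_sum e ?p T \<omega>) - (LINT \<omega>|M. jump_sum e ?n T \<omega>)"
    unfolding eq by (rule Bochner_Integration.integral_diff) (intro p n; auto)+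
  also have "\<dots> = (LINT z|P2. ?p z * nu e (fst z) (snd z)) - (LINT z|P2. ?n z * nu e (fst z) (snd z))"
    by (subst p, simp, subst n, simp, rule refl)
  also have "\<dots> = (LINT z|P2. ?p z * nu e (fst z) (snd z) - ?n z * nu e (fst z) (snd z))"
    by (rule Bochner_Integration.integral_diff[OF ip "in", symmetric])
  also have "\<dots> = (LINT z|P2. f z * nu e (fst z) (snd z))"
    by (rule Bochner_Integration.integral_cong) (auto simp: max_def)
  finally show "(LINT \<omega>|M. jump_sum e f T \<omega>) = (LINT z|P2. f z * nu e (fst z) (snd z))" .
qed

section \<open>Projection onto the observed filtration\<close>

lemma PredG_slice:
  assumes "X \<in> borel_measurable PredG" "0 \<le> v" "v \<le> T"
  shows "(\<lambda>\<omega>. X (v, \<omega>)) \<in> borel_measurable (G v)"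
proof -
  have "X \<in> borel_measurable (leb v \<Otimes>\<^sub>M G v)"
    by (rule predictable_imp_progressive[OF horizon obs_filtration assms(2,3) space_obs _ assms(1)])
      (use filtration_onD(3)[OF obs_filtration] assms in auto)
  from measurable_Pair2[OF this, of v] show ?thesis using assms by (simp add: space_restrict_space)
qed

lemma I_jointly_measurable: "(\<lambda>(t, \<omega>). I h t \<omega>) \<in> borel_measurable P2"
  by (rule right_continuous_imp_jointly_measurable[OF horizon])
    (use I_tendsto_right filtration_on_measurable[OF filtration _ _ I_adapted] in auto)

lemma pi_jointly_measurable:
  assumes "h \<in> {1..m}"
  shows "(\<lambda>(t, \<omega>). \<pi> h t \<omega>) \<in> borel_measurable P2"
  by (rule right_continuous_imp_jointly_measurable[OF horizon])
    (use filter_cadlag[OF assms] filtration_on_measurable[OF obs_filtration _ _ filter_adapted[OF assms]]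
      in \<open>auto simp: cadlag_on_def\<close>)

lemma I_cadlag: "\<omega> \<in> space M \<Longrightarrow> cadlag_on 0 T (\<lambda>t. I h t \<omega>)"
  unfolding cadlag_on_def using I_tendsto_left I_tendsto_right by fastforce

lemma AE_I_left: "AE z in P2. I_left h (fst z) (snd z) = I h (fst z) (snd z)"
proof (rule AE_P2I)
  have "(\<lambda>z. I h (fst z) (snd z)) \<in> borel_measurable P2" "(\<lambda>z. I_left h (fst z) (snd z)) \<in> borel_measurable P2"
    using I_jointly_measurable Pred_imp_P2[OF I_left_predictable] by (simp_all add: case_prod_beta')
  then show "{z \<in> space P2. I_left h (fst z) (snd z) = I h (fst z) (snd z)} \<in> sets P2"
    by measurable
  fix \<omega> assume w: "\<omega> \<in> space M"
  show "countable {v \<in> {0..T}. \<not> I_left h (fst (v, \<omega>)) (snd (v, \<omega>)) = I h (fst (v, \<omega>)) (snd (v, \<omega>))}"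
    by (rule countable_subset[OF _ cadlag_on_countable_jumps[OF I_cadlag[OF w, of h]]])
      (auto simp: I_left_eq[OF w])
qed

lemma AE_pi_left:
  assumes h: "h \<in> {1..m}"
  shows "AE z in P2. pi_left h (fst z) (snd z) = \<pi> h (fst z) (snd z)"
proof (rule AE_P2I)
  have "(\<lambda>z. \<pi> h (fst z) (snd z)) \<in> borel_measurable P2" "(\<lambda>z. pi_left h (fst z) (snd z)) \<in> borel_measurable P2"
    using pi_jointly_measurable[OF h] PredG_imp_P2[OF pi_left_predictable[OF h]] by (simp_all add: case_prod_beta')
  then show "{z \<in> space P2. pi_left h (fst z) (snd z) = \<pi> h (fst z) (snd z)} \<in> sets P2"
    by measurable
  fix \<omega> assume w: "\<omega> \<in> space M"
  show "countable {v \<in> {0..T}. \<not> pi_left h (fst (v, \<omega>)) (snd (v, \<omega>)) = \<pi> h (fst (v, \<omega>)) (snd (v, \<omega>))}"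
    by (rule countable_subset[OF _ cadlag_on_countable_jumps[OF filter_cadlag[OF h w]]])
      (auto simp: pi_left_def)
qed

text \<open>At a fixed time v the slice of f is known in \<open>G v\<close>, so conditioning
  replaces I by \<pi>. The filter is a conditional expectation at fixed times, which says nothing
  directly about its left limits; hence the detour from left limits to values and back, both
  exchanges being valid almost everywhere.\<close>

lemma projection:
  assumes h: "h \<in> {1..m}" and f: "f \<in> borel_measurable PredG" and int: "integrable P2 f"
  shows "(LINT z|P2. f z * I_left h (fst z) (snd z)) = (LINT z|P2. f z * pi_left h (fst z) (snd z))"
proof -
  have fm[measurable]: "f \<in> borel_measurable P2" by (rule PredG_imp_P2[OF f])
  have m[measurable]: "(\<lambda>z. I h (fst z) (snd z)) \<in> borel_measurable P2" "(\<lambda>z. I_left h (fst z) (snd z)) \<in> borel_measurable P2"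
      "(\<lambda>z. \<pi> h (fst z) (snd z)) \<in> borel_measurable P2" "(\<lambda>z. pi_left h (fst z) (snd z)) \<in> borel_measurable P2"
    using I_jointly_measurable[of h] Pred_imp_P2[OF I_left_predictable, of h]
      pi_jointly_measurable[OF h] PredG_imp_P2[OF pi_left_predictable[OF h]] by (simp_all add: case_prod_beta')
  have intI: "integrable P2 (\<lambda>z. f z * I h (fst z) (snd z))"
    by (rule Bochner_Integration.integrable_bound[OF int])
      (auto simp: abs_mult I_bounds intro!: AE_I2 mult_left_le)
  have intpi: "integrable P2 (\<lambda>z. f z * \<pi> h (fst z) (snd z))"
    by (rule Bochner_Integration.integrable_bound[OF int])
      (use filter_bounds[OF h] in \<open>auto simp: abs_mult space_P2 intro!: AE_I2 mult_left_le\<close>)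
  have "(LINT z|P2. f z * I_left h (fst z) (snd z)) = (LINT z|P2. f z * I h (fst z) (snd z))"
    by (rule integral_cong_AE) (use AE_I_left[of h] in \<open>auto elim: eventually_mono\<close>)
  also have "\<dots> = (LINT v|leb T. LINT \<omega>|M. f (v, \<omega>) * I h v \<omega>)"
    using P2.integral_fst'[OF intI] by simp
  also have "\<dots> = (LINT v|leb T. LINT \<omega>|M. f (v, \<omega>) * \<pi> h v \<omega>)"
  proof (rule Bochner_Integration.integral_cong_AE)
    show "(\<lambda>v. LINT \<omega>|M. f (v, \<omega>) * I h v \<omega>) \<in> borel_measurable (leb T)"
      using P2.integrable_fst'[OF intI] by simp
    show "(\<lambda>v. LINT \<omega>|M. f (v, \<omega>) * \<pi> h v \<omega>) \<in> borel_measurable (leb T)"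
      using P2.integrable_fst'[OF intpi] by simp
    show "AE v in leb T. (LINT \<omega>|M. f (v, \<omega>) * I h v \<omega>) = (LINT \<omega>|M. f (v, \<omega>) * \<pi> h v \<omega>)"
      using P2.AE_integrable_fst'[OF intI] AE_space
    proof eventually_elim
      case (elim v)
      then have v: "0 \<le> v" "v \<le> T" by (auto simp: space_restrict_space)
      interpret sub: finite_measure_subalgebra M "G v"
        by unfold_locales (rule filtration_onD(1)[OF obs_filtration v])
      have Im: "I h v \<in> borel_measurable M"
        by (rule filtration_on_measurable[OF filtration v I_adapted[OF v]])
      have pim: "\<pi> h v \<in> borel_measurable M"
        by (rule filtration_on_measurable[OF obs_filtration v filter_adapted[OF h v]])
      have fv: "(\<lambda>\<omega>. f (v, \<omega>)) \<in> borel_measurable (G v)" by (rule PredG_slice[OF f v])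
      have fvM: "(\<lambda>\<omega>. f (v, \<omega>)) \<in> borel_measurable M"
        by (rule filtration_on_measurable[OF obs_filtration v fv])
      have "integrable M (\<lambda>\<omega>. f (v, \<omega>) * I h v \<omega>)" using elim(1) by simp
      from sub.real_cond_exp_intg(2)[OF this fv Im]
      have "(LINT \<omega>|M. f (v, \<omega>) * I h v \<omega>) = (LINT \<omega>|M. f (v, \<omega>) * real_cond_exp M (G v) (I h v) \<omega>)" by simp
      also have "\<dots> = (LINT \<omega>|M. f (v, \<omega>) * \<pi> h v \<omega>)"
        by (rule integral_cong_AE)
          (use filter_cond_exp[OF h v] fvM pim in \<open>auto simp: I_def[abs_def] elim: eventually_mono\<close>)
      finally show ?case .
    qed
  qed
  also have "\<dots> = (LINT z|P2. f z * \<pi> h (fst z) (snd z))"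
    using P2.integral_fst'[OF intpi] by simp
  also have "\<dots> = (LINT z|P2. f z * pi_left h (fst z) (snd z))"
    by (rule integral_cong_AE) (use AE_pi_left[OF h] in \<open>auto elim: eventually_mono\<close>)
  finally show ?thesis .
qed

lemma integrable_P2_mult_bounded:
  fixes f g :: "real \<times> 'a \<Rightarrow> real"
  assumes f: "integrable P2 f" and g: "g \<in> borel_measurable P2"
    and b: "\<And>t \<omega>. 0 \<le> t \<Longrightarrow> t \<le> T \<Longrightarrow> \<omega> \<in> space M \<Longrightarrow> \<bar>g (t, \<omega>)\<bar> \<le> B"
  shows "integrable P2 (\<lambda>z. f z * g z)"
proof (rule Bochner_Integration.integrable_bound)
  show "integrable P2 (\<lambda>z. f z * B)" using f by simp
  show "(\<lambda>z. f z * g z) \<in> borel_measurable P2" using g f by measurable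
  show "AE z in P2. norm (f z * g z) \<le> norm (f z * B)"
  proof (rule AE_I2)
    fix z assume "z \<in> space P2"
    then have "\<bar>g z\<bar> \<le> \<bar>B\<bar>" using b[of "fst z" "snd z"] by (cases z) (auto simp: space_P2)
    then show "norm (f z * g z) \<le> norm (f z * B)" by (simp add: abs_mult mult_left_mono)
  qed
qed

lemma exposure_measurable:
  assumes "e \<in> E" shows "(\<lambda>z. Y e (fst z) (snd z)) \<in> borel_measurable PredG"
  using exposure_predictable[OF assms] by (simp add: case_prod_beta')

lemma pi_left_measurable: "h \<in> {1..m} \<Longrightarrow> (\<lambda>z. pi_left h (fst z) (snd z)) \<in> borel_measurable PredG"
  using pi_left_predictable by (simp add: case_prod_beta')

lemma lam_measurable: "(\<lambda>z. lam e (fst z) (snd z)) \<in> borel_measurable PredG"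
  using lam_predictable by (simp add: case_prod_beta')

lemma I_left_measurable: "(\<lambda>z. I_left h (fst z) (snd z)) \<in> borel_measurable Pred"
  using I_left_predictable by (simp add: case_prod_beta')

lemma integrable_exposure:
  assumes e: "e \<in> E" and f: "f \<in> borel_measurable PredG" and int: "integrable P2 f"
  shows "integrable P2 (\<lambda>z. f z * Y e (fst z) (snd z) * c)"
    "(\<lambda>z. f z * Y e (fst z) (snd z) * c) \<in> borel_measurable PredG"
proof -
  have "integrable P2 (\<lambda>z. f z * Y e (fst z) (snd z))"
    by (rule integrable_P2_mult_bounded[OF int PredG_imp_P2[OF exposure_measurable[OF e]], where B = K])
      (use exposure_bounds[OF e] in auto)
  then show "integrable P2 (\<lambda>z. f z * Y e (fst z) (snd z) * c)" by simp
  show "(\<lambda>z. f z * Y e (fst z) (snd z) * c) \<in> borel_measurable PredG"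
    using f exposure_measurable[OF e] by measurable
qed

text \<open>This gives the observed intensity. The exposure is G-predictable, so only the state
  indicators inside \<open>nu\<close> are projected, one state at a time.\<close>

lemma intensity_projection:
  assumes e: "e \<in> E" and f: "f \<in> borel_measurable PredG" and int: "integrable P2 f"
  shows "(LINT z|P2. f z * nu e (fst z) (snd z)) = (LINT z|P2. f z * (Y e (fst z) (snd z) * lam e (fst z) (snd z)))"
proof -
  note fe = integrable_exposure[OF e f int]
  have i1: "integrable P2 (\<lambda>z. f z * Y e (fst z) (snd z) * ell r e * I_left r (fst z) (snd z))" for r
    by (rule integrable_P2_mult_bounded[OF fe(1) Pred_imp_P2[OF I_left_measurable], where B = 1]) (auto simp: I_bounds)
  have i2: "integrable P2 (\<lambda>z. f z * Y e (fst z) (snd z) * ell r e * pi_left r (fst z) (snd z))" if "r \<in> {1..m}" for r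
    by (rule integrable_P2_mult_bounded[OF fe(1) PredG_imp_P2[OF pi_left_measurable[OF that]], where B = 1])
      (use pi_left_bounds[OF that] in auto)
  have "(LINT z|P2. f z * nu e (fst z) (snd z))
    = (LINT z|P2. (\<Sum>r=1..m. f z * Y e (fst z) (snd z) * ell r e * I_left r (fst z) (snd z)))"
    by (rule Bochner_Integration.integral_cong) (auto simp: nu_def sum_distrib_left mult_ac)
  also have "\<dots> = (\<Sum>r=1..m. LINT z|P2. f z * Y e (fst z) (snd z) * ell r e * I_left r (fst z) (snd z))"
    by (rule Bochner_Integration.integral_sum) (rule i1)
  also have "\<dots> = (\<Sum>r=1..m. LINT z|P2. f z * Y e (fst z) (snd z) * ell r e * pi_left r (fst z) (snd z))"
    by (intro sum.cong refl projection fe)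
  also have "\<dots> = (LINT z|P2. (\<Sum>r=1..m. f z * Y e (fst z) (snd z) * ell r e * pi_left r (fst z) (snd z)))"
    by (rule Bochner_Integration.integral_sum[symmetric]) (rule i2)
  also have "\<dots> = (LINT z|P2. f z * (Y e (fst z) (snd z) * lam e (fst z) (snd z)))"
    by (rule Bochner_Integration.integral_cong) (auto simp: lam_def sum_distrib_left mult_ac)
  finally show ?thesis .
qed

section \<open>The right-hand side of the filter equation\<close>

text \<open>Posterior minus prior in Bayes' rule: a jump of type e multiplies the weight of state h
  by its rate \<open>ell h e\<close>, and \<open>lam\<close> renormalises.\<close>

definition gain :: "nat \<Rightarrow> 'e \<Rightarrow> real \<Rightarrow> 'a \<Rightarrow> real" where
  "gain h e t \<omega> = ell h e * pi_left h t \<omega> / lam e t \<omega> - pi_left h t \<omega>"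

definition drift :: "nat \<Rightarrow> real \<Rightarrow> 'a \<Rightarrow> real" where
  "drift h t \<omega> = (\<Sum>r=1..m. k r h * pi_left r t \<omega>)"

text \<open>The right-hand side of the filter equation for the given \<pi>, with the integrals
  against the counts written as sums over jumps; \<open>gain_integral_eq\<close> translates
  back.\<close>

definition X :: "nat \<Rightarrow> real \<Rightarrow> 'a \<Rightarrow> real" where
  "X h t \<omega> = \<pi> h 0 \<omega> + (LINT v:{0..t}|lborel. drift h v \<omega>)
     + (\<Sum>e\<in>E. jump_sum e (\<lambda>z. gain h e (fst z) (snd z)) t \<omega>
          - (LINT v:{0..t}|lborel. gain h e v \<omega> * (Y e v \<omega> * lam e v \<omega>)))"

lemma gain_measurable:
  assumes "h \<in> {1..m}" shows "(\<lambda>z. gain h e (fst z) (snd z)) \<in> borel_measurable PredG"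
  unfolding gain_def using pi_left_measurable[OF assms] lam_measurable[of e] by measurable

lemma drift_measurable: "(\<lambda>z. drift h (fst z) (snd z)) \<in> borel_measurable PredG"
  unfolding drift_def by (intro borel_measurable_sum borel_measurable_times pi_left_measurable) auto

lemma ell_pi_le_lam:
  assumes "h \<in> {1..m}" "e \<in> E" "\<omega> \<in> space M" "0 \<le> t" "t \<le> T"
  shows "ell h e * pi_left h t \<omega> \<le> lam e t \<omega>"
  unfolding lam_def
  by (rule member_le_sum[OF assms(1), of "\<lambda>r. ell r e * pi_left r t \<omega>"])
    (use ell_nonneg[OF assms(2)] pi_left_bounds[OF _ assms(3-5)] in auto)

text \<open>Posterior and prior both lie in [0, 1]. Since a jump of the counts moves X by at most 1,
  the number of jumps controls X.\<close>

lemma gain_bound: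
  assumes "h \<in> {1..m}" "e \<in> E" "\<omega> \<in> space M" "0 \<le> t" "t \<le> T"
  shows "\<bar>gain h e t \<omega>\<bar> \<le> 1"
proof -
  have "0 \<le> ell h e * pi_left h t \<omega> / lam e t \<omega>"
    using ell_nonneg[OF assms(2,1)] pi_left_bounds[OF assms(1,3-5)] lam_bounds[OF assms(2-5)] by simp
  moreover have "ell h e * pi_left h t \<omega> / lam e t \<omega> \<le> 1"
    using ell_pi_le_lam[OF assms] lam_bounds[OF assms(2-5)] by (cases "lam e t \<omega> = 0") auto
  ultimately show ?thesis using pi_left_bounds[OF assms(1,3-5)] unfolding gain_def by linarith
qed

text \<open>Where \<open>lam\<close> vanishes, so does \<open>ell h e * pi_left h\<close>: the convention \<open>x / 0 = 0\<close> does no harm.\<close>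

lemma gain_mult_lam:
  assumes "h \<in> {1..m}" "e \<in> E" "\<omega> \<in> space M" "0 \<le> t" "t \<le> T"
  shows "gain h e t \<omega> * lam e t \<omega> = ell h e * pi_left h t \<omega> - pi_left h t \<omega> * lam e t \<omega>"
proof (cases "lam e t \<omega> = 0")
  case True
  then have "ell h e * pi_left h t \<omega> = 0"
    using ell_pi_le_lam[OF assms] ell_nonneg[OF assms(2,1)] pi_left_bounds[OF assms(1,3-5)]
    by (metis antisym mult_nonneg_nonneg)
  then show ?thesis using True by simp
next
  case False
  then show ?thesis by (simp add: gain_def left_diff_distrib)
qed

definition k_max :: "nat \<Rightarrow> real" where
  "k_max h = (\<Sum>r=1..m. \<bar>k r h\<bar>)"

lemma drift_bound:
  assumes "\<omega> \<in> space M" "0 \<le> t" "t \<le> T"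
  shows "\<bar>drift h t \<omega>\<bar> \<le> k_max h"
  unfolding drift_def k_max_def
proof (rule order.trans[OF sum_abs sum_mono])
  fix r assume "r \<in> {1..m}"
  then show "\<bar>k r h * pi_left r t \<omega>\<bar> \<le> \<bar>k r h\<bar>"
    using pi_left_bounds[OF _ assms, of r] by (simp add: abs_mult mult_left_le)
qed

lemma comp_bound:
  assumes "h \<in> {1..m}" "e \<in> E" "\<omega> \<in> space M" "0 \<le> t" "t \<le> T"
  shows "\<bar>gain h e t \<omega> * (Y e t \<omega> * lam e t \<omega>)\<bar> \<le> K * ell_max"
proof -
  have "\<bar>gain h e t \<omega>\<bar> * \<bar>Y e t \<omega> * lam e t \<omega>\<bar> \<le> 1 * (K * ell_max)"
    using gain_bound[OF assms] exposure_bounds[OF assms(2-5)] lam_bounds[OF assms(2-5)] K_nonneg[OF assms(2)] ell_max_nonneg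
    by (intro mult_mono) (auto simp: abs_mult intro!: mult_mono)
  then show ?thesis by (simp add: abs_mult)
qed

lemma path_measurable:
  assumes "f \<in> borel_measurable P2" "\<omega> \<in> space M"
  shows "(\<lambda>v. f (v, \<omega>)) \<in> borel_measurable (leb T)"
  using measurable_Pair1[OF assms] by simp

lemma leb_integrable:
  fixes g :: "real \<Rightarrow> real"
  assumes g: "g \<in> borel_measurable (leb T)" and B: "\<And>v. 0 \<le> v \<Longrightarrow> v \<le> T \<Longrightarrow> \<bar>g v\<bar> \<le> B"
  shows "integrable (leb T) (\<lambda>v. indicator {s<..t} v * g v)"
proof (rule finite_measure.integrable_const_bound[OF finite_leb, of _ "\<bar>B\<bar>"])
  have "indicator {s<..t} \<in> borel_measurable (leb T)"
    by (rule measurable_restrict_space1) simp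
  then show "(\<lambda>v. indicator {s<..t} v * g v) \<in> borel_measurable (leb T)" using g by measurable
  show "AE v in leb T. norm (indicator {s<..t} v * g v) \<le> \<bar>B\<bar>"
    using B by (intro AE_I2) (force simp: space_restrict_space indicator_def)
qed

lemma leb_increment:
  fixes g :: "real \<Rightarrow> real"
  assumes g: "g \<in> borel_measurable (leb T)" and B: "\<And>v. 0 \<le> v \<Longrightarrow> v \<le> T \<Longrightarrow> \<bar>g v\<bar> \<le> B"
    and st: "0 \<le> s" "s \<le> t" "t \<le> T"
  shows "(LINT v:{0..t}|lborel. g v) - (LINT v:{0..s}|lborel. g v) = (LINT v|leb T. indicator {s<..t} v * g v)"
    and "\<bar>LINT v|leb T. indicator {s<..t} v * g v\<bar> \<le> B * (t - s)"
proof -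
  have "(LINT v:{0..t}|lborel. g v) - (LINT v:{0..s}|lborel. g v)
    = (LINT v|leb T. indicator {0<..t} v * g v) - (LINT v|leb T. indicator {0<..s} v * g v)"
    using leb_integral_Ioc[OF _ _ g, of 0 t] leb_integral_Ioc[OF _ _ g, of 0 s] st by simp
  also have "\<dots> = (LINT v|leb T. indicator {0<..t} v * g v - indicator {0<..s} v * g v)"
    by (rule Bochner_Integration.integral_diff[symmetric]) (intro leb_integrable[OF g B]; assumption)+
  also have "\<dots> = (LINT v|leb T. indicator {s<..t} v * g v)"
    by (rule Bochner_Integration.integral_cong) (use st in \<open>auto simp: indicator_def\<close>)
  finally show "(LINT v:{0..t}|lborel. g v) - (LINT v:{0..s}|lborel. g v) = (LINT v|leb T. indicator {s<..t} v * g v)" .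
  have ic: "integrable (leb T) (\<lambda>v. indicator {s<..t} v * B)"
    by (rule leb_integrable[of "\<lambda>v. B" "\<bar>B\<bar>"]) auto
  have "\<bar>LINT v|leb T. indicator {s<..t} v * g v\<bar> \<le> (LINT v|leb T. \<bar>indicator {s<..t} v * g v\<bar>)"
    by (rule integral_abs_bound)
  also have "\<dots> \<le> (LINT v|leb T. indicator {s<..t} v * B)"
    by (rule integral_mono)
      (use leb_integrable[OF g B] ic B in \<open>auto simp: indicator_def space_restrict_space\<close>)
  also have "\<dots> = (LINT v:{s..t}|lborel. B)"
    by (rule leb_integral_Ioc[symmetric]) (use st in auto)
  also have "\<dots> = B * (t - s)"
    using st by (simp add: set_lebesgue_integral_def)
  finally show "\<bar>LINT v|leb T. indicator {s<..t} v * g v\<bar> \<le> B * (t - s)" .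
qed

definition comp :: "nat \<Rightarrow> 'e \<Rightarrow> real \<times> 'a \<Rightarrow> real" where
  "comp h e z = gain h e (fst z) (snd z) * (Y e (fst z) (snd z) * lam e (fst z) (snd z))"

lemma comp_measurable:
  assumes "h \<in> {1..m}" "e \<in> E" shows "comp h e \<in> borel_measurable PredG"
  unfolding comp_def[abs_def]
  using gain_measurable[OF assms(1)] lam_measurable exposure_measurable[OF assms(2)] by measurable

lemma jump_sum_increment:
  assumes "e \<in> E" "\<omega> \<in> space M" "s \<le> t"
  shows "jump_sum e f t \<omega> - jump_sum e f s \<omega> = (\<Sum>x\<in>{x\<in>J e \<omega>. s < snd x \<and> snd x \<le> t}. f (snd x, \<omega>))"
proof -
  have "{x\<in>J e \<omega>. snd x \<le> t} = {x\<in>J e \<omega>. snd x \<le> s} \<union> {x\<in>J e \<omega>. s < snd x \<and> snd x \<le> t}" using assms by auto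
  then show ?thesis unfolding jump_sum_def
    using finite_jumps[OF assms(2,1)] by (simp add: sum.union_disjoint disjoint_iff)
qed

lemma jump_sum_increment_T:
  assumes "e \<in> E" "\<omega> \<in> space M" "s \<le> t" "t \<le> T"
  shows "jump_sum e f t \<omega> - jump_sum e f s \<omega> = jump_sum e (\<lambda>z. indicator {s<..t} (fst z) * f z) T \<omega>"
  unfolding jump_sum_increment[OF assms(1-3)] unfolding jump_sum_def
  by (rule sum.mono_neutral_cong_left) (use finite_jumps[OF assms(2,1)] assms in \<open>auto simp: indicator_def\<close>)

lemma X_increment:
  assumes h: "h \<in> {1..m}" and w: "\<omega> \<in> space M" and st: "0 \<le> s" "s \<le> t" "t \<le> T"
  shows "X h t \<omega> - X h s \<omega> = (LINT v|leb T. indicator {s<..t} v * drift h v \<omega>)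
    + (\<Sum>e\<in>E. (jump_sum e (\<lambda>z. gain h e (fst z) (snd z)) t \<omega> - jump_sum e (\<lambda>z. gain h e (fst z) (snd z)) s \<omega>)
        - (LINT v|leb T. indicator {s<..t} v * comp h e (v, \<omega>)))"
proof -
  have d: "(LINT v:{0..t}|lborel. drift h v \<omega>) - (LINT v:{0..s}|lborel. drift h v \<omega>) =
      (LINT v|leb T. indicator {s<..t} v * drift h v \<omega>)"
    using path_measurable[OF PredG_imp_P2[OF drift_measurable] w] drift_bound[OF w]
    by (intro leb_increment st) auto
  have c: "(LINT v:{0..t}|lborel. comp h e (v, \<omega>)) - (LINT v:{0..s}|lborel. comp h e (v, \<omega>)) =
      (LINT v|leb T. indicator {s<..t} v * comp h e (v, \<omega>))" if e: "e \<in> E" for e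
    by (intro leb_increment[of _ "K * ell_max"] st path_measurable[OF PredG_imp_P2[OF comp_measurable[OF h e]] w])
      (use comp_bound[OF h e w] in \<open>auto simp: comp_def\<close>)
  have "(\<Sum>e\<in>E. (jump_sum e (\<lambda>z. gain h e (fst z) (snd z)) t \<omega> - jump_sum e (\<lambda>z. gain h e (fst z) (snd z)) s \<omega>)
        - (LINT v|leb T. indicator {s<..t} v * comp h e (v, \<omega>)))
     = (\<Sum>e\<in>E. (jump_sum e (\<lambda>z. gain h e (fst z) (snd z)) t \<omega> - (LINT v:{0..t}|lborel. comp h e (v, \<omega>)))
         - (jump_sum e (\<lambda>z. gain h e (fst z) (snd z)) s \<omega> - (LINT v:{0..s}|lborel. comp h e (v, \<omega>))))"
    by (rule sum.cong) (simp_all add: c[symmetric])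
  then show ?thesis unfolding X_def d[symmetric] comp_def fst_conv snd_conv sum_subtractf by simp
qed

text \<open>Lipschitz constant of X between its jumps: one contribution from the drift and one from
  each compensator.\<close>

definition var_const :: "nat \<Rightarrow> real" where
  "var_const h = k_max h + (\<Sum>e\<in>E. K * ell_max)"

text \<open>Once the jumps are removed only time integrals of bounded processes remain. The
  variation of X and its one-sided limits are both read off from this bound.\<close>

lemma X_jump_bound:
  assumes h: "h \<in> {1..m}" and w: "\<omega> \<in> space M" and st: "0 \<le> s" "s \<le> t" "t \<le> T"
  shows "\<bar>X h t \<omega> - X h s \<omega> - (\<Sum>e\<in>E. \<Sum>x\<in>{x\<in>J e \<omega>. s < snd x \<and> snd x \<le> t}. gain h e (snd x) \<omega>)\<bar> \<le> var_const h * (t - s)"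
proof -
  have d: "\<bar>LINT v|leb T. indicator {s<..t} v * drift h v \<omega>\<bar> \<le> k_max h * (t - s)"
    using path_measurable[OF PredG_imp_P2[OF drift_measurable] w] drift_bound[OF w]
    by (intro leb_increment st) auto
  have c: "\<bar>LINT v|leb T. indicator {s<..t} v * comp h e (v, \<omega>)\<bar> \<le> K * ell_max * (t - s)" if e: "e \<in> E" for e
    by (intro leb_increment[of _ "K * ell_max"] st path_measurable[OF PredG_imp_P2[OF comp_measurable[OF h e]] w])
      (use comp_bound[OF h e w] in \<open>auto simp: comp_def\<close>)
  have "\<bar>\<Sum>e\<in>E. LINT v|leb T. indicator {s<..t} v * comp h e (v, \<omega>)\<bar> \<le> (\<Sum>e\<in>E. K * ell_max * (t - s))"
    by (rule order.trans[OF sum_abs sum_mono]) (rule c)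
  also have "\<dots> = (\<Sum>e\<in>E. K * ell_max) * (t - s)" by (simp only: sum_distrib_right)
  finally have "\<bar>\<Sum>e\<in>E. LINT v|leb T. indicator {s<..t} v * comp h e (v, \<omega>)\<bar> \<le> (\<Sum>e\<in>E. K * ell_max) * (t - s)" .
  moreover have "X h t \<omega> - X h s \<omega> - (\<Sum>e\<in>E. \<Sum>x\<in>{x\<in>J e \<omega>. s < snd x \<and> snd x \<le> t}. gain h e (snd x) \<omega>)
    = (LINT v|leb T. indicator {s<..t} v * drift h v \<omega>) - (\<Sum>e\<in>E. LINT v|leb T. indicator {s<..t} v * comp h e (v, \<omega>))"
    unfolding X_increment[OF h w st] by (simp add: jump_sum_increment[OF _ w st(2)] sum_subtractf)
  ultimately show ?thesis using d unfolding var_const_def distrib_right by linarith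
qed

lemma X_variation:
  assumes h: "h \<in> {1..m}" and w: "\<omega> \<in> space M" and st: "0 \<le> s" "s \<le> t" "t \<le> T"
  shows "\<bar>X h t \<omega> - X h s \<omega>\<bar> \<le> var_const h * (t - s) + (\<Sum>e\<in>E. real (N e t \<omega>) - real (N e s \<omega>))"
proof -
  have "\<bar>\<Sum>x\<in>{x\<in>J e \<omega>. s < snd x \<and> snd x \<le> t}. gain h e (snd x) \<omega>\<bar> \<le> real (N e t \<omega>) - real (N e s \<omega>)"
    if e: "e \<in> E" for e
  proof -
    have "\<bar>\<Sum>x\<in>{x\<in>J e \<omega>. s < snd x \<and> snd x \<le> t}. gain h e (snd x) \<omega>\<bar>
       \<le> (\<Sum>x\<in>{x\<in>J e \<omega>. s < snd x \<and> snd x \<le> t}. 1)"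
    proof (rule order.trans[OF sum_abs sum_mono])
      fix x assume "x \<in> {x \<in> J e \<omega>. s < snd x \<and> snd x \<le> t}"
      then show "\<bar>gain h e (snd x) \<omega>\<bar> \<le> 1"
        using jump_times[OF w e, of x] gain_bound[OF h e w, of "snd x"] by simp
    qed
    also have "\<dots> = real (N e t \<omega>) - real (N e s \<omega>)"
      using jumps_upto_diff[OF finite_jumps[OF w e] st(2)] by simp
    finally show ?thesis .
  qed
  then have "\<bar>\<Sum>e\<in>E. \<Sum>x\<in>{x\<in>J e \<omega>. s < snd x \<and> snd x \<le> t}. gain h e (snd x) \<omega>\<bar>
      \<le> (\<Sum>e\<in>E. real (N e t \<omega>) - real (N e s \<omega>))"
    by (rule order.trans[OF sum_abs sum_mono])
  then show ?thesis using X_jump_bound[OF h w st] by linarith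
qed

lemma X_zero: "h \<in> {1..m} \<Longrightarrow> \<omega> \<in> space M \<Longrightarrow> X h 0 \<omega> = \<pi> h 0 \<omega>"
proof -
  assume w: "\<omega> \<in> space M"
  have "jump_sum e f 0 \<omega> = 0" if "e \<in> E" for e f
  proof -
    have "{x \<in> J e \<omega>. snd x \<le> 0} = {}" using jump_times[OF w that] by fastforce
    then show ?thesis unfolding jump_sum_def by (simp only: sum.empty)
  qed
  then show ?thesis unfolding X_def by (simp add: set_integral_singleton)
qed

lemma N_zero: "e \<in> E \<Longrightarrow> \<omega> \<in> space M \<Longrightarrow> N e 0 \<omega> = 0"
  unfolding jumps_upto_def using jump_times[of \<omega> e] by (force simp: card_eq_0_iff)

lemma X_bound:
  assumes h: "h \<in> {1..m}" and w: "\<omega> \<in> space M" and t: "0 \<le> t" "t \<le> T"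
  shows "\<bar>X h t \<omega>\<bar> \<le> 1 + var_const h * T + (\<Sum>e\<in>E. real (N e T \<omega>))"
proof -
  have "0 \<le> var_const h" unfolding var_const_def k_max_def
    by (intro add_nonneg_nonneg sum_nonneg mult_nonneg_nonneg ell_max_nonneg K_nonneg) auto
  then have "var_const h * t \<le> var_const h * T" using t by (intro mult_left_mono) auto
  moreover have "(\<Sum>e\<in>E. real (N e t \<omega>) - real (N e 0 \<omega>)) \<le> (\<Sum>e\<in>E. real (N e T \<omega>))"
    using jumps_upto_mono[OF finite_jumps[OF w] t(2)] by (intro sum_mono) (simp add: N_zero[OF _ w])
  moreover have "\<bar>X h 0 \<omega>\<bar> \<le> 1" using filter_bounds[OF h w, of 0] X_zero[OF h w] horizon by simp
  ultimately show ?thesis using X_variation[OF h w order_refl t] by simp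
qed

lemma X_adapted:
  assumes h: "h \<in> {1..m}" and t: "0 \<le> t" "t \<le> T"
  shows "X h t \<in> borel_measurable (G t)"
proof -
  have "\<pi> h 0 \<in> borel_measurable (G t)"
    using t by (intro filtration_on_measurable_mono[OF obs_filtration _ _ _ filter_adapted[OF h]]) auto
  moreover have "(\<lambda>\<omega>. LINT v:{0..t}|lborel. comp h e (v, \<omega>)) \<in> borel_measurable (G t)" if "e \<in> E" for e
    by (rule progressive_integral_measurable[OF horizon obs_filtration t comp_measurable[OF h that]])
  moreover have "(\<lambda>\<omega>. LINT v:{0..t}|lborel. drift h v \<omega>) \<in> borel_measurable (G t)"
    using progressive_integral_measurable[OF horizon obs_filtration t drift_measurable] by simp
  moreover have "jump_sum e (\<lambda>z. gain h e (fst z) (snd z)) t \<in> borel_measurable (G t)" if "e \<in> E" for e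
    by (rule jump_sum_obs_measurable[OF that t gain_measurable[OF h]])
  ultimately show ?thesis unfolding X_def[abs_def] comp_def fst_conv snd_conv
    by (intro borel_measurable_add borel_measurable_sum borel_measurable_diff)
qed

lemma integrable_total_count: "integrable M (\<lambda>\<omega>. \<Sum>e\<in>E. real (N e T \<omega>))"
  by (intro Bochner_Integration.integrable_sum integrable_count)

lemma X_integrable:
  assumes h: "h \<in> {1..m}" and t: "0 \<le> t" "t \<le> T"
  shows "integrable M (X h t)"
proof (rule Bochner_Integration.integrable_bound)
  show "integrable M (\<lambda>\<omega>. 1 + var_const h * T + (\<Sum>e\<in>E. real (N e T \<omega>)))"
    using integrable_total_count by simp
  show "X h t \<in> borel_measurable M"
    by (rule filtration_on_measurable[OF obs_filtration t X_adapted[OF h t]])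
  show "AE \<omega> in M. norm (X h t \<omega>) \<le> norm (1 + var_const h * T + (\<Sum>e\<in>E. real (N e T \<omega>)))"
    using X_bound[OF h _ t] by (intro AE_I2) (smt (verit) real_norm_def)
qed

lemma I_integrable: "0 \<le> t \<Longrightarrow> t \<le> T \<Longrightarrow> integrable M (I h t)"
  by (rule integrable_const_bound[of _ 1])
    (use filtration_on_measurable[OF filtration _ _ I_adapted[of t h]] in \<open>auto simp: I_bounds\<close>)

lemma indicator_mult_integrable:
  assumes "A \<in> sets M" "integrable M f"
  shows "integrable M (\<lambda>\<omega>. indicator A \<omega> * f \<omega> :: real)"
  using integrable_mult_indicator[OF assms] by simp

section \<open>Orthogonality of the increments of X - I to the observed past\<close>

lemma expectation_leb:
  fixes f :: "real \<times> 'a \<Rightarrow> real"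
  assumes f: "f \<in> borel_measurable P2" and B: "\<And>t \<omega>. 0 \<le> t \<Longrightarrow> t \<le> T \<Longrightarrow> \<omega> \<in> space M \<Longrightarrow> \<bar>f (t, \<omega>)\<bar> \<le> B"
    and A: "A \<in> sets M"
  shows "integrable M (\<lambda>\<omega>. indicator A \<omega> * (LINT v|leb T. indicator {s<..t} v * f (v, \<omega>)))"
    and "(LINT \<omega>|M. indicator A \<omega> * (LINT v|leb T. indicator {s<..t} v * f (v, \<omega>)))
      = (LINT z|P2. indicator {s<..t} (fst z) * indicator A (snd z) * f z)"
proof -
  have i1: "(\<lambda>z. indicator {s<..t} (fst z) :: real) \<in> borel_measurable P2"
    by (rule measurable_compose[OF measurable_fst]) (simp add: measurable_restrict_space1)
  have i2: "(\<lambda>z. indicator A (snd z) :: real) \<in> borel_measurable P2" using A by measurable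
  have int: "integrable P2 (\<lambda>(v, \<omega>). indicator {s<..t} v * indicator A \<omega> * f (v, \<omega>))"
  proof (rule integrable_P2_bounded[where B = "\<bar>B\<bar>"])
    show "(\<lambda>(v, \<omega>). indicator {s<..t} v * indicator A \<omega> * f (v, \<omega>)) \<in> borel_measurable P2"
      using i1 i2 f by (simp add: case_prod_beta')
  qed (use B in \<open>force simp: indicator_def\<close>)
  have eq: "(LINT v|leb T. indicator {s<..t} v * indicator A \<omega> * f (v, \<omega>))
    = indicator A \<omega> * (LINT v|leb T. indicator {s<..t} v * f (v, \<omega>))" for \<omega>
    by (subst integral_mult_right_zero[symmetric]) (simp add: mult_ac)
  show "integrable M (\<lambda>\<omega>. indicator A \<omega> * (LINT v|leb T. indicator {s<..t} v * f (v, \<omega>)))"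
    using P2.integrable_snd[OF int] unfolding eq .
  show "(LINT \<omega>|M. indicator A \<omega> * (LINT v|leb T. indicator {s<..t} v * f (v, \<omega>)))
      = (LINT z|P2. indicator {s<..t} (fst z) * indicator A (snd z) * f z)"
    using P2.integral_snd[OF int] unfolding eq by (simp add: case_prod_beta')
qed

lemma window_predictable:
  assumes "A \<in> sets (G s)" "0 \<le> s" "s \<le> t" "t \<le> T"
  shows "(\<lambda>z. indicator {s<..t} (fst z) * indicator A (snd z) :: real) \<in> borel_measurable PredG"
  using predictable_Ioc[OF horizon obs_filtration assms(2,4), of "indicator A"] assms by (simp add: case_prod_beta')

text \<open>The window on an event of \<open>G s\<close>, multiplied by \<open>gain\<close>, is
  G-predictable. Its sum over jumps thus has the expectation of its observed compensator, which is
  the term subtracted in X; only the drift survives.\<close>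

lemma expectation_X_increment:
  assumes h: "h \<in> {1..m}" and st: "0 \<le> s" "s \<le> t" "t \<le> T" and A: "A \<in> sets (G s)"
  shows "(LINT \<omega>|M. indicator A \<omega> * (X h t \<omega> - X h s \<omega>))
    = (LINT z|P2. indicator {s<..t} (fst z) * indicator A (snd z) * drift h (fst z) (snd z))"
proof -
  have AM: "A \<in> sets M" using A filtration_onD(4)[OF obs_filtration, of s] st by auto
  let ?w = "\<lambda>z. indicator {s<..t} (fst z) * indicator A (snd z) :: real"
  let ?g = "\<lambda>e z. gain h e (fst z) (snd z)"
  have w: "?w \<in> borel_measurable PredG" by (rule window_predictable[OF A st])
  note ed = expectation_leb[OF PredG_imp_P2[OF drift_measurable[of h]] _ AM, where B = "k_max h" and s = s and t = t]
  have ed: "integrable M (\<lambda>\<omega>. indicator A \<omega> * (LINT v|leb T. indicator {s<..t} v * drift h v \<omega>))"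
    "(LINT \<omega>|M. indicator A \<omega> * (LINT v|leb T. indicator {s<..t} v * drift h v \<omega>)) = (LINT z|P2. ?w z * drift h (fst z) (snd z))"
    using ed drift_bound by auto
  have ec: "integrable M (\<lambda>\<omega>. indicator A \<omega> * (LINT v|leb T. indicator {s<..t} v * comp h e (v, \<omega>)))"
    "(LINT \<omega>|M. indicator A \<omega> * (LINT v|leb T. indicator {s<..t} v * comp h e (v, \<omega>))) = (LINT z|P2. ?w z * comp h e z)"
    if e: "e \<in> E" for e
    using expectation_leb[OF PredG_imp_P2[OF comp_measurable[OF h e]] _ AM, where B = "K * ell_max" and s = s and t = t]
      comp_bound[OF h e] by (auto simp: comp_def)
  have wg: "(\<lambda>z. ?w z * ?g e z) \<in> borel_measurable PredG" for e
    using w gain_measurable[OF h] by measurable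
  have iwg: "integrable P2 (\<lambda>z. ?w z * ?g e z)" if e: "e \<in> E" for e
    by (rule integrable_P2_bounded[OF PredG_imp_P2[OF wg], where B = 1])
      (use gain_bound[OF h e] in \<open>auto simp: indicator_def\<close>)
  have iwgnu: "integrable P2 (\<lambda>z. ?w z * ?g e z * nu e (fst z) (snd z))" if e: "e \<in> E" for e
    by (rule integrable_P2_mult_bounded[OF iwg[OF e] nu_measurable[OF e], where B = "K * ell_max"])
      (use nu_bounds[OF e] in auto)
  note jc = jump_compensator[OF _ PredG_imp_Pred[OF wg] iwgnu]
  have js: "indicator A \<omega> * (jump_sum e (?g e) t \<omega> - jump_sum e (?g e) s \<omega>) = jump_sum e (\<lambda>z. ?w z * ?g e z) T \<omega>"
    if "e \<in> E" "\<omega> \<in> space M" for e \<omega>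
    unfolding jump_sum_increment_T[OF that st(2,3)] unfolding jump_sum_def
    by (simp add: sum_distrib_left mult_ac)
  have ejc: "(LINT \<omega>|M. jump_sum e (\<lambda>z. ?w z * ?g e z) T \<omega>) = (LINT z|P2. ?w z * comp h e z)" if e: "e \<in> E" for e
  proof -
    have "(LINT \<omega>|M. jump_sum e (\<lambda>z. ?w z * ?g e z) T \<omega>) = (LINT z|P2. (?w z * ?g e z) * nu e (fst z) (snd z))"
      by (rule jc(2)[OF e e])
    also have "\<dots> = (LINT z|P2. (?w z * ?g e z) * (Y e (fst z) (snd z) * lam e (fst z) (snd z)))"
      by (rule intensity_projection[OF e wg iwg[OF e]])
    also have "\<dots> = (LINT z|P2. ?w z * comp h e z)"
      by (simp add: comp_def mult.assoc)
    finally show ?thesis .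
  qed
  have "(LINT \<omega>|M. indicator A \<omega> * (X h t \<omega> - X h s \<omega>))
    = (LINT \<omega>|M. indicator A \<omega> * (LINT v|leb T. indicator {s<..t} v * drift h v \<omega>)
       + (\<Sum>e\<in>E. jump_sum e (\<lambda>z. ?w z * ?g e z) T \<omega> - indicator A \<omega> * (LINT v|leb T. indicator {s<..t} v * comp h e (v, \<omega>))))"
  proof (rule Bochner_Integration.integral_cong[OF refl])
    fix \<omega> assume w: "\<omega> \<in> space M"
    show "indicator A \<omega> * (X h t \<omega> - X h s \<omega>) =
      indicator A \<omega> * (LINT v|leb T. indicator {s<..t} v * drift h v \<omega>)
       + (\<Sum>e\<in>E. jump_sum e (\<lambda>z. ?w z * ?g e z) T \<omega> - indicator A \<omega> * (LINT v|leb T. indicator {s<..t} v * comp h e (v, \<omega>)))"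
      unfolding X_increment[OF h w st] distrib_left sum_distrib_left
      by (intro arg_cong2[of _ _ _ _ "(+)"] refl sum.cong) (simp add: js[OF _ w, symmetric] right_diff_distrib)
  qed
  also have "\<dots> = (LINT \<omega>|M. indicator A \<omega> * (LINT v|leb T. indicator {s<..t} v * drift h v \<omega>))
       + (LINT \<omega>|M. (\<Sum>e\<in>E. jump_sum e (\<lambda>z. ?w z * ?g e z) T \<omega> - indicator A \<omega> * (LINT v|leb T. indicator {s<..t} v * comp h e (v, \<omega>))))"
    by (intro Bochner_Integration.integral_add ed Bochner_Integration.integrable_sum Bochner_Integration.integrable_diff jc(1) ec)
  also have "(LINT \<omega>|M. (\<Sum>e\<in>E. jump_sum e (\<lambda>z. ?w z * ?g e z) T \<omega> - indicator A \<omega> * (LINT v|leb T. indicator {s<..t} v * comp h e (v, \<omega>))))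
    = (\<Sum>e\<in>E. LINT \<omega>|M. jump_sum e (\<lambda>z. ?w z * ?g e z) T \<omega> - indicator A \<omega> * (LINT v|leb T. indicator {s<..t} v * comp h e (v, \<omega>)))"
    by (intro Bochner_Integration.integral_sum Bochner_Integration.integrable_diff jc(1) ec)
  also have "\<dots> = (\<Sum>e\<in>E. 0)"
  proof (rule sum.cong[OF refl])
    fix e assume e: "e \<in> E"
    show "(LINT \<omega>|M. jump_sum e (\<lambda>z. ?w z * ?g e z) T \<omega> - indicator A \<omega> * (LINT v|leb T. indicator {s<..t} v * comp h e (v, \<omega>))) = 0"
      by (subst Bochner_Integration.integral_diff[OF jc(1)[OF e e] ec(1)[OF e]]) (simp only: ejc[OF e] ec(2)[OF e] diff_self)
  qed
  finally show ?thesis using ed(2) by simp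
qed

text \<open>The forward equation of the chain gives the drift with I in place of the filter;
  projection replaces I by \<open>pi_left\<close> and produces the same expression as for X.\<close>

lemma expectation_I_increment:
  assumes h: "h \<in> {1..m}" and st: "0 \<le> s" "s \<le> t" "t \<le> T" and A: "A \<in> sets (G s)"
  shows "(LINT \<omega>|M. indicator A \<omega> * (I h t \<omega> - I h s \<omega>))
    = (LINT z|P2. indicator {s<..t} (fst z) * indicator A (snd z) * drift h (fst z) (snd z))"
proof -
  have AM: "A \<in> sets M" using A filtration_onD(4)[OF obs_filtration, of s] st by auto
  let ?w = "\<lambda>z. indicator {s<..t} (fst z) * indicator A (snd z) :: real"
  have w: "?w \<in> borel_measurable PredG" by (rule window_predictable[OF A st])
  have wP: "?w \<in> borel_measurable P2" by (rule PredG_imp_P2[OF w])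
  have iw: "integrable P2 ?w" by (rule integrable_P2_bounded[OF wP, where B = 1]) (auto simp: indicator_def)
  have Im: "(\<lambda>z. I r (fst z) (snd z)) \<in> borel_measurable P2" for r
    using I_jointly_measurable[of r] by (simp add: case_prod_beta')
  have iwI: "integrable P2 (\<lambda>z. ?w z * I r (fst z) (snd z))" for r
    by (rule integrable_P2_mult_bounded[OF iw Im, where B = 1]) (auto simp: I_bounds)
  have iwp: "integrable P2 (\<lambda>z. ?w z * pi_left r (fst z) (snd z))" if "r \<in> {1..m}" for r
    by (rule integrable_P2_mult_bounded[OF iw PredG_imp_P2[OF pi_left_measurable[OF that]], where B = 1])
      (use pi_left_bounds[OF that] in auto)
  have fub: "(LINT v|leb T. indicator {s<..t} v * (LINT \<omega>|M. indicator A \<omega> * I r v \<omega>)) = (LINT z|P2. ?w z * I r (fst z) (snd z))"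
    and fub_int: "integrable (leb T) (\<lambda>v. indicator {s<..t} v * (LINT \<omega>|M. indicator A \<omega> * I r v \<omega>))" for r
    using P2.integral_fst'[OF iwI] P2.integrable_fst'[OF iwI] by (simp_all add: mult.assoc)
  have meas: "(\<lambda>v. LINT \<omega>|M. indicator A \<omega> * I r v \<omega>) \<in> borel_measurable (leb T)" for r
  proof -
    have "(\<lambda>(v, \<omega>). indicator A \<omega> * I r v \<omega>) \<in> borel_measurable P2"
      using Im[of r] AM by (simp add: case_prod_beta')
    then show ?thesis by (rule borel_measurable_lebesgue_integral)
  qed
  have "(LINT \<omega>|M. indicator A \<omega> * (I h t \<omega> - I h s \<omega>)) = (LINT \<omega>|M. indicator A \<omega> * I h t \<omega>) - (LINT \<omega>|M. indicator A \<omega> * I h s \<omega>)"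
    unfolding right_diff_distrib
    by (intro Bochner_Integration.integral_diff indicator_mult_integrable[OF AM] I_integrable) (use st in auto)
  also have "\<dots> = (LINT v:{s..t}|lborel. (\<Sum>r=1..m. k r h * (LINT \<omega>|M. indicator A \<omega> * I r v \<omega>)))"
    unfolding I_def using A obs_sub[of s] st by (intro factor_chain h st) auto
  also have "\<dots> = (LINT v|leb T. indicator {s<..t} v * (\<Sum>r=1..m. k r h * (LINT \<omega>|M. indicator A \<omega> * I r v \<omega>)))"
    by (intro leb_integral_Ioc st borel_measurable_sum borel_measurable_times meas) auto
  also have "\<dots> = (LINT v|leb T. (\<Sum>r=1..m. k r h * (indicator {s<..t} v * (LINT \<omega>|M. indicator A \<omega> * I r v \<omega>))))"
    by (simp add: sum_distrib_left mult_ac)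
  also have "\<dots> = (\<Sum>r=1..m. k r h * (LINT z|P2. ?w z * I r (fst z) (snd z)))"
    by (subst Bochner_Integration.integral_sum) (use fub_int in \<open>auto simp: fub\<close>)
  also have "\<dots> = (\<Sum>r=1..m. k r h * (LINT z|P2. ?w z * pi_left r (fst z) (snd z)))"
  proof (intro sum.cong refl arg_cong2[of _ _ _ _ "(*)"])
    fix r assume r: "r \<in> {1..m}"
    have "(LINT z|P2. ?w z * I r (fst z) (snd z)) = (LINT z|P2. ?w z * I_left r (fst z) (snd z))"
      by (rule integral_cong_AE)
        (use AE_I_left[of r] Im[of r] wP Pred_imp_P2[OF I_left_measurable[of r]] in \<open>auto elim: eventually_mono\<close>)
    then show "(LINT z|P2. ?w z * I r (fst z) (snd z)) = (LINT z|P2. ?w z * pi_left r (fst z) (snd z))"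
      using projection[OF r w iw] by simp
  qed
  also have "\<dots> = (LINT z|P2. (\<Sum>r=1..m. k r h * (?w z * pi_left r (fst z) (snd z))))"
    by (subst Bochner_Integration.integral_sum) (use iwp in auto)
  also have "\<dots> = (LINT z|P2. ?w z * drift h (fst z) (snd z))"
    by (simp add: drift_def sum_distrib_left mult_ac)
  finally show ?thesis .
qed

lemma increments_orthogonal:
  assumes h: "h \<in> {1..m}" and st: "0 \<le> s" "s \<le> t" "t \<le> T" and A: "A \<in> sets (G s)"
  shows "(LINT \<omega>|M. indicator A \<omega> * ((X h t \<omega> - I h t \<omega>) - (X h s \<omega> - I h s \<omega>))) = 0"
proof -
  have AM: "A \<in> sets M" using A filtration_onD(4)[OF obs_filtration, of s] st by auto
  have iX: "integrable M (\<lambda>\<omega>. indicator A \<omega> * (X h t \<omega> - X h s \<omega>))"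
    by (intro indicator_mult_integrable[OF AM] Bochner_Integration.integrable_diff X_integrable h) (use st in auto)
  have iI: "integrable M (\<lambda>\<omega>. indicator A \<omega> * (I h t \<omega> - I h s \<omega>))"
    by (intro indicator_mult_integrable[OF AM] Bochner_Integration.integrable_diff I_integrable) (use st in auto)
  have "(LINT \<omega>|M. indicator A \<omega> * ((X h t \<omega> - I h t \<omega>) - (X h s \<omega> - I h s \<omega>)))
    = (LINT \<omega>|M. indicator A \<omega> * (X h t \<omega> - X h s \<omega>) - indicator A \<omega> * (I h t \<omega> - I h s \<omega>))"
    by (rule Bochner_Integration.integral_cong) (auto simp: algebra_simps)
  also have "\<dots> = 0"
    unfolding Bochner_Integration.integral_diff[OF iX iI] expectation_X_increment[OF assms] expectation_I_increment[OF assms] by simp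
  finally show ?thesis .
qed

section \<open>Observed events as functionals of the counting paths\<close>

definition simple_path :: "'a \<Rightarrow> bool" where
  "simple_path \<omega> \<longleftrightarrow> (\<forall>e\<in>E. \<forall>e'\<in>E. \<forall>x\<in>J e \<omega>. \<forall>x'\<in>J e' \<omega>. snd x = snd x' \<longrightarrow> e = e' \<and> x = x')"

text \<open>\<open>\<Gamma> v\<close> is the event \<open>A\<close> evaluated along the path of the counts stopped at \<open>v\<close>; at a jump of
  type \<open>e\<close> its value changes from \<open>L\<close> to \<open>R e\<close>.  All conditions are preserved by complements and
  countable unions, so that every observed event has such a representation.\<close>

definition represents :: "real \<Rightarrow> 'a set \<Rightarrow> (real \<Rightarrow> 'a set) \<Rightarrow> (real \<times> 'a) set \<Rightarrow> ('e \<Rightarrow> (real \<times> 'a) set) \<Rightarrow> bool" where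
  "represents t A \<Gamma> L R \<longleftrightarrow>
     \<Gamma> t = A \<and> (\<forall>v\<in>{0..t}. \<Gamma> v \<in> sets (G v)) \<and> L \<in> sets PredG \<and> (\<forall>e. R e \<in> sets PredG) \<and>
     (\<forall>\<omega>\<in>space M. \<forall>v\<in>{0..t}. \<forall>w\<in>{v..t}. (\<forall>e\<in>E. N e v \<omega> = N e w \<omega>) \<longrightarrow> (\<omega> \<in> \<Gamma> v \<longleftrightarrow> \<omega> \<in> \<Gamma> w)) \<and>
     (\<forall>\<omega>\<in>space M. simple_path \<omega> \<longrightarrow> (\<forall>e\<in>E. \<forall>x\<in>J e \<omega>. snd x \<le> t \<longrightarrow>
        (\<omega> \<in> \<Gamma> (snd x) \<longleftrightarrow> (snd x, \<omega>) \<in> R e) \<and>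
        (\<forall>w\<in>{0..<snd x}. (\<forall>e'\<in>E. \<forall>y\<in>J e' \<omega>. \<not> (w < snd y \<and> snd y < snd x)) \<longrightarrow>
           (\<omega> \<in> \<Gamma> w \<longleftrightarrow> (snd x, \<omega>) \<in> L))))"

lemma stopped_count_left:
  assumes e: "e \<in> E" and w: "\<omega> \<in> space M" and t: "0 < t"
  shows "\<forall>\<^sub>F v in at_left t. N e (min v s) \<omega> = card {x \<in> J e \<omega>. snd x < t \<and> snd x \<le> s}"
proof -
  have "\<forall>\<^sub>F v in at_left t. \<forall>x\<in>{x\<in>J e \<omega>. snd x < t}. snd x \<le> v"
  proof (rule eventually_ball_finite)
    show "finite {x\<in>J e \<omega>. snd x < t}" using finite_jumps[OF w e] by auto
    show "\<forall>x\<in>{x \<in> J e \<omega>. snd x < t}. \<forall>\<^sub>F v in at_left t. snd x \<le> v"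
      by (auto simp: eventually_at_left_field intro!: exI)
  qed
  moreover have "\<forall>\<^sub>F v in at_left t. v < t" by (simp add: eventually_at_filter)
  ultimately show ?thesis
  proof eventually_elim
    case (elim v)
    then have "{x \<in> J e \<omega>. snd x \<le> min v s} = {x \<in> J e \<omega>. snd x < t \<and> snd x \<le> s}" by fastforce
    then show ?case unfolding jumps_upto_def by simp
  qed
qed

lemma stopped_count_predictable:
  assumes e: "e \<in> E" and s: "0 \<le> s" "s \<le> T"
  shows "(\<lambda>(t, \<omega>). left_lim 0 (\<lambda>v. real (N e (min v s) \<omega>)) t) \<in> borel_measurable PredG"
proof (rule predictable_left_lim[OF horizon obs_filtration])
  show "(\<lambda>\<omega>. real (N e (min v s) \<omega>)) \<in> borel_measurable (G v)" if "0 \<le> v" "v \<le> T" for v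
    by (rule N_obs_measurable_real[OF e]) (use that s in auto)
  show "\<exists>y. ((\<lambda>v. real (N e (min v s) \<omega>)) \<longlongrightarrow> y) (at_left t)" if "\<omega> \<in> space M" "0 < t" "t \<le> T" for \<omega> t
    by (rule exI, rule tendsto_eventually, rule eventually_mono[OF stopped_count_left[OF e that(1,2), of s]]) simp
qed

lemma left_lim_stopped_count:
  assumes e: "e \<in> E" and w: "\<omega> \<in> space M" and t: "0 < t"
  shows "left_lim 0 (\<lambda>v. real (N e (min v s) \<omega>)) t = real (card {x \<in> J e \<omega>. snd x < t \<and> snd x \<le> s})"
proof -
  have "((\<lambda>v. real (N e (min v s) \<omega>)) \<longlongrightarrow> real (card {x \<in> J e \<omega>. snd x < t \<and> snd x \<le> s})) (at_left t)"
    by (rule tendsto_eventually, rule eventually_mono[OF stopped_count_left[OF e w t, of s]]) simp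
  then show ?thesis using t by (simp add: left_lim_def tendsto_Lim)
qed

lemma PredG_product:
  assumes "A \<in> sets (G 0)" shows "{0..T} \<times> A \<in> sets PredG"
proof -
  have "(\<lambda>z. (\<lambda>(t, \<omega>). indicator {0} t * indicator A \<omega>) z + (\<lambda>(t, \<omega>). indicator {0<..T} t * indicator A \<omega>) z :: real) \<in> borel_measurable PredG"
    by (intro borel_measurable_add predictable_zero[OF horizon obs_filtration] predictable_Ioc[OF horizon obs_filtration])
      (use assms horizon in auto)
  from measurable_sets[OF this, of "{1}"]
  have "(\<lambda>z. (\<lambda>(t, \<omega>). indicator {0} t * indicator A \<omega>) z + (\<lambda>(t, \<omega>). indicator {0<..T} t * indicator A \<omega>) z :: real) -` {1} \<inter> space PredG \<in> sets PredG"
    by simp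
  also have "(\<lambda>z. (\<lambda>(t, \<omega>). indicator {0} t * indicator A \<omega>) z + (\<lambda>(t, \<omega>). indicator {0<..T} t * indicator A \<omega>) z :: real) -` {1} \<inter> space PredG = {0..T} \<times> A"
    using sets.sets_into_space[OF assms] space_obs horizon by (auto simp: space_Pred split: split_indicator split_indicator_asm)
  finally show ?thesis .
qed

text \<open>For an event about the count of type e at time s, stop this count at s. Its left limit
  is predictable and gives L. At a jump of type e not later than s the stopped count rises by
  exactly 1, because a simple path has no other jump then, and at any other jump it does not move;
  this gives R.\<close>

lemma represents_generator:
  assumes t: "0 \<le> t" "t \<le> T" and e: "e \<in> E" and s: "0 \<le> s" "s \<le> t"
  shows "\<exists>\<Gamma> L R. represents t ((\<lambda>\<omega>. N e s \<omega>) -` B \<inter> space M) \<Gamma> L R"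
proof (intro exI)
  let ?S = "\<lambda>v \<omega>. left_lim 0 (\<lambda>u. real (N e (min u s) \<omega>)) v"
  let ?B = "real ` B"
  let ?\<Gamma> = "\<lambda>v. (\<lambda>\<omega>. N e (min v s) \<omega>) -` B \<inter> space M"
  let ?L = "(\<lambda>z. ?S (fst z) (snd z)) -` ?B \<inter> space PredG"
  let ?R = "\<lambda>e'. (\<lambda>z. ?S (fst z) (snd z) + (if e' = e then indicator {..s} (fst z) else 0)) -` ?B \<inter> space PredG"
  have S: "(\<lambda>z. ?S (fst z) (snd z)) \<in> borel_measurable PredG"
    using stopped_count_predictable[OF e, of s] s t by (simp add: case_prod_beta')
  have B: "?B \<in> sets borel" by (rule sets.countable) auto
  have G: "?\<Gamma> v \<in> sets (G v)" if "v \<in> {0..t}" for v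
    using measurable_sets[OF N_obs_measurable[OF e, of "min v s" v], of B] that s t space_obs by auto
  have ind: "(\<lambda>z. indicator {..s} (fst z) :: real) \<in> borel_measurable PredG"
    by (rule measurable_compose[OF predictable_time[OF horizon obs_filtration]]) simp
  have R: "?R e' \<in> sets PredG" for e'
  proof (cases "e' = e")
    case True
    then show ?thesis using measurable_sets[OF borel_measurable_add[OF S ind] B] by simp
  next
    case False
    then show ?thesis using measurable_sets[OF S B] by simp
  qed
  have jump: "(\<omega> \<in> ?\<Gamma> (snd x) \<longleftrightarrow> (snd x, \<omega>) \<in> ?R e') \<and>
        (\<forall>w\<in>{0..<snd x}. (\<forall>e'\<in>E. \<forall>y\<in>J e' \<omega>. \<not> (w < snd y \<and> snd y < snd x)) \<longrightarrow>
           (\<omega> \<in> ?\<Gamma> w \<longleftrightarrow> (snd x, \<omega>) \<in> ?L))"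
    if w: "\<omega> \<in> space M" and simple: "simple_path \<omega>" and e': "e' \<in> E" and x: "x \<in> J e' \<omega>" "snd x \<le> t" for \<omega> e' x
  proof -
    let ?C = "{y \<in> J e \<omega>. snd y < snd x \<and> snd y \<le> s}"
    have pos: "0 < snd x" "snd x \<le> T" using jump_times[OF w e' x(1)] by auto
    have fin: "finite (J e \<omega>)" by (rule finite_jumps[OF w e])
    have Sx: "?S (snd x) \<omega> = real (card ?C)" by (rule left_lim_stopped_count[OF e w pos(1)])
    have sp: "(snd x, \<omega>) \<in> space PredG" using pos w by (simp add: space_Pred)
    have mem: "real a \<in> ?B \<longleftrightarrow> a \<in> B" for a by auto
    have now: "N e (min (snd x) s) \<omega> = card ?C + (if e' = e \<and> snd x \<le> s then 1 else 0)"
    proof (cases "e' = e \<and> snd x \<le> s")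
      case True
      have "{y \<in> J e \<omega>. snd y \<le> min (snd x) s} = insert x ?C"
        using True x simple e unfolding simple_path_def by (fastforce simp: less_le)
      then show ?thesis using True fin by (simp add: jumps_upto_def)
    next
      case False
      have "y \<in> ?C" if "y \<in> J e \<omega>" "snd y \<le> min (snd x) s" for y
      proof -
        have "snd y \<noteq> snd x" using that False simple e e' x unfolding simple_path_def by (metis min.boundedE)
        then show ?thesis using that by auto
      qed
      then have "{y \<in> J e \<omega>. snd y \<le> min (snd x) s} = ?C" by auto
      then show ?thesis using False unfolding jumps_upto_def by (simp only: if_False add_0_right)
    qed
    have "(snd x, \<omega>) \<in> ?R e' \<longleftrightarrow> real (N e (min (snd x) s) \<omega>) \<in> ?B"
      using sp Sx now by (simp add: indicator_def)
    then have 1: "\<omega> \<in> ?\<Gamma> (snd x) \<longleftrightarrow> (snd x, \<omega>) \<in> ?R e'" unfolding mem using w by simp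
    have 2: "\<omega> \<in> ?\<Gamma> v \<longleftrightarrow> (snd x, \<omega>) \<in> ?L"
      if "v \<in> {0..<snd x}" "\<forall>e'\<in>E. \<forall>y\<in>J e' \<omega>. \<not> (v < snd y \<and> snd y < snd x)" for v
    proof -
      have "{y \<in> J e \<omega>. snd y \<le> min v s} = ?C" using that e by fastforce
      then have "N e (min v s) \<omega> = card ?C" unfolding jumps_upto_def by simp
      then show ?thesis using sp Sx mem[of "card ?C"] w by simp
    qed
    show ?thesis by (rule conjI[OF 1], rule ballI, rule impI, rule 2)
  qed
  have const: "\<omega> \<in> ?\<Gamma> v \<longleftrightarrow> \<omega> \<in> ?\<Gamma> w"
    if w: "\<omega> \<in> space M" and vw: "v \<in> {0..t}" "w \<in> {v..t}" and eq: "\<forall>e\<in>E. N e v \<omega> = N e w \<omega>" for \<omega> v w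
  proof -
    \<comment> \<open>Counts are monotone, so one that agrees at v and w is constant in
      between.\<close>
    have "N e (min v s) \<omega> = N e (min w s) \<omega>"
    proof (rule antisym)
      show "N e (min v s) \<omega> \<le> N e (min w s) \<omega>"
        by (rule jumps_upto_mono[OF finite_jumps[OF w e]]) (use vw in auto)
      show "N e (min w s) \<omega> \<le> N e (min v s) \<omega>"
      proof (cases "v \<le> s")
        case True
        have "N e (min w s) \<omega> \<le> N e w \<omega>" by (rule jumps_upto_mono[OF finite_jumps[OF w e]]) auto
        then show ?thesis using eq e True by simp
      next
        case False
        then show ?thesis using vw by simp
      qed
    qed
    then show ?thesis by simp
  qed
  show "represents t ((\<lambda>\<omega>. N e s \<omega>) -` B \<inter> space M) ?\<Gamma> ?L ?R"
    unfolding represents_def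
  proof (intro conjI)
    show "?\<Gamma> t = (\<lambda>\<omega>. N e s \<omega>) -` B \<inter> space M" using s by (simp add: min_absorb2)
    show "\<forall>v\<in>{0..t}. ?\<Gamma> v \<in> sets (G v)" by (intro ballI G)
    show "?L \<in> sets PredG" by (rule measurable_sets[OF S B])
    show "\<forall>e. ?R e \<in> sets PredG" by (intro allI R)
    show "\<forall>\<omega>\<in>space M. \<forall>v\<in>{0..t}. \<forall>w\<in>{v..t}. (\<forall>e\<in>E. N e v \<omega> = N e w \<omega>) \<longrightarrow> (\<omega> \<in> ?\<Gamma> v \<longleftrightarrow> \<omega> \<in> ?\<Gamma> w)"
      by (rule ballI, rule ballI, rule ballI, rule impI, rule const)
    show "\<forall>\<omega>\<in>space M. simple_path \<omega> \<longrightarrow> (\<forall>e\<in>E. \<forall>x\<in>J e \<omega>. snd x \<le> t \<longrightarrow>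
        (\<omega> \<in> ?\<Gamma> (snd x) \<longleftrightarrow> (snd x, \<omega>) \<in> ?R e) \<and>
        (\<forall>w\<in>{0..<snd x}. (\<forall>e'\<in>E. \<forall>y\<in>J e' \<omega>. \<not> (w < snd y \<and> snd y < snd x)) \<longrightarrow>
           (\<omega> \<in> ?\<Gamma> w \<longleftrightarrow> (snd x, \<omega>) \<in> ?L)))"
      by (rule ballI, rule impI, rule ballI, rule ballI, rule impI, rule jump)
  qed
qed

text \<open>By completion a null set belongs to every \<open>G v\<close>, so it can be represented
  by itself at all times.\<close>

lemma represents_null:
  assumes t: "0 \<le> t" "t \<le> T" and A: "A \<in> null_sets M"
  shows "represents t A (\<lambda>_. A) ({0..T} \<times> A) (\<lambda>_. {0..T} \<times> A)"
proof -
  have AG: "A \<in> sets (G v)" if "v \<in> {0..t}" for v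
    using that t A by (subst sets_obs) (auto intro!: sigma_sets.Basic)
  have "snd x \<in> {0..T}" if "\<omega> \<in> space M" "e \<in> E" "x \<in> J e \<omega>" for x \<omega> e
    using jump_times[OF that] by auto
  then show ?thesis unfolding represents_def using AG AG[of 0] PredG_product t by simp
qed

lemma represents_Compl:
  assumes t: "0 \<le> t" "t \<le> T" and r: "represents t A \<Gamma> L R"
  shows "represents t (space M - A) (\<lambda>v. space M - \<Gamma> v) (space PredG - L) (\<lambda>e. space PredG - R e)"
proof -
  have sp: "(snd x, \<omega>) \<in> space PredG" if "\<omega> \<in> space M" "e \<in> E" "x \<in> J e \<omega>" for x \<omega> e
    using jump_times[OF that] that by (auto simp: space_Pred)
  have "space M - \<Gamma> v \<in> sets (G v)" if "v \<in> {0..t}" for v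
    using r that sets.compl_sets[of "\<Gamma> v" "G v"] space_obs unfolding represents_def by auto
  then show ?thesis using r sp unfolding represents_def by (simp add: sets.compl_sets)
qed

lemma represents_UN:
  assumes r: "\<And>i::nat. represents t (A i) (\<Gamma> i) (L i) (R i)"
  shows "represents t (\<Union>i. A i) (\<lambda>v. \<Union>i. \<Gamma> i v) (\<Union>i. L i) (\<lambda>e. \<Union>i. R i e)"
  using r unfolding represents_def by (simp add: sets.countable_UN image_subset_iff)

lemma ex_represents:
  assumes t: "0 \<le> t" "t \<le> T" and A: "A \<in> sets (G t)"
  shows "\<exists>\<Gamma> L R. represents t A \<Gamma> L R"
  using A[unfolded sets_obs[OF t]]
proof (induction rule: sigma_sets.induct)
  case (Basic A)
  then show ?case using represents_generator[OF t] represents_null[OF t] by blast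
next
  case Empty
  show ?case using represents_null[OF t, of "{}"] by auto
next
  case (Compl A)
  then show ?case using represents_Compl[OF t] by blast
next
  case (Union A)
  then obtain \<Gamma> L R where "\<And>i. represents t (A i) (\<Gamma> i) (L i) (R i)" by metis
  then show ?case using represents_UN by blast
qed

section \<open>One-sided limits and jumps of X\<close>

lemma jumps_right:
  assumes "\<omega> \<in> space M" "e \<in> E"
  shows "\<forall>\<^sub>F v in at_right t. {x\<in>J e \<omega>. t < snd x \<and> snd x \<le> v} = {}"
proof -
  have "\<forall>\<^sub>F v in at_right t. \<forall>x\<in>{x\<in>J e \<omega>. t < snd x}. v < snd x"
  proof (rule eventually_ball_finite)
    show "finite {x\<in>J e \<omega>. t < snd x}" using finite_jumps[OF assms] by auto
    show "\<forall>x\<in>{x \<in> J e \<omega>. t < snd x}. \<forall>\<^sub>F v in at_right t. v < snd x"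
      by (auto simp: eventually_at_right_field intro!: exI)
  qed
  then show ?thesis by eventually_elim fastforce
qed

lemma jumps_left:
  assumes "\<omega> \<in> space M" "e \<in> E"
  shows "\<forall>\<^sub>F v in at_left t. {x\<in>J e \<omega>. v < snd x \<and> snd x \<le> t} = {x\<in>J e \<omega>. snd x = t}"
proof -
  have "\<forall>\<^sub>F v in at_left t. \<forall>x\<in>{x\<in>J e \<omega>. snd x < t}. snd x \<le> v"
  proof (rule eventually_ball_finite)
    show "finite {x\<in>J e \<omega>. snd x < t}" using finite_jumps[OF assms] by auto
    show "\<forall>x\<in>{x \<in> J e \<omega>. snd x < t}. \<forall>\<^sub>F v in at_left t. snd x \<le> v"
      by (auto simp: eventually_at_left_field intro!: exI)
  qed
  moreover have "\<forall>\<^sub>F v in at_left t. v < t" by (simp add: eventually_at_filter)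
  ultimately show ?thesis by eventually_elim fastforce
qed

lemma X_tendsto_right:
  assumes h: "h \<in> {1..m}" and w: "\<omega> \<in> space M" and t: "0 \<le> t" "t < T"
  shows "((\<lambda>v. X h v \<omega>) \<longlongrightarrow> X h t \<omega>) (at_right t)"
proof -
  have "((\<lambda>v. X h v \<omega> - X h t \<omega>) \<longlongrightarrow> 0) (at_right t)"
  proof (rule Lim_null_comparison)
    have "\<forall>\<^sub>F v in at_right t. \<forall>e\<in>E. {x\<in>J e \<omega>. t < snd x \<and> snd x \<le> v} = {}"
      by (rule eventually_ball_finite[OF finite_types]) (use jumps_right[OF w] in blast)
    moreover have "\<forall>\<^sub>F v in at_right t. v \<in> {t<..<T}" by (rule eventually_at_rightI[OF _ t(2)])
    ultimately show "\<forall>\<^sub>F v in at_right t. norm (X h v \<omega> - X h t \<omega>) \<le> var_const h * (v - t)"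
    proof eventually_elim
      case (elim v)
      then have "(\<Sum>e\<in>E. \<Sum>x\<in>{x\<in>J e \<omega>. t < snd x \<and> snd x \<le> v}. gain h e (snd x) \<omega>) = 0"
      proof (intro sum.neutral[where A = E] ballI)
        fix e assume "e \<in> E"
        then have "{x\<in>J e \<omega>. t < snd x \<and> snd x \<le> v} = {}" using elim by blast
        then show "(\<Sum>x\<in>{x\<in>J e \<omega>. t < snd x \<and> snd x \<le> v}. gain h e (snd x) \<omega>) = 0"
          by (simp only: sum.empty)
      qed
      then show ?case using X_jump_bound[OF h w t(1), of v] elim by simp
    qed
    show "((\<lambda>v. var_const h * (v - t)) \<longlongrightarrow> 0) (at_right t)" by (auto intro!: tendsto_eq_intros)
  qed
  from tendsto_add[OF this tendsto_const[of "X h t \<omega>"]] show ?thesis by simp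
qed

lemma X_tendsto_left:
  assumes h: "h \<in> {1..m}" and w: "\<omega> \<in> space M" and t: "0 < t" "t \<le> T"
  shows "((\<lambda>v. X h v \<omega>) \<longlongrightarrow> X h t \<omega> - (\<Sum>e\<in>E. \<Sum>x\<in>{x\<in>J e \<omega>. snd x = t}. gain h e (snd x) \<omega>)) (at_left t)"
proof -
  let ?s = "\<Sum>e\<in>E. \<Sum>x\<in>{x\<in>J e \<omega>. snd x = t}. gain h e (snd x) \<omega>"
  have "((\<lambda>v. X h v \<omega> - (X h t \<omega> - ?s)) \<longlongrightarrow> 0) (at_left t)"
  proof (rule Lim_null_comparison)
    have "\<forall>\<^sub>F v in at_left t. \<forall>e\<in>E. {x\<in>J e \<omega>. v < snd x \<and> snd x \<le> t} = {x\<in>J e \<omega>. snd x = t}"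
      by (rule eventually_ball_finite[OF finite_types]) (use jumps_left[OF w] in blast)
    moreover have "\<forall>\<^sub>F v in at_left t. v \<in> {0<..<t}" by (rule eventually_at_leftI[OF _ t(1)])
    ultimately show "\<forall>\<^sub>F v in at_left t. norm (X h v \<omega> - (X h t \<omega> - ?s)) \<le> var_const h * (t - v)"
    proof eventually_elim
      case (elim v)
      then have "(\<Sum>e\<in>E. \<Sum>x\<in>{x\<in>J e \<omega>. v < snd x \<and> snd x \<le> t}. gain h e (snd x) \<omega>) = ?s"
        by (intro sum.cong) auto
      then show ?case using X_jump_bound[OF h w _ _ t(2), of v] elim
        by (simp add: abs_minus_commute algebra_simps)
    qed
    show "((\<lambda>v. var_const h * (t - v)) \<longlongrightarrow> 0) (at_left t)" by (auto intro!: tendsto_eq_intros)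
  qed
  from tendsto_add[OF this tendsto_const[of "X h t \<omega> - ?s"]] show ?thesis by simp
qed

lemma X_cadlag: "h \<in> {1..m} \<Longrightarrow> \<omega> \<in> space M \<Longrightarrow> cadlag_on 0 T (\<lambda>t. X h t \<omega>)"
  unfolding cadlag_on_def using X_tendsto_right X_tendsto_left by fastforce

definition X_left :: "nat \<Rightarrow> real \<Rightarrow> 'a \<Rightarrow> real" where
  "X_left h t \<omega> = left_lim 0 (\<lambda>v. X h v \<omega>) t"

lemma X_left_measurable:
  assumes h: "h \<in> {1..m}"
  shows "(\<lambda>z. X_left h (fst z) (snd z)) \<in> borel_measurable PredG"
proof -
  have "(\<lambda>(t, \<omega>). left_lim 0 (\<lambda>v. X h v \<omega>) t) \<in> borel_measurable PredG"
    using X_tendsto_left[OF h] by (intro predictable_left_lim[OF horizon obs_filtration] X_adapted h) blast+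
  then show ?thesis by (simp add: X_left_def case_prod_beta')
qed

text \<open>In general the value exceeds the left limit by the gains of all jumps at that time; on a
  simple path there is just one.\<close>

lemma X_jump:
  assumes h: "h \<in> {1..m}" and w: "\<omega> \<in> space M" and simple: "simple_path \<omega>" and e: "e \<in> E" and x: "x \<in> J e \<omega>"
  shows "X h (snd x) \<omega> = X_left h (snd x) \<omega> + gain h e (snd x) \<omega>"
proof -
  have t: "0 < snd x" "snd x \<le> T" using jump_times[OF w e x] by auto
  have "(\<Sum>e'\<in>E. \<Sum>y\<in>{y\<in>J e' \<omega>. snd y = snd x}. gain h e' (snd y) \<omega>)
    = (\<Sum>e'\<in>E. if e' = e then gain h e (snd x) \<omega> else 0)"
  proof (rule sum.cong[OF refl])
    fix e' assume e': "e' \<in> E"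
    have eq: "{y\<in>J e' \<omega>. snd y = snd x} = (if e' = e then {x} else {})"
      using simple e e' x unfolding simple_path_def by auto
    show "(\<Sum>y\<in>{y\<in>J e' \<omega>. snd y = snd x}. gain h e' (snd y) \<omega>) = (if e' = e then gain h e (snd x) \<omega> else 0)"
      unfolding eq by (cases "e' = e") simp_all
  qed
  also have "\<dots> = gain h e (snd x) \<omega>" using e finite_types by simp
  finally have "((\<lambda>v. X h v \<omega>) \<longlongrightarrow> X h (snd x) \<omega> - gain h e (snd x) \<omega>) (at_left (snd x))"
    using X_tendsto_left[OF h w t] by simp
  then have "X_left h (snd x) \<omega> = X h (snd x) \<omega> - gain h e (snd x) \<omega>"
    using t by (simp add: X_left_def left_lim_def tendsto_Lim)
  then show ?thesis by simp
qed

lemma X_left_bound: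
  assumes h: "h \<in> {1..m}" and w: "\<omega> \<in> space M" and t: "0 \<le> t" "t \<le> T"
  shows "\<bar>X_left h t \<omega>\<bar> \<le> 1 + var_const h * T + (\<Sum>e\<in>E. real (N e T \<omega>))"
proof (cases "t = 0")
  case True
  then show ?thesis using X_bound[OF h w order_refl horizon] by (simp add: X_left_def left_lim_def)
next
  case False
  then have t': "0 < t" using t by simp
  have "((\<lambda>v. X h v \<omega>) \<longlongrightarrow> X_left h t \<omega>) (at_left t)"
    unfolding X_left_def by (rule cadlag_on_left_lim_tendsto[OF X_cadlag[OF h w] t' t(2)])
  then have "((\<lambda>v. \<bar>X h v \<omega>\<bar>) \<longlongrightarrow> \<bar>X_left h t \<omega>\<bar>) (at_left t)" by (rule tendsto_rabs)
  moreover have "\<forall>\<^sub>F v in at_left t. v \<in> {0<..<t}" by (rule eventually_at_leftI[OF _ t'])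
  then have "\<forall>\<^sub>F v in at_left t. \<bar>X h v \<omega>\<bar> \<le> 1 + var_const h * T + (\<Sum>e\<in>E. real (N e T \<omega>))"
    by eventually_elim (use X_bound[OF h w] t in auto)
  ultimately show ?thesis by (rule tendsto_upperbound) simp
qed

lemma X_jointly_measurable:
  assumes h: "h \<in> {1..m}"
  shows "(\<lambda>z. X h (fst z) (snd z)) \<in> borel_measurable P2"
proof -
  have "(\<lambda>(t, \<omega>). X h t \<omega>) \<in> borel_measurable P2"
    by (rule right_continuous_imp_jointly_measurable[OF horizon])
      (use X_tendsto_right[OF h] filtration_on_measurable[OF obs_filtration _ _ X_adapted[OF h]] in auto)
  then show ?thesis by (simp add: case_prod_beta')
qed

lemma AE_X_left:
  assumes h: "h \<in> {1..m}"
  shows "AE z in P2. X_left h (fst z) (snd z) = X h (fst z) (snd z)"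
proof (rule AE_P2I)
  show "{z \<in> space P2. X_left h (fst z) (snd z) = X h (fst z) (snd z)} \<in> sets P2"
    using X_jointly_measurable[OF h] PredG_imp_P2[OF X_left_measurable[OF h]] by measurable
  fix \<omega> assume w: "\<omega> \<in> space M"
  show "countable {v \<in> {0..T}. \<not> X_left h (fst (v, \<omega>)) (snd (v, \<omega>)) = X h (fst (v, \<omega>)) (snd (v, \<omega>))}"
    by (rule countable_subset[OF _ cadlag_on_countable_jumps[OF X_cadlag[OF h w]]])
      (auto simp: X_left_def)
qed

section \<open>Riemann sums of the error along an observed event\<close>

definition err :: "nat \<Rightarrow> real \<Rightarrow> 'a \<Rightarrow> real" where
  "err h t \<omega> = X h t \<omega> - I h t \<omega>"

text \<open>An integrable majorant, linear in the number of jumps, for X at all times; multiples of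
  it dominate the grid sums and the differences from \<pi>.\<close>

definition dominating :: "nat \<Rightarrow> 'a \<Rightarrow> real" where
  "dominating h \<omega> = 1 + var_const h * T + (\<Sum>e\<in>E. real (N e T \<omega>))"

lemma dominating_integrable: "integrable M (dominating h)"
  unfolding dominating_def[abs_def] using integrable_total_count by simp

lemma var_const_nonneg: "0 \<le> var_const h"
  unfolding var_const_def k_max_def
  by (intro add_nonneg_nonneg sum_nonneg mult_nonneg_nonneg ell_max_nonneg K_nonneg) auto

lemma dominating_ge_1: "1 \<le> dominating h \<omega>"
  unfolding dominating_def using var_const_nonneg[of h] horizon by (simp add: sum_nonneg)

lemma obs_measurable_M:
  assumes "A \<in> sets (G v)" "0 \<le> v" "v \<le> T" shows "A \<in> sets M"
  using assms filtration_onD(4)[OF obs_filtration] by blast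

lemma expectation_filter:
  assumes h: "h \<in> {1..m}" and v: "0 \<le> v" "v \<le> T" and A: "A \<in> sets (G v)"
  shows "(LINT \<omega>|M. indicator A \<omega> * \<pi> h v \<omega>) = (LINT \<omega>|M. indicator A \<omega> * I h v \<omega>)"
proof -
  interpret sub: finite_measure_subalgebra M "G v"
    by unfold_locales (rule filtration_onD(1)[OF obs_filtration v])
  have AM: "A \<in> sets M" by (rule obs_measurable_M[OF A v])
  have Im: "I h v \<in> borel_measurable M"
    by (rule filtration_on_measurable[OF filtration v I_adapted[OF v]])
  have pim: "\<pi> h v \<in> borel_measurable M"
    by (rule filtration_on_measurable[OF obs_filtration v filter_adapted[OF h v]])
  have ind: "(indicator A :: 'a \<Rightarrow> real) \<in> borel_measurable (G v)" using A by simp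
  have "(LINT \<omega>|M. indicator A \<omega> * \<pi> h v \<omega>) = (LINT \<omega>|M. indicator A \<omega> * real_cond_exp M (G v) (I h v) \<omega>)"
    by (rule integral_cong_AE)
      (use filter_cond_exp[OF h v] AM pim in \<open>auto simp: I_def[abs_def] elim: eventually_mono\<close>)
  also have "\<dots> = (LINT \<omega>|M. indicator A \<omega> * I h v \<omega>)"
    by (rule sub.real_cond_exp_intg(2)[OF indicator_mult_integrable[OF AM I_integrable[OF v]] ind Im])
  finally show ?thesis .
qed

lemma pi_integrable:
  assumes "h \<in> {1..m}" "0 \<le> v" "v \<le> T" shows "integrable M (\<pi> h v)"
  by (rule integrable_const_bound[of _ 1])
    (use filter_bounds[OF assms(1) _ assms(2,3)] filtration_on_measurable[OF obs_filtration assms(2,3) filter_adapted[OF assms]] in auto)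

lemma err_integrable:
  assumes "h \<in> {1..m}" "0 \<le> v" "v \<le> T" shows "integrable M (err h v)"
  unfolding err_def[abs_def] by (intro Bochner_Integration.integrable_diff X_integrable I_integrable assms)

lemma expectation_err_eq:
  assumes h: "h \<in> {1..m}" and v: "0 \<le> v" "v \<le> T" and A: "A \<in> sets (G v)"
  shows "(LINT \<omega>|M. indicator A \<omega> * err h v \<omega>) = (LINT \<omega>|M. indicator A \<omega> * (X h v \<omega> - \<pi> h v \<omega>))"
proof -
  note i = indicator_mult_integrable[OF obs_measurable_M[OF A v]]
  show ?thesis
    unfolding err_def right_diff_distrib
    by (subst (1 2) Bochner_Integration.integral_diff)
      (use i[OF X_integrable[OF h v]] i[OF I_integrable[OF v]] i[OF pi_integrable[OF h v]] expectation_filter[OF assms] in auto)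
qed

lemma expectation_err_zero:
  assumes h: "h \<in> {1..m}" and A: "A \<in> sets (G 0)"
  shows "(LINT \<omega>|M. indicator A \<omega> * err h 0 \<omega>) = 0"
proof -
  have "(LINT \<omega>|M. indicator A \<omega> * err h 0 \<omega>) = (LINT \<omega>|M. indicator A \<omega> * (X h 0 \<omega> - \<pi> h 0 \<omega>))"
    by (rule expectation_err_eq[OF h order_refl horizon A])
  also have "\<dots> = (LINT \<omega>|M. 0)" by (rule Bochner_Integration.integral_cong) (auto simp: X_zero[OF h])
  finally show ?thesis by simp
qed

definition grid :: "real \<Rightarrow> nat \<Rightarrow> nat \<Rightarrow> real" where
  "grid t n j = real j * t / real (Suc n)"

lemma grid_simps: "grid t n 0 = 0" "grid t n (Suc n) = t"
  by (simp_all add: grid_def del: of_nat_Suc)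

lemma grid_mono: "0 \<le> t \<Longrightarrow> i \<le> j \<Longrightarrow> grid t n i \<le> grid t n j"
  unfolding grid_def by (intro divide_right_mono mult_right_mono) auto

lemma grid_bounds: "0 \<le> t \<Longrightarrow> j \<le> Suc n \<Longrightarrow> 0 \<le> grid t n j \<and> grid t n j \<le> t"
  using grid_mono[of t 0 j n] grid_mono[of t j "Suc n" n] by (simp add: grid_simps)

text \<open>Riemann-Stieltjes sum of the error against the 0-1 path of \<Gamma>. The error is taken
  at right ends so that summation by parts pairs its increments with \<Gamma> at left ends, where
  \<Gamma> belongs to the observed past.\<close>

definition grid_sum :: "nat \<Rightarrow> real \<Rightarrow> (real \<Rightarrow> 'a set) \<Rightarrow> nat \<Rightarrow> 'a \<Rightarrow> real" where
  "grid_sum h t \<Gamma> n \<omega> = (\<Sum>j\<le>n. (indicator (\<Gamma> (grid t n (Suc j))) \<omega> - indicator (\<Gamma> (grid t n j)) \<omega>) * err h (grid t n (Suc j)) \<omega>)"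

lemma representsD:
  assumes "represents t A \<Gamma> L R"
  shows "\<Gamma> t = A" "\<And>v. 0 \<le> v \<Longrightarrow> v \<le> t \<Longrightarrow> \<Gamma> v \<in> sets (G v)" "L \<in> sets PredG" "\<And>e. R e \<in> sets PredG"
    and "\<And>\<omega> v w. \<omega> \<in> space M \<Longrightarrow> 0 \<le> v \<Longrightarrow> v \<le> w \<Longrightarrow> w \<le> t \<Longrightarrow> (\<And>e. e \<in> E \<Longrightarrow> N e v \<omega> = N e w \<omega>) \<Longrightarrow>
      \<omega> \<in> \<Gamma> v \<longleftrightarrow> \<omega> \<in> \<Gamma> w"
    and "\<And>\<omega> e x. \<omega> \<in> space M \<Longrightarrow> simple_path \<omega> \<Longrightarrow> e \<in> E \<Longrightarrow> x \<in> J e \<omega> \<Longrightarrow> snd x \<le> t \<Longrightarrow>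
      \<omega> \<in> \<Gamma> (snd x) \<longleftrightarrow> (snd x, \<omega>) \<in> R e"
    and "\<And>\<omega> e x w. \<omega> \<in> space M \<Longrightarrow> simple_path \<omega> \<Longrightarrow> e \<in> E \<Longrightarrow> x \<in> J e \<omega> \<Longrightarrow> snd x \<le> t \<Longrightarrow> 0 \<le> w \<Longrightarrow> w < snd x \<Longrightarrow>
      (\<And>e' y. e' \<in> E \<Longrightarrow> y \<in> J e' \<omega> \<Longrightarrow> w < snd y \<Longrightarrow> snd y < snd x \<Longrightarrow> False) \<Longrightarrow>
      \<omega> \<in> \<Gamma> w \<longleftrightarrow> (snd x, \<omega>) \<in> L"
proof -
  note r = assms[unfolded represents_def]
  show "\<Gamma> t = A" "L \<in> sets PredG" using r by blast+
  show "\<And>v. 0 \<le> v \<Longrightarrow> v \<le> t \<Longrightarrow> \<Gamma> v \<in> sets (G v)" using r by simp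
  show "\<And>e. R e \<in> sets PredG" using r by blast
  show "\<omega> \<in> \<Gamma> v \<longleftrightarrow> \<omega> \<in> \<Gamma> w"
    if "\<omega> \<in> space M" "0 \<le> v" "v \<le> w" "w \<le> t" "\<And>e. e \<in> E \<Longrightarrow> N e v \<omega> = N e w \<omega>" for \<omega> v w
    using r that by simp
  show "\<omega> \<in> \<Gamma> (snd x) \<longleftrightarrow> (snd x, \<omega>) \<in> R e"
    if "\<omega> \<in> space M" "simple_path \<omega>" "e \<in> E" "x \<in> J e \<omega>" "snd x \<le> t" for \<omega> e x
    using r that by blast
  show "\<omega> \<in> \<Gamma> w \<longleftrightarrow> (snd x, \<omega>) \<in> L"
    if "\<omega> \<in> space M" "simple_path \<omega>" "e \<in> E" "x \<in> J e \<omega>" "snd x \<le> t" "0 \<le> w" "w < snd x"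
      "\<And>e' y. e' \<in> E \<Longrightarrow> y \<in> J e' \<omega> \<Longrightarrow> w < snd y \<Longrightarrow> snd y < snd x \<Longrightarrow> False" for \<omega> e x w
  proof -
    have "\<forall>w\<in>{0..<snd x}. (\<forall>e'\<in>E. \<forall>y\<in>J e' \<omega>. \<not> (w < snd y \<and> snd y < snd x)) \<longrightarrow>
           (\<omega> \<in> \<Gamma> w \<longleftrightarrow> (snd x, \<omega>) \<in> L)"
      using r that(1-5) by blast
    then show ?thesis using that(6-8) by (metis atLeastLessThan_iff)
  qed
qed

text \<open>After summation by parts every increment of the error is paired with an earlier observed
  event and has expectation 0. So has the boundary term at time 0, because X starts at \<pi>. What
  remains is the boundary term at t, whatever the grid.\<close>

lemma grid_sum_expectation:
  assumes r: "represents t A \<Gamma> L R" and h: "h \<in> {1..m}" and t: "0 \<le> t" "t \<le> T"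
  shows "(LINT \<omega>|M. grid_sum h t \<Gamma> n \<omega>) = (LINT \<omega>|M. indicator A \<omega> * err h t \<omega>)"
    and "integrable M (grid_sum h t \<Gamma> n)"
proof -
  let ?g = "\<lambda>j \<omega>. indicator (\<Gamma> (grid t n j)) \<omega> :: real" and ?e = "\<lambda>j. err h (grid t n j)"
  have gb: "0 \<le> grid t n j" "grid t n j \<le> t" "grid t n j \<le> T" if "j \<le> Suc n" for j
    using grid_bounds[OF t(1) that] t by auto
  have GG: "\<Gamma> (grid t n j) \<in> sets (G (grid t n j))" if "j \<le> Suc n" for j
    by (rule representsD(2)[OF r]) (use gb[OF that] in auto)
  have GM: "\<Gamma> (grid t n j) \<in> sets M" if "j \<le> Suc n" for j
    by (rule obs_measurable_M[OF GG[OF that]]) (use gb[OF that] in auto)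
  have eq: "grid_sum h t \<Gamma> n = (\<lambda>\<omega>. ?g (Suc n) \<omega> * ?e (Suc n) \<omega> - ?g 0 \<omega> * ?e 0 \<omega>
     - (\<Sum>j\<le>n. ?g j \<omega> * (?e (Suc j) \<omega> - ?e j \<omega>)))"
    unfolding grid_sum_def by (rule ext) (rule summation_by_parts[of "\<lambda>j. ?g j _" "\<lambda>j. ?e j _"])
  have i1: "integrable M (\<lambda>\<omega>. ?g (Suc n) \<omega> * ?e (Suc n) \<omega>)" "integrable M (\<lambda>\<omega>. ?g 0 \<omega> * ?e 0 \<omega>)"
    by (intro indicator_mult_integrable GM err_integrable h gb; simp)+
  have i2: "integrable M (\<lambda>\<omega>. ?g j \<omega> * (?e (Suc j) \<omega> - ?e j \<omega>))" if "j \<le> n" for j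
    by (intro indicator_mult_integrable GM Bochner_Integration.integrable_diff err_integrable h gb; use that in simp)
  have i3: "integrable M (\<lambda>\<omega>. \<Sum>j\<le>n. ?g j \<omega> * (?e (Suc j) \<omega> - ?e j \<omega>))"
    by (intro Bochner_Integration.integrable_sum i2) simp
  show "integrable M (grid_sum h t \<Gamma> n)"
    unfolding eq by (intro Bochner_Integration.integrable_diff Bochner_Integration.integrable_sum i1 i2) auto
  have "(LINT \<omega>|M. grid_sum h t \<Gamma> n \<omega>) = (LINT \<omega>|M. ?g (Suc n) \<omega> * ?e (Suc n) \<omega>) - (LINT \<omega>|M. ?g 0 \<omega> * ?e 0 \<omega>)
     - (\<Sum>j\<le>n. LINT \<omega>|M. ?g j \<omega> * (?e (Suc j) \<omega> - ?e j \<omega>))"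
    unfolding eq Bochner_Integration.integral_diff[OF Bochner_Integration.integrable_diff[OF i1] i3]
      Bochner_Integration.integral_diff[OF i1] by (subst Bochner_Integration.integral_sum) (rule i2, simp, rule refl)
  also have "(LINT \<omega>|M. ?g 0 \<omega> * ?e 0 \<omega>) = 0"
    using expectation_err_zero[OF h] GG[of 0] by (simp add: grid_simps)
  also have "(\<Sum>j\<le>n. LINT \<omega>|M. ?g j \<omega> * (?e (Suc j) \<omega> - ?e j \<omega>)) = 0"
  proof (rule sum.neutral, rule ballI)
    fix j assume "j \<in> {..n}"
    then show "(LINT \<omega>|M. ?g j \<omega> * (?e (Suc j) \<omega> - ?e j \<omega>)) = 0"
      unfolding err_def
      by (intro increments_orthogonal h gb GG grid_mono t) auto
  qed
  finally show "(LINT \<omega>|M. grid_sum h t \<Gamma> n \<omega>) = (LINT \<omega>|M. indicator A \<omega> * err h t \<omega>)"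
    by (simp add: grid_simps representsD(1)[OF r])
qed

text \<open>Summation by parts moves the increments onto \<open>X\<close>, whose variation is linear in the number of
  jumps; the crude bound would be quadratic in that number.\<close>

lemma grid_sum_bound:
  assumes r: "represents t A \<Gamma> L R" and h: "h \<in> {1..m}" and t: "0 \<le> t" "t \<le> T" and w: "\<omega> \<in> space M"
  shows "\<bar>grid_sum h t \<Gamma> n \<omega>\<bar> \<le> 4 * dominating h \<omega>"
proof -
  let ?g = "\<lambda>j. indicator (\<Gamma> (grid t n j)) \<omega> :: real"
  let ?x = "\<lambda>j. X h (grid t n j) \<omega>" and ?i = "\<lambda>j. I h (grid t n j) \<omega>"
  let ?N = "\<lambda>j. \<Sum>e\<in>E. real (N e (grid t n j) \<omega>)"
  have gb: "0 \<le> grid t n j" "grid t n j \<le> t" "grid t n j \<le> T" if "j \<le> Suc n" for j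
    using grid_bounds[OF t(1) that] t by auto
  have Nmono: "N e (grid t n j) \<omega> \<le> N e (grid t n (Suc j)) \<omega>" if "e \<in> E" for e j
    by (intro jumps_upto_mono finite_jumps w that grid_mono t) auto
  have g1: "\<bar>?g j\<bar> \<le> 1" for j by (auto simp: indicator_def)
  have tN: "?N (Suc n) - ?N 0 \<le> dominating h \<omega> - 1 - var_const h * T"
  proof -
    have "?N (Suc n) \<le> (\<Sum>e\<in>E. real (N e T \<omega>))"
      using jumps_upto_mono[OF finite_jumps[OF w] t(2)] by (intro sum_mono) (simp add: grid_simps)
    moreover have "0 \<le> ?N 0" by (intro sum_nonneg) auto
    ultimately show ?thesis unfolding dominating_def by linarith
  qed
  \<comment> \<open>The indicator of \<Gamma> can change over a cell only if some count changes, so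
    the increments of the counts control its variation.\<close>
  have jump: "\<bar>?g (Suc j) - ?g j\<bar> \<le> ?N (Suc j) - ?N j" if j: "j \<le> n" for j
  proof (cases "\<forall>e\<in>E. N e (grid t n j) \<omega> = N e (grid t n (Suc j)) \<omega>")
    case True
    then have "\<omega> \<in> \<Gamma> (grid t n j) \<longleftrightarrow> \<omega> \<in> \<Gamma> (grid t n (Suc j))"
      by (intro representsD(5)[OF r] w gb grid_mono t) (use j in auto)
    then show ?thesis using Nmono by (auto simp: indicator_def sum_mono)
  next
    case False
    then obtain e where e: "e \<in> E" "N e (grid t n j) \<omega> < N e (grid t n (Suc j)) \<omega>"
      using Nmono by (metis le_neq_implies_less)
    have "1 \<le> real (N e (grid t n (Suc j)) \<omega>) - real (N e (grid t n j) \<omega>)" using e(2) by linarith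
    also have "\<dots> \<le> (\<Sum>e\<in>E. real (N e (grid t n (Suc j)) \<omega>) - real (N e (grid t n j) \<omega>))"
      by (rule member_le_sum[OF e(1)]) (use Nmono finite_types in auto)
    finally show ?thesis by (auto simp: sum_subtractf indicator_def)
  qed
  \<comment> \<open>Four pieces, each at most \<open>dominating h \<omega>\<close>: for X the two
    boundary terms and the sum left by summation by parts, and for I the original sum, which is
    bounded directly because I takes values in [0, 1].\<close>
  have "grid_sum h t \<Gamma> n \<omega> = (\<Sum>j\<le>n. (?g (Suc j) - ?g j) * ?x (Suc j)) - (\<Sum>j\<le>n. (?g (Suc j) - ?g j) * ?i (Suc j))"
    unfolding grid_sum_def err_def right_diff_distrib sum_subtractf ..
  moreover have "(\<Sum>j\<le>n. (?g (Suc j) - ?g j) * ?x (Suc j))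
    = ?g (Suc n) * ?x (Suc n) - ?g 0 * ?x 0 - (\<Sum>j\<le>n. ?g j * (?x (Suc j) - ?x j))"
    by (rule summation_by_parts)
  moreover have "\<bar>\<Sum>j\<le>n. (?g (Suc j) - ?g j) * ?i (Suc j)\<bar> \<le> dominating h \<omega>"
  proof -
    have "\<bar>\<Sum>j\<le>n. (?g (Suc j) - ?g j) * ?i (Suc j)\<bar> \<le> (\<Sum>j\<le>n. ?N (Suc j) - ?N j)"
    proof (rule order.trans[OF sum_abs sum_mono])
      fix j assume "j \<in> {..n}"
      then have "\<bar>?g (Suc j) - ?g j\<bar> * \<bar>?i (Suc j)\<bar> \<le> (?N (Suc j) - ?N j) * 1"
        using jump[of j] order.trans[OF abs_ge_zero jump[of j]] by (intro mult_mono) (auto simp: I_bounds)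
      then show "\<bar>(?g (Suc j) - ?g j) * ?i (Suc j)\<bar> \<le> ?N (Suc j) - ?N j" by (simp only: abs_mult mult_1_right)
    qed
    also have "\<dots> = ?N (Suc n) - ?N 0" by (rule sum_atMost_telescope)
    finally show ?thesis using tN mult_nonneg_nonneg[OF var_const_nonneg[of h] horizon] by linarith
  qed
  moreover have "\<bar>\<Sum>j\<le>n. ?g j * (?x (Suc j) - ?x j)\<bar> \<le> dominating h \<omega>"
  proof -
    let ?F = "\<lambda>j. var_const h * grid t n j + ?N j"
    have "\<bar>\<Sum>j\<le>n. ?g j * (?x (Suc j) - ?x j)\<bar> \<le> (\<Sum>j\<le>n. ?F (Suc j) - ?F j)"
    proof (rule order.trans[OF sum_abs sum_mono])
      fix j assume j: "j \<in> {..n}"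
      have "\<bar>?x (Suc j) - ?x j\<bar> \<le> ?F (Suc j) - ?F j"
        using X_variation[OF h w, of "grid t n j" "grid t n (Suc j)"] gb[of j] gb[of "Suc j"] grid_mono[OF t(1), of j "Suc j" n] j
        by (simp add: sum_subtractf algebra_simps)
      moreover have "\<bar>?g j\<bar> * \<bar>?x (Suc j) - ?x j\<bar> \<le> 1 * \<bar>?x (Suc j) - ?x j\<bar>"
        by (rule mult_right_mono[OF g1]) simp
      ultimately show "\<bar>?g j * (?x (Suc j) - ?x j)\<bar> \<le> ?F (Suc j) - ?F j" unfolding abs_mult mult_1 by (rule order.trans[rotated])
    qed
    also have "\<dots> = ?F (Suc n) - ?F 0" by (rule sum_atMost_telescope)
    also have "\<dots> = var_const h * t + (?N (Suc n) - ?N 0)" by (simp add: grid_simps)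
    also have "\<dots> \<le> dominating h \<omega>"
      using tN mult_left_mono[OF t(2) var_const_nonneg[of h]] by linarith
    finally show ?thesis .
  qed
  moreover have "\<bar>?g j * ?x j\<bar> \<le> dominating h \<omega>" if "j \<le> Suc n" for j
  proof -
    have "\<bar>?g j\<bar> * \<bar>?x j\<bar> \<le> 1 * \<bar>?x j\<bar>" by (rule mult_right_mono[OF g1]) simp
    then show ?thesis using X_bound[OF h w gb(1)[OF that] gb(3)[OF that]] unfolding dominating_def abs_mult by linarith
  qed
  from this[of 0] this[of "Suc n"]
  have "\<bar>?g 0 * ?x 0\<bar> \<le> dominating h \<omega>" "\<bar>?g (Suc n) * ?x (Suc n)\<bar> \<le> dominating h \<omega>" by simp_all
  ultimately show ?thesis by linarith
qed

lemma err_tendsto_right: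
  assumes "h \<in> {1..m}" "\<omega> \<in> space M" "0 \<le> t" "t < T"
  shows "((\<lambda>v. err h v \<omega>) \<longlongrightarrow> err h t \<omega>) (at_right t)"
  unfolding err_def by (intro tendsto_diff X_tendsto_right I_tendsto_right assms)

lemma count_eq_if_no_jump:
  assumes "v \<le> w" "\<And>y. y \<in> J e \<omega> \<Longrightarrow> v < snd y \<Longrightarrow> snd y \<le> w \<Longrightarrow> False"
  shows "N e v \<omega> = N e w \<omega>"
proof -
  have "{x \<in> J e \<omega>. snd x \<le> v} = {x \<in> J e \<omega>. snd x \<le> w}" using assms by force
  then show ?thesis unfolding jumps_upto_def by simp
qed

text \<open>Once the mesh is smaller than all gaps between jump times, a cell contains at most one
  jump. Cells without jumps leave \<Gamma> unchanged. A cell with a jump of type e contributes the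
  change from L to \<open>R e\<close> times the error at the right end of the cell, which tends to
  the error at the jump by right continuity.\<close>

lemma grid_sum_tendsto:
  assumes r: "represents t A \<Gamma> L R" and h: "h \<in> {1..m}" and t: "0 < t" "t \<le> T"
    and w: "\<omega> \<in> space M" and simple: "simple_path \<omega>"
  shows "(\<lambda>n. grid_sum h t \<Gamma> n \<omega>) \<longlonglongrightarrow>
    (\<Sum>e\<in>E. \<Sum>x\<in>{x\<in>J e \<omega>. snd x \<le> t}. (indicator (R e) (snd x, \<omega>) - indicator L (snd x, \<omega>)) * err h (snd x) \<omega>)"
proof -
  define U where "U = Sigma E (\<lambda>e. {x\<in>J e \<omega>. snd x \<le> t})"
  define time :: "'e \<times> ('q \<times> real) \<Rightarrow> real" where "time u = snd (snd u)" for u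
  define d :: "'e \<times> ('q \<times> real) \<Rightarrow> real" where "d u = indicator (R (fst u)) (time u, \<omega>) - indicator L (time u, \<omega>)" for u
  have finU: "finite U" unfolding U_def using finite_types finite_jumps[OF w] by auto
  have time: "0 < time u" "time u \<le> t" if "u \<in> U" for u
    using that jump_times[OF w] unfolding U_def time_def by auto
  have time_inj: "u = u'" if "u \<in> U" "u' \<in> U" "time u = time u'" for u u'
  proof -
    have "fst u \<in> E" "snd u \<in> J (fst u) \<omega>" "fst u' \<in> E" "snd u' \<in> J (fst u') \<omega>"
      using that(1,2) by (auto simp: U_def)
    then have "fst u = fst u' \<and> snd u = snd u'"
      using simple that(3) unfolding simple_path_def time_def by blast
    then show ?thesis by (simp add: prod_eq_iff)
  qed
  have sep: "\<forall>\<^sub>F n in sequentially. \<forall>u\<in>U. \<forall>u'\<in>U. u \<noteq> u' \<longrightarrow> t / real (Suc n) < \<bar>time u - time u'\<bar>"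
  proof (rule eventually_ball_finite[OF finU], rule ballI, rule eventually_ball_finite[OF finU], rule ballI)
    fix u u' assume u: "u \<in> U" "u' \<in> U"
    show "\<forall>\<^sub>F n in sequentially. u \<noteq> u' \<longrightarrow> t / real (Suc n) < \<bar>time u - time u'\<bar>"
    proof (cases "u = u'")
      case False
      then have "0 < \<bar>time u - time u'\<bar>" using time_inj[OF u] by auto
      from order_tendstoD(2)[OF grid_step_tendsto[of t] this] show ?thesis by (rule eventually_mono) simp
    qed simp
  qed
  have eq: "\<forall>\<^sub>F n in sequentially. (\<Sum>u\<in>U. d u * err h (grid t n (Suc (cell t n (time u)))) \<omega>) = grid_sum h t \<Gamma> n \<omega>"
    using sep
  proof eventually_elim
    case (elim n)
    let ?j = "\<lambda>u. cell t n (time u)"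
    let ?a = "\<lambda>j. (indicator (\<Gamma> (grid t n (Suc j))) \<omega> - indicator (\<Gamma> (grid t n j)) \<omega>) * err h (grid t n (Suc j)) \<omega>"
    have cell: "grid t n (?j u) < time u" "time u \<le> grid t n (Suc (?j u))" "?j u \<le> n" if "u \<in> U" for u
      using cell_bounds(1,2,5)[OF time[OF that], of n] unfolding grid_def by auto
    have step: "grid t n (Suc j) = grid t n j + t / real (Suc n)" for j
      by (simp add: grid_def add_divide_distrib distrib_right)
    have cell_inj: "u = u'" if "u \<in> U" "u' \<in> U" "?j u = ?j u'" for u u'
    proof (rule ccontr)
      assume "u \<noteq> u'"
      then have "t / real (Suc n) < \<bar>time u - time u'\<bar>" using elim that by blast
      then show False using cell(1,2)[OF that(1)] cell(1,2)[OF that(2)] that(3) unfolding step by simp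
    qed
    have find: "?j (e, y) = j" "(e, y) \<in> U"
      if "e \<in> E" "y \<in> J e \<omega>" "grid t n j < snd y" "snd y \<le> grid t n (Suc j)" "j \<le> n" for e y j
    proof -
      have y: "0 < snd y" "snd y \<le> t"
        using jump_times[OF w that(1,2)] that(4) grid_bounds[of t "Suc j" n] that(5) t by auto
      show "(e, y) \<in> U" using that y by (simp add: U_def)
      show "?j (e, y) = j"
        using cell_eq_iff[OF y, of j n] that(3,4) by (simp add: time_def grid_def del: of_nat_Suc)
    qed
    have "grid_sum h t \<Gamma> n \<omega> = (\<Sum>j\<in>?j ` U. ?a j)"
      unfolding grid_sum_def
    proof (rule sum.mono_neutral_right)
      show "?j ` U \<subseteq> {..n}" using cell(3) by auto
      show "\<forall>j\<in>{..n} - ?j ` U. ?a j = 0"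
      proof
        fix j assume j: "j \<in> {..n} - ?j ` U"
        have "\<omega> \<in> \<Gamma> (grid t n j) \<longleftrightarrow> \<omega> \<in> \<Gamma> (grid t n (Suc j))"
        proof (rule representsD(5)[OF r w])
          fix e assume e: "e \<in> E"
          show "N e (grid t n j) \<omega> = N e (grid t n (Suc j)) \<omega>"
          proof (rule count_eq_if_no_jump)
            fix y assume "y \<in> J e \<omega>" "grid t n j < snd y" "snd y \<le> grid t n (Suc j)"
            from find[OF e this] j show False by (metis DiffE atMost_iff imageI)
          qed (use t in \<open>auto intro: grid_mono\<close>)
        qed (use grid_bounds[of t j n] grid_bounds[of t "Suc j" n] grid_mono[of t j "Suc j" n] t j in auto)
        then show "?a j = 0" by (simp add: indicator_def)
      qed
    qed simp
    also have "\<dots> = (\<Sum>u\<in>U. ?a (?j u))"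
    proof (rule sum.reindex_cong[of ?j U])
      show "inj_on ?j U" by (rule inj_onI) (rule cell_inj)
    qed simp_all
    also have "\<dots> = (\<Sum>u\<in>U. d u * err h (grid t n (Suc (?j u))) \<omega>)"
    proof (rule sum.cong[OF refl])
      fix u assume u: "u \<in> U"
      obtain e x where ex: "u = (e, x)" "e \<in> E" "x \<in> J e \<omega>" "snd x \<le> t" using u by (auto simp: U_def)
      have tu: "time u = snd x" by (simp add: time_def ex)
      \<comment> \<open>As x is alone in its cell, \<Gamma> is constant from x to the right end, and
        its value at the left end is the one that L prescribes for x.\<close>
      have only: "y = x \<and> e' = e" if "e' \<in> E" "y \<in> J e' \<omega>" "grid t n (?j u) < snd y" "snd y \<le> grid t n (Suc (?j u))" for e' y
        using cell_inj[OF find(2)[OF that cell(3)[OF u]] u find(1)[OF that cell(3)[OF u]]] by (simp add: ex)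
      have "\<omega> \<in> \<Gamma> (snd x) \<longleftrightarrow> \<omega> \<in> \<Gamma> (grid t n (Suc (?j u)))"
      proof (rule representsD(5)[OF r w])
        fix e' assume e': "e' \<in> E"
        show "N e' (snd x) \<omega> = N e' (grid t n (Suc (?j u))) \<omega>"
        proof (rule count_eq_if_no_jump)
          fix y assume "y \<in> J e' \<omega>" "snd x < snd y" "snd y \<le> grid t n (Suc (?j u))"
          then show False using only[OF e', of y] cell(1)[OF u] tu by auto
        qed (use cell(2)[OF u] tu in simp)
      qed (use cell(2)[OF u] cell(3)[OF u] tu time[OF u] grid_bounds[of t "Suc (?j u)" n] t in auto)
      moreover have "\<omega> \<in> \<Gamma> (snd x) \<longleftrightarrow> (snd x, \<omega>) \<in> R e"
        by (rule representsD(6)[OF r w simple ex(2-4)])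
      moreover have "\<omega> \<in> \<Gamma> (grid t n (?j u)) \<longleftrightarrow> (snd x, \<omega>) \<in> L"
      proof (rule representsD(7)[OF r w simple ex(2-4)])
        fix e' y assume y: "e' \<in> E" "y \<in> J e' \<omega>" "grid t n (?j u) < snd y" "snd y < snd x"
        have "snd y \<le> grid t n (Suc (?j u))" using y(4) cell(2)[OF u] unfolding tu by linarith
        with only[OF y(1-3)] y(4) show False by simp
      next
        show "0 \<le> grid t n (?j u)" using grid_bounds[of t "?j u" n] cell(3)[OF u] t by simp
        show "grid t n (?j u) < snd x" using cell(1)[OF u] unfolding tu .
      qed
      ultimately show "?a (?j u) = d u * err h (grid t n (Suc (?j u))) \<omega>"
        unfolding d_def tu by (simp add: indicator_def ex(1))
    qed
    finally show ?case by simp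
  qed
  have "(\<lambda>n. \<Sum>u\<in>U. d u * err h (grid t n (Suc (cell t n (time u)))) \<omega>) \<longlonglongrightarrow> (\<Sum>u\<in>U. d u * err h (time u) \<omega>)"
  proof (intro tendsto_sum tendsto_mult tendsto_const)
    fix u assume u: "u \<in> U"
    show "(\<lambda>n. err h (grid t n (Suc (cell t n (time u)))) \<omega>) \<longlonglongrightarrow> err h (time u) \<omega>"
      unfolding grid_def
      by (rule cell_right_tendsto[OF time[OF u], of "\<lambda>v. err h v \<omega>"])
        (rule err_tendsto_right[OF h w], use time[OF u] t in auto)
  qed
  from Lim_transform_eventually[OF this eq]
  have "(\<lambda>n. grid_sum h t \<Gamma> n \<omega>) \<longlonglongrightarrow> (\<Sum>u\<in>U. d u * err h (time u) \<omega>)" .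
  also have "(\<Sum>u\<in>U. d u * err h (time u) \<omega>)
    = (\<Sum>e\<in>E. \<Sum>x\<in>{x\<in>J e \<omega>. snd x \<le> t}. (indicator (R e) (snd x, \<omega>) - indicator L (snd x, \<omega>)) * err h (snd x) \<omega>)"
    unfolding U_def d_def time_def
    by (subst sum.Sigma) (use finite_types finite_jumps[OF w] in \<open>auto intro!: sum.cong\<close>)
  finally show ?thesis .
qed

section \<open>The expected error over an observed event\<close>

lemma integrable_P2_snd:
  fixes g :: "'a \<Rightarrow> real"
  assumes "integrable M g" shows "integrable P2 (\<lambda>z. g (snd z))"
proof (rule P2.Fubini_integrable)
  show "(\<lambda>z. g (snd z)) \<in> borel_measurable P2" using assms by measurable
  show "integrable (leb T) (\<lambda>v. LINT \<omega>|M. norm (g (snd (v, \<omega>))))"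
    using finite_measure.integrable_const[OF finite_leb] by simp
qed (use assms in simp)

lemma integrable_P2_dominated:
  fixes f :: "real \<times> 'a \<Rightarrow> real"
  assumes f: "f \<in> borel_measurable P2"
    and b: "\<And>t \<omega>. 0 \<le> t \<Longrightarrow> t \<le> T \<Longrightarrow> \<omega> \<in> space M \<Longrightarrow> \<bar>f (t, \<omega>)\<bar> \<le> c * dominating h \<omega>"
  shows "integrable P2 f"
proof (rule Bochner_Integration.integrable_bound)
  show "integrable P2 (\<lambda>z. c * dominating h (snd z))"
    by (rule Bochner_Integration.integrable_mult_right[OF integrable_P2_snd[OF dominating_integrable]])
  show "AE z in P2. norm (f z) \<le> norm (c * dominating h (snd z))"
  proof (rule AE_I2)
    fix z assume "z \<in> space P2"
    then have "\<bar>f z\<bar> \<le> c * dominating h (snd z)" using b[of "fst z" "snd z"] by (cases z) (auto simp: space_P2)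
    then show "norm (f z) \<le> norm (c * dominating h (snd z))" by simp
  qed
qed (rule f)

definition D_left :: "nat \<Rightarrow> real \<times> 'a \<Rightarrow> real" where
  "D_left h z = X_left h (fst z) (snd z) - pi_left h (fst z) (snd z)"

lemma D_left_measurable: "h \<in> {1..m} \<Longrightarrow> D_left h \<in> borel_measurable PredG"
  unfolding D_left_def[abs_def] by (intro borel_measurable_diff X_left_measurable pi_left_measurable)

lemma D_left_bound:
  assumes "h \<in> {1..m}" "0 \<le> t" "t \<le> T" "\<omega> \<in> space M"
  shows "\<bar>D_left h (t, \<omega>)\<bar> \<le> 2 * dominating h \<omega>"
  using X_left_bound[OF assms(1,4,2,3)] pi_left_bounds[OF assms(1,4,2,3)] dominating_ge_1[of h \<omega>]
  unfolding D_left_def dominating_def[symmetric] by simp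

text \<open>This is the computation that dictates \<open>gain\<close>. Here f is d times the error
  at a jump, written with left limits; after compensation and projection,
  \<open>gain_mult_lam\<close> cancels the projected indicator against the gain and leaves
  \<open>D_left\<close>.\<close>

lemma jump_integral:
  assumes h: "h \<in> {1..m}" and e: "e \<in> E" and t: "0 \<le> t" "t \<le> T"
    and d: "d \<in> borel_measurable PredG" and d1: "\<And>z. \<bar>d z\<bar> \<le> 1"
  defines "f \<equiv> \<lambda>z. indicator {0<..t} (fst z) * d z * (X_left h (fst z) (snd z) + gain h e (fst z) (snd z) - I_left h (fst z) (snd z))"
  shows "f \<in> borel_measurable Pred" "integrable M (jump_sum e f T)"
    and "(LINT \<omega>|M. jump_sum e f T \<omega>)
      = (LINT z|P2. indicator {0<..t} (fst z) * d z * (Y e (fst z) (snd z) * lam e (fst z) (snd z)) * D_left h z)"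
proof -
  let ?w = "\<lambda>z. indicator {0<..t} (fst z) * d z :: real"
  let ?x = "\<lambda>z. X_left h (fst z) (snd z) + gain h e (fst z) (snd z)"
  have ind: "(\<lambda>z. indicator {0<..t} (fst z) :: real) \<in> borel_measurable PredG"
    by (rule measurable_compose[OF predictable_time[OF horizon obs_filtration]]) simp
  have w: "?w \<in> borel_measurable PredG" by (intro borel_measurable_times ind d)
  have w1: "\<bar>?w z\<bar> \<le> 1" for z using d1[of z] by (auto simp: indicator_def)
  have x: "?x \<in> borel_measurable PredG" by (intro borel_measurable_add X_left_measurable gain_measurable h)
  have wx: "(\<lambda>z. ?w z * ?x z) \<in> borel_measurable PredG" by (intro borel_measurable_times w x)
  have iw: "integrable P2 ?w" by (rule integrable_P2_bounded[OF PredG_imp_P2[OF w]]) (rule w1)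
  have xb: "\<bar>?w (v, \<omega>) * ?x (v, \<omega>)\<bar> \<le> 2 * dominating h \<omega>" if "0 \<le> v" "v \<le> T" "\<omega> \<in> space M" for v \<omega>
  proof -
    have "\<bar>?x (v, \<omega>)\<bar> \<le> 2 * dominating h \<omega>"
      using X_left_bound[OF h that(3,1,2)] gain_bound[OF h e that(3,1,2)] dominating_ge_1[of h \<omega>]
      unfolding dominating_def[symmetric] by simp
    then have "\<bar>?w (v, \<omega>)\<bar> * \<bar>?x (v, \<omega>)\<bar> \<le> 1 * (2 * dominating h \<omega>)"
      using w1[of "(v, \<omega>)"] by (intro mult_mono) auto
    then show ?thesis by (simp only: abs_mult mult_1)
  qed
  have iwx: "integrable P2 (\<lambda>z. ?w z * ?x z)"
    by (rule integrable_P2_dominated[OF PredG_imp_P2[OF wx]]) (rule xb)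
  have iwI: "integrable P2 (\<lambda>z. ?w z * I_left h (fst z) (snd z))"
    by (rule integrable_P2_mult_bounded[OF iw Pred_imp_P2[OF I_left_measurable], where B = 1]) (auto simp: I_bounds)
  have f_eq: "f z = ?w z * ?x z - ?w z * I_left h (fst z) (snd z)" for z
    unfolding f_def by (rule right_diff_distrib)
  show f: "f \<in> borel_measurable Pred"
    unfolding f_eq[abs_def]
    by (intro borel_measurable_diff borel_measurable_times[OF PredG_imp_Pred[OF w] I_left_measurable] PredG_imp_Pred[OF wx])
  have nub: "\<bar>nu e v \<omega>\<bar> \<le> K * ell_max" if "0 \<le> v" "v \<le> T" "\<omega> \<in> space M" for v \<omega>
    using nu_bounds[OF e that(3,1,2)] by simp
  have i1: "integrable P2 (\<lambda>z. ?w z * ?x z * nu e (fst z) (snd z))"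
    by (rule integrable_P2_mult_bounded[OF iwx nu_measurable[OF e], where B = "K * ell_max"]) (use nub in simp)
  have i2: "integrable P2 (\<lambda>z. ?w z * I_left h (fst z) (snd z) * nu e (fst z) (snd z))"
    by (rule integrable_P2_mult_bounded[OF iwI nu_measurable[OF e], where B = "K * ell_max"]) (use nub in simp)
  have int: "integrable P2 (\<lambda>z. f z * nu e (fst z) (snd z))"
    unfolding f_eq left_diff_distrib by (rule Bochner_Integration.integrable_diff[OF i1 i2])
  show "integrable M (jump_sum e f T)" by (rule jump_compensator(1)[OF e f int])
  note we = integrable_exposure[OF e w iw, of "ell h e"]
  have ie1: "integrable P2 (\<lambda>z. ?w z * ?x z * (Y e (fst z) (snd z) * lam e (fst z) (snd z)))"
  proof (rule integrable_P2_mult_bounded[OF iwx, where B = "K * ell_max"])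
    show "(\<lambda>z. Y e (fst z) (snd z) * lam e (fst z) (snd z)) \<in> borel_measurable P2"
      by (rule PredG_imp_P2) (intro borel_measurable_times exposure_measurable[OF e] lam_measurable)
    show "\<bar>Y e (fst (v, \<omega>)) (snd (v, \<omega>)) * lam e (fst (v, \<omega>)) (snd (v, \<omega>))\<bar> \<le> K * ell_max"
      if "0 \<le> v" "v \<le> T" "\<omega> \<in> space M" for v \<omega>
      using exposure_bounds[OF e that(3,1,2)] lam_bounds[OF e that(3,1,2)] K_nonneg[OF e]
      by (auto simp: abs_mult intro!: mult_mono)
  qed
  have ie2: "integrable P2 (\<lambda>z. ?w z * Y e (fst z) (snd z) * ell h e * pi_left h (fst z) (snd z))"
    by (rule integrable_P2_mult_bounded[OF we(1) PredG_imp_P2[OF pi_left_measurable[OF h]], where B = 1])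
      (use pi_left_bounds[OF h] in auto)
  \<comment> \<open>\<open>I_left h\<close> is 1 only if h is the state just before v, so it keeps a
    single summand of \<open>nu\<close>.\<close>
  have I_nu: "I_left h v \<omega> * nu e v \<omega> = Y e v \<omega> * ell h e * I_left h v \<omega>" for v \<omega>
  proof -
    have "I_left h v \<omega> * (\<Sum>r=1..m. ell r e * I_left r v \<omega>) = (\<Sum>r=1..m. if r = h then ell h e * I_left h v \<omega> else 0)"
      unfolding sum_distrib_left by (rule sum.cong) (auto simp: I_left_def)
    also have "\<dots> = ell h e * I_left h v \<omega>" using h by simp
    finally show ?thesis by (simp add: nu_def mult_ac)
  qed
  have "(LINT \<omega>|M. jump_sum e f T \<omega>) = (LINT z|P2. f z * nu e (fst z) (snd z))"
    by (rule jump_compensator(2)[OF e f int])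
  also have "\<dots> = (LINT z|P2. ?w z * ?x z * nu e (fst z) (snd z)) - (LINT z|P2. ?w z * I_left h (fst z) (snd z) * nu e (fst z) (snd z))"
    unfolding f_eq left_diff_distrib by (rule Bochner_Integration.integral_diff[OF i1 i2])
  also have "(LINT z|P2. ?w z * ?x z * nu e (fst z) (snd z)) = (LINT z|P2. ?w z * ?x z * (Y e (fst z) (snd z) * lam e (fst z) (snd z)))"
    by (rule intensity_projection[OF e wx iwx])
  also have "(LINT z|P2. ?w z * I_left h (fst z) (snd z) * nu e (fst z) (snd z))
      = (LINT z|P2. ?w z * Y e (fst z) (snd z) * ell h e * I_left h (fst z) (snd z))"
    by (rule Bochner_Integration.integral_cong[OF refl]) (simp only: mult.assoc I_nu)
  also have "\<dots> = (LINT z|P2. ?w z * Y e (fst z) (snd z) * ell h e * pi_left h (fst z) (snd z))"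
    by (rule projection[OF h we(2,1)])
  also have "(LINT z|P2. ?w z * ?x z * (Y e (fst z) (snd z) * lam e (fst z) (snd z)))
      - (LINT z|P2. ?w z * Y e (fst z) (snd z) * ell h e * pi_left h (fst z) (snd z))
    = (LINT z|P2. ?w z * ?x z * (Y e (fst z) (snd z) * lam e (fst z) (snd z)) - ?w z * Y e (fst z) (snd z) * ell h e * pi_left h (fst z) (snd z))"
    by (rule Bochner_Integration.integral_diff[OF ie1 ie2, symmetric])
  also have "\<dots> = (LINT z|P2. ?w z * (Y e (fst z) (snd z) * lam e (fst z) (snd z)) * D_left h z)"
  proof (rule Bochner_Integration.integral_cong[OF refl])
    fix z assume z: "z \<in> space P2"
    have "gain h e (fst z) (snd z) * lam e (fst z) (snd z) = ell h e * pi_left h (fst z) (snd z) - pi_left h (fst z) (snd z) * lam e (fst z) (snd z)"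
      by (rule gain_mult_lam[OF h e]) (use z in \<open>auto simp: space_P2\<close>)
    then have *: "?x z * lam e (fst z) (snd z) - ell h e * pi_left h (fst z) (snd z) = lam e (fst z) (snd z) * D_left h z"
      by (simp add: D_left_def algebra_simps)
    have "?w z * ?x z * (Y e (fst z) (snd z) * lam e (fst z) (snd z)) - ?w z * Y e (fst z) (snd z) * ell h e * pi_left h (fst z) (snd z)
      = ?w z * Y e (fst z) (snd z) * (?x z * lam e (fst z) (snd z) - ell h e * pi_left h (fst z) (snd z))"
      by (simp add: algebra_simps)
    also have "\<dots> = ?w z * (Y e (fst z) (snd z) * lam e (fst z) (snd z)) * D_left h z"
      unfolding * by (simp only: mult_ac)
    finally show "?w z * ?x z * (Y e (fst z) (snd z) * lam e (fst z) (snd z)) - ?w z * Y e (fst z) (snd z) * ell h e * pi_left h (fst z) (snd z)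
      = ?w z * (Y e (fst z) (snd z) * lam e (fst z) (snd z)) * D_left h z" .
  qed
  finally show "(LINT \<omega>|M. jump_sum e f T \<omega>)
      = (LINT z|P2. indicator {0<..t} (fst z) * d z * (Y e (fst z) (snd z) * lam e (fst z) (snd z)) * D_left h z)" .
qed

text \<open>The grid sums have constant expectation and converge almost surely to a sum over jumps.
  Dominated convergence equates that constant with the expectation of the limit, which
  \<open>jump_integral\<close> evaluates.\<close>

lemma expectation_err_formula:
  assumes h: "h \<in> {1..m}" and t: "0 < t" "t \<le> T" and r: "represents t A \<Gamma> L R"
  shows "(LINT \<omega>|M. indicator A \<omega> * err h t \<omega>) = (\<Sum>e\<in>E. LINT z|P2. indicator {0<..t} (fst z) *
    (indicator (R e) z - indicator L z) * (Y e (fst z) (snd z) * lam e (fst z) (snd z)) * D_left h z)"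
proof -
  let ?d = "\<lambda>e z. indicator (R e) z - indicator L z :: real"
  have d: "?d e \<in> borel_measurable PredG" for e
    using representsD(3,4)[OF r] by measurable
  have d1: "\<bar>?d e z\<bar> \<le> 1" for e z by (auto simp: indicator_def)
  let ?f = "\<lambda>e z. indicator {0<..t} (fst z) * ?d e z * (X_left h (fst z) (snd z) + gain h e (fst z) (snd z) - I_left h (fst z) (snd z))"
  let ?S = "\<lambda>\<omega>. \<Sum>e\<in>E. jump_sum e (?f e) T \<omega>"
  note ji = jump_integral[OF h _ less_imp_le[OF t(1)] t(2) d d1]
  have lim: "AE \<omega> in M. (\<lambda>n. grid_sum h t \<Gamma> n \<omega>) \<longlonglongrightarrow> ?S \<omega>"
    using no_simultaneous no_common AE_space
  proof eventually_elim
    case (elim \<omega>)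
    then have simple: "simple_path \<omega>" unfolding simple_path_def by blast
    have "(\<Sum>e\<in>E. \<Sum>x\<in>{x\<in>J e \<omega>. snd x \<le> t}. ?d e (snd x, \<omega>) * err h (snd x) \<omega>) = ?S \<omega>"
    proof (rule sum.cong[OF refl])
      fix e assume e: "e \<in> E"
      show "(\<Sum>x\<in>{x\<in>J e \<omega>. snd x \<le> t}. ?d e (snd x, \<omega>) * err h (snd x) \<omega>) = jump_sum e (?f e) T \<omega>"
        unfolding jump_sum_def
      proof (rule sum.mono_neutral_cong_left)
        show "finite {x \<in> J e \<omega>. snd x \<le> T}" using finite_jumps[OF elim(3) e] by simp
        show "{x \<in> J e \<omega>. snd x \<le> t} \<subseteq> {x \<in> J e \<omega>. snd x \<le> T}" using t by auto
        show "\<forall>x\<in>{x \<in> J e \<omega>. snd x \<le> T} - {x \<in> J e \<omega>. snd x \<le> t}. ?f e (snd x, \<omega>) = 0" by auto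
        fix x assume x: "x \<in> {x \<in> J e \<omega>. snd x \<le> t}"
        then have xJ: "x \<in> J e \<omega>" by simp
        \<comment> \<open>The hidden factor does not jump together with the counts. This turns the
          error at a jump into an F-predictable integrand.\<close>
        have "I_left h (snd x) \<omega> = I h (snd x) \<omega>" using elim(2) e xJ by (simp add: I_left_def I_def)
        then have "err h (snd x) \<omega> = X_left h (snd x) \<omega> + gain h e (snd x) \<omega> - I_left h (snd x) \<omega>"
          unfolding err_def X_jump[OF h elim(3) simple e xJ] by simp
        then show "?d e (snd x, \<omega>) * err h (snd x) \<omega> = ?f e (snd x, \<omega>)"
          using x jump_times[OF elim(3) e xJ] by simp
      qed
    qed
    then show ?case using grid_sum_tendsto[OF r h t elim(3) simple] by simp
  qed
  have "(\<lambda>n. LINT \<omega>|M. grid_sum h t \<Gamma> n \<omega>) \<longlonglongrightarrow> (LINT \<omega>|M. ?S \<omega>)"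
  proof (rule integral_dominated_convergence[where w = "\<lambda>\<omega>. 4 * dominating h \<omega>"])
    show "?S \<in> borel_measurable M"
      by (intro borel_measurable_sum borel_measurable_integrable ji(2))
    show "grid_sum h t \<Gamma> n \<in> borel_measurable M" for n
      by (rule borel_measurable_integrable[OF grid_sum_expectation(2)[OF r h less_imp_le[OF t(1)] t(2)]])
    show "integrable M (\<lambda>\<omega>. 4 * dominating h \<omega>)" using dominating_integrable by simp
    show "AE \<omega> in M. norm (grid_sum h t \<Gamma> n \<omega>) \<le> 4 * dominating h \<omega>" for n
      by (rule AE_I2) (use grid_sum_bound[OF r h less_imp_le[OF t(1)] t(2)] in simp)
  qed (rule lim)
  then have "(LINT \<omega>|M. indicator A \<omega> * err h t \<omega>) = (LINT \<omega>|M. ?S \<omega>)"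
    unfolding grid_sum_expectation(1)[OF r h less_imp_le[OF t(1)] t(2)] by (rule LIMSEQ_const_iff[THEN iffD1])
  also have "\<dots> = (\<Sum>e\<in>E. LINT \<omega>|M. jump_sum e (?f e) T \<omega>)"
    by (rule Bochner_Integration.integral_sum) (rule ji(2))
  also have "\<dots> = (\<Sum>e\<in>E. LINT z|P2. indicator {0<..t} (fst z) * ?d e z * (Y e (fst z) (snd z) * lam e (fst z) (snd z)) * D_left h z)"
    by (rule sum.cong[OF refl]) (rule ji(3))
  finally show ?thesis .
qed

definition total_rate :: real where
  "total_rate = (\<Sum>e\<in>E. K * ell_max)"

lemma total_rate_nonneg: "0 \<le> total_rate"
  unfolding total_rate_def by (intro sum_nonneg mult_nonneg_nonneg K_nonneg ell_max_nonneg)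

lemma expectation_err_bound:
  assumes h: "h \<in> {1..m}" and t: "0 < t" "t \<le> T" and A: "A \<in> sets (G t)"
  shows "\<bar>LINT \<omega>|M. indicator A \<omega> * err h t \<omega>\<bar> \<le> total_rate * (LINT z|P2. indicator {0<..t} (fst z) * \<bar>D_left h z\<bar>)"
proof -
  obtain \<Gamma> L R where r: "represents t A \<Gamma> L R" using ex_represents[OF less_imp_le[OF t(1)] t(2) A] by blast
  have ind: "(\<lambda>z. indicator {0<..t} (fst z) :: real) \<in> borel_measurable PredG"
    by (rule measurable_compose[OF predictable_time[OF horizon obs_filtration]]) simp
  have iD: "integrable P2 (\<lambda>z. indicator {0<..t} (fst z) * \<bar>D_left h z\<bar>)"
  proof (rule integrable_P2_dominated)
    show "(\<lambda>z. indicator {0<..t} (fst z) * \<bar>D_left h z\<bar>) \<in> borel_measurable P2"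
      by (rule PredG_imp_P2) (intro borel_measurable_times ind borel_measurable_abs D_left_measurable[OF h])
    show "\<bar>indicator {0<..t} (fst (v, \<omega>)) * \<bar>D_left h (v, \<omega>)\<bar>\<bar> \<le> 2 * dominating h \<omega>"
      if "0 \<le> v" "v \<le> T" "\<omega> \<in> space M" for v \<omega>
      using D_left_bound[OF h that] dominating_ge_1[of h \<omega>] by (auto simp: indicator_def)
  qed
  let ?q = "\<lambda>e z. indicator {0<..t} (fst z) * (indicator (R e) z - indicator L z) * (Y e (fst z) (snd z) * lam e (fst z) (snd z)) * D_left h z :: real"
  have q: "\<bar>LINT z|P2. ?q e z\<bar> \<le> K * ell_max * (LINT z|P2. indicator {0<..t} (fst z) * \<bar>D_left h z\<bar>)" if e: "e \<in> E" for e
  proof -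
    have qb: "\<bar>?q e z\<bar> \<le> K * ell_max * (indicator {0<..t} (fst z) * \<bar>D_left h z\<bar>)" if "z \<in> space P2" for z
    proof -
      have z: "snd z \<in> space M" "0 \<le> fst z" "fst z \<le> T" using that by (auto simp: space_P2)
      have 1: "\<bar>indicator (R e) z - indicator L z :: real\<bar> \<le> 1" by (auto simp: indicator_def)
      have 2: "\<bar>Y e (fst z) (snd z) * lam e (fst z) (snd z)\<bar> \<le> K * ell_max"
        using exposure_bounds[OF e z] lam_bounds[OF e z] K_nonneg[OF e] by (auto simp: abs_mult intro!: mult_mono)
      have "\<bar>?q e z\<bar> = indicator {0<..t} (fst z) * \<bar>indicator (R e) z - indicator L z\<bar> * \<bar>Y e (fst z) (snd z) * lam e (fst z) (snd z)\<bar> * \<bar>D_left h z\<bar>"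
        by (simp add: abs_mult)
      also have "\<dots> \<le> indicator {0<..t} (fst z) * 1 * (K * ell_max) * \<bar>D_left h z\<bar>"
        by (intro mult_mono mult_nonneg_nonneg 1 2) (use K_nonneg[OF e] ell_max_nonneg in auto)
      finally show ?thesis by (simp only: mult_ac mult_1_right)
    qed
    have "\<bar>LINT z|P2. ?q e z\<bar> \<le> (LINT z|P2. \<bar>?q e z\<bar>)" by (rule integral_abs_bound)
    also have "\<dots> \<le> (LINT z|P2. K * ell_max * (indicator {0<..t} (fst z) * \<bar>D_left h z\<bar>))"
    proof (rule integral_mono')
      show "integrable P2 (\<lambda>z. K * ell_max * (indicator {0<..t} (fst z) * \<bar>D_left h z\<bar>))"
        by (rule Bochner_Integration.integrable_mult_right[OF iD])
      show "0 \<le> K * ell_max * (indicator {0<..t} (fst z) * \<bar>D_left h z\<bar>)" for z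
        using K_nonneg[OF e] ell_max_nonneg by simp
    qed (rule qb)
    finally show ?thesis by simp
  qed
  have "\<bar>LINT \<omega>|M. indicator A \<omega> * err h t \<omega>\<bar> \<le> (\<Sum>e\<in>E. K * ell_max * (LINT z|P2. indicator {0<..t} (fst z) * \<bar>D_left h z\<bar>))"
    unfolding expectation_err_formula[OF h t r]
    by (rule order.trans[OF sum_abs sum_mono]) (rule q)
  then show ?thesis unfolding total_rate_def sum_distrib_right .
qed

section \<open>Gronwall's lemma and identification of X with the filter\<close>

definition gap :: "nat \<Rightarrow> real \<Rightarrow> real" where
  "gap h t = (LINT \<omega>|M. \<bar>X h t \<omega> - \<pi> h t \<omega>\<bar>)"

lemma gap_integrable:
  assumes "h \<in> {1..m}" "0 \<le> t" "t \<le> T"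
  shows "integrable M (\<lambda>\<omega>. X h t \<omega> - \<pi> h t \<omega>)"
  by (intro Bochner_Integration.integrable_diff X_integrable pi_integrable assms)

lemma D_measurable:
  assumes h: "h \<in> {1..m}" shows "(\<lambda>z. \<bar>X h (fst z) (snd z) - \<pi> h (fst z) (snd z)\<bar>) \<in> borel_measurable P2"
proof -
  have "(\<lambda>z. \<pi> h (fst z) (snd z)) \<in> borel_measurable P2"
    using pi_jointly_measurable[OF h] by (simp add: case_prod_beta')
  then show ?thesis using X_jointly_measurable[OF h] by measurable
qed

lemma gap_measurable:
  assumes h: "h \<in> {1..m}" shows "gap h \<in> borel_measurable (leb T)"
proof -
  have "(\<lambda>(v, \<omega>). \<bar>X h v \<omega> - \<pi> h v \<omega>\<bar>) \<in> borel_measurable P2"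
    using D_measurable[OF h] by (simp add: case_prod_beta')
  then show ?thesis unfolding gap_def[abs_def] by (rule borel_measurable_lebesgue_integral)
qed

text \<open>Left limits agree with values almost everywhere, so by Fubini the bound on the expected
  error closes up in terms of \<open>gap\<close> itself.\<close>

lemma integral_D_left:
  assumes h: "h \<in> {1..m}" and t: "0 \<le> t" "t \<le> T"
  shows "(LINT z|P2. indicator {0<..t} (fst z) * \<bar>D_left h z\<bar>) = (LINT v:{0..t}|lborel. gap h v)"
proof -
  let ?D = "\<lambda>z. \<bar>X h (fst z) (snd z) - \<pi> h (fst z) (snd z)\<bar>"
  have ind: "(\<lambda>z. indicator {0<..t} (fst z) :: real) \<in> borel_measurable P2"
    by (rule measurable_compose[OF Pred_imp_P2[OF predictable_time[OF horizon filtration]]]) simp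
  have m: "(\<lambda>z. indicator {0<..t} (fst z) * ?D z) \<in> borel_measurable P2"
    by (intro borel_measurable_times ind D_measurable h)
  have int: "integrable P2 (\<lambda>z. indicator {0<..t} (fst z) * ?D z)"
  proof (rule integrable_P2_dominated[OF m])
    fix v \<omega> assume v: "0 \<le> v" "v \<le> T" "\<omega> \<in> space M"
    show "\<bar>indicator {0<..t} (fst (v, \<omega>)) * ?D (v, \<omega>)\<bar> \<le> 2 * dominating h \<omega>"
      using X_bound[OF h v(3,1,2)] filter_bounds[OF h v(3,1,2)] dominating_ge_1[of h \<omega>]
      unfolding dominating_def[symmetric] by (auto simp: indicator_def)
  qed
  have "(LINT z|P2. indicator {0<..t} (fst z) * \<bar>D_left h z\<bar>) = (LINT z|P2. indicator {0<..t} (fst z) * ?D z)"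
  proof (rule integral_cong_AE)
    show "(\<lambda>z. indicator {0<..t} (fst z) * \<bar>D_left h z\<bar>) \<in> borel_measurable P2"
      by (intro borel_measurable_times ind borel_measurable_abs PredG_imp_P2[OF D_left_measurable[OF h]])
    show "AE z in P2. indicator {0<..t} (fst z) * \<bar>D_left h z\<bar> = indicator {0<..t} (fst z) * ?D z"
      using AE_X_left[OF h] AE_pi_left[OF h] by eventually_elim (simp add: D_left_def)
  qed (rule m)
  also have "\<dots> = (LINT v|leb T. indicator {0<..t} v * gap h v)"
    using P2.integral_fst'[OF int] by (simp add: gap_def)
  also have "\<dots> = (LINT v:{0..t}|lborel. gap h v)"
    by (rule leb_integral_Ioc[symmetric]) (use t gap_measurable[OF h] in auto)
  finally show ?thesis .
qed

lemma gap_le: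
  assumes h: "h \<in> {1..m}" and t: "0 \<le> t" "t \<le> T"
  shows "gap h t \<le> 2 * total_rate * (LINT v:{0..t}|lborel. gap h v)"
\<comment> \<open>The bound on the expected error is stated for positive t only; at 0 the gap
  vanishes by the initial value of X.\<close>
proof (cases "t = 0")
  case True
  have "gap h 0 = (LINT \<omega>|M. 0)"
    unfolding gap_def by (rule Bochner_Integration.integral_cong) (auto simp: X_zero[OF h])
  then show ?thesis using True by (simp add: set_integral_singleton)
next
  case False
  then have t0: "0 < t" using t by simp
  let ?D = "\<lambda>\<omega>. X h t \<omega> - \<pi> h t \<omega>"
  let ?P = "{\<omega> \<in> space M. 0 < ?D \<omega>}" and ?N = "{\<omega> \<in> space M. ?D \<omega> < 0}"
  have D: "?D \<in> borel_measurable (G t)" by (intro borel_measurable_diff X_adapted filter_adapted h t)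
  have P: "?P \<in> sets (G t)" and N: "?N \<in> sets (G t)"
    using borel_measurable_less[OF borel_measurable_const[of 0] D]
      borel_measurable_less[OF D borel_measurable_const[of 0]] unfolding space_obs .
  note iP = indicator_mult_integrable[OF obs_measurable_M[OF P t] gap_integrable[OF h t]]
  note iN = indicator_mult_integrable[OF obs_measurable_M[OF N t] gap_integrable[OF h t]]
  have "gap h t = (LINT \<omega>|M. indicator ?P \<omega> * ?D \<omega> - indicator ?N \<omega> * ?D \<omega>)"
    unfolding gap_def by (rule Bochner_Integration.integral_cong) (auto simp: indicator_def)
  also have "\<dots> = (LINT \<omega>|M. indicator ?P \<omega> * err h t \<omega>) - (LINT \<omega>|M. indicator ?N \<omega> * err h t \<omega>)"
    unfolding Bochner_Integration.integral_diff[OF iP iN] expectation_err_eq[OF h t P] expectation_err_eq[OF h t N] ..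
  \<comment> \<open>One \<open>total_rate\<close> for each of the two events.\<close>
  also have "\<dots> \<le> 2 * total_rate * (LINT z|P2. indicator {0<..t} (fst z) * \<bar>D_left h z\<bar>)"
    using expectation_err_bound[OF h t0 t(2) P] expectation_err_bound[OF h t0 t(2) N] by linarith
  finally show ?thesis unfolding integral_D_left[OF h t] .
qed

lemma gap_zero:
  assumes h: "h \<in> {1..m}" and t: "0 \<le> t" "t \<le> T"
  shows "gap h t = 0"
proof (rule gronwall_zero[where u = "gap h" and t = t and T = T and C = "2 * total_rate" and B = "LINT \<omega>|M. 2 * dominating h \<omega>"])
  show "0 \<le> 2 * total_rate" using total_rate_nonneg by simp
  show "set_borel_measurable borel {0..T} (gap h)"
    using gap_measurable[OF h] unfolding set_borel_measurable_def
    by (subst (asm) borel_measurable_restrict_space_iff) auto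
  show "t \<in> {0..T}" using t by simp
  fix v assume v: "v \<in> {0..T}"
  show "gap h v \<le> 2 * total_rate * (LINT v:{0..v}|lborel. gap h v)" using gap_le[OF h] v by simp
  have "gap h v \<le> (LINT \<omega>|M. 2 * dominating h \<omega>)"
    unfolding gap_def
  proof (rule integral_mono)
    show "integrable M (\<lambda>\<omega>. \<bar>X h v \<omega> - \<pi> h v \<omega>\<bar>)" using gap_integrable[OF h] v by simp
    show "integrable M (\<lambda>\<omega>. 2 * dominating h \<omega>)" using dominating_integrable by simp
    show "\<bar>X h v \<omega> - \<pi> h v \<omega>\<bar> \<le> 2 * dominating h \<omega>" if "\<omega> \<in> space M" for \<omega>
      using X_bound[OF h that] filter_bounds[OF h that] dominating_ge_1[of h \<omega>] v
      unfolding dominating_def[symmetric] by (smt (verit) atLeastAtMost_iff)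
  qed
  then show "0 \<le> gap h v \<and> gap h v \<le> (LINT \<omega>|M. 2 * dominating h \<omega>)" by (simp add: gap_def)
qed

lemma X_eq_filter:
  assumes h: "h \<in> {1..m}" and t: "0 \<le> t" "t \<le> T"
  shows "AE \<omega> in M. X h t \<omega> = \<pi> h t \<omega>"
proof -
  have "AE \<omega> in M. \<bar>X h t \<omega> - \<pi> h t \<omega>\<bar> = 0"
    using gap_zero[OF assms] gap_integrable[OF assms] unfolding gap_def
    by (subst (asm) integral_nonneg_eq_0_iff_AE) auto
  then show ?thesis by eventually_elim simp
qed

text \<open>The exceptional null set of \<open>X_eq_filter\<close> depends on the time. The
  rationals and T give a common one, and right continuity of both sides does the rest.\<close>

theorem filter_equation:
  assumes h: "h \<in> {1..m}"
  shows "AE \<omega> in M. \<forall>t\<in>{0..T}. \<pi> h t \<omega> = X h t \<omega>"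
proof -
  have "AE \<omega> in M. \<forall>q\<in>\<rat> \<inter> {0..T}. X h q \<omega> = \<pi> h q \<omega>"
    by (rule AE_ball_countable[THEN iffD2]) (use X_eq_filter[OF h] countable_rat in \<open>auto intro: countable_Int1\<close>)
  moreover note X_eq_filter[OF h horizon order_refl]
  ultimately show ?thesis using AE_space
  proof eventually_elim
    case (elim \<omega>)
    show ?case
    proof
      fix t assume t: "t \<in> {0..T}"
      show "\<pi> h t \<omega> = X h t \<omega>"
      proof (cases "t = T")
        case False
        then have t': "0 \<le> t" "t < T" using t by auto
        have lim: "((\<lambda>v. X h v \<omega> - \<pi> h v \<omega>) \<longlongrightarrow> X h t \<omega> - \<pi> h t \<omega>) (at_right t)"
          by (intro tendsto_diff X_tendsto_right[OF h elim(3) t'])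
            (use filter_cadlag[OF h elim(3)] t' in \<open>simp add: cadlag_on_def\<close>)
        show ?thesis
        proof (rule ccontr)
          assume "\<pi> h t \<omega> \<noteq> X h t \<omega>"
          then have "\<forall>\<^sub>F v in at_right t. X h v \<omega> - \<pi> h v \<omega> \<noteq> 0"
            using tendsto_imp_eventually_ne[OF lim, of 0] by simp
          then obtain b where b: "b > t" "\<And>v. t < v \<Longrightarrow> v < b \<Longrightarrow> X h v \<omega> - \<pi> h v \<omega> \<noteq> 0"
            by (auto simp: eventually_at_right_field)
          obtain q where "q \<in> \<rat>" "t < q" "q < min b T"
            using Rats_dense_in_real[of t "min b T"] b(1) t' by auto
          then show False using b(2)[of q] elim(1) t' by auto
        qed
      qed (use elim(2) in simp)
    qed
  qed
qed

lemma gain_integral_eq: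
  assumes h: "h \<in> {1..m}" and e: "e \<in> E" and w: "\<omega> \<in> space M" and t: "0 \<le> t" "t \<le> T"
  shows "(LINT v:{0<..t}|interval_measure (\<lambda>w. real (jumps_upto (J e \<omega>) w)). gain h e v \<omega>)
    = jump_sum e (\<lambda>z. gain h e (fst z) (snd z)) t \<omega>"
proof -
  have "(\<lambda>v. gain h e v \<omega>) \<in> borel_measurable (leb T)"
    using path_measurable[OF PredG_imp_P2[OF gain_measurable[OF h]] w] by simp
  then have "(\<lambda>v. indicator {0..T} v *\<^sub>R gain h e v \<omega>) \<in> borel_measurable borel"
    by (subst (asm) borel_measurable_restrict_space_iff) auto
  then have "(\<lambda>v. indicator {0<..t} v * (indicator {0..T} v *\<^sub>R gain h e v \<omega>)) \<in> borel_measurable borel"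
    by measurable
  also have "(\<lambda>v. indicator {0<..t} v * (indicator {0..T} v *\<^sub>R gain h e v \<omega>)) = (\<lambda>v. indicator {0<..t} v * gain h e v \<omega>)"
    by (rule ext) (use t in \<open>auto simp: indicator_def\<close>)
  finally show ?thesis
    unfolding jump_sum_def fst_conv snd_conv
    by (intro integral_interval_measure_jumps finite_jumps[OF w e]) (use jump_times[OF w e] in auto)
qed

end

section \<open>The rating model\<close>

context hidden_factor_model
begin

section \<open>Rating jumps as counting processes with intensities\<close>

definition moves :: "(nat \<times> nat) set" where
  "moves = {(i, j). i \<in> {1..p} \<and> j \<in> {1..p} \<and> i \<noteq> j}"

definition jumps :: "nat \<times> nat \<Rightarrow> 'a \<Rightarrow> ('q \<times> real) set" where
  "jumps e \<omega> = {(q, v). q \<in> Q \<and> 0 < v \<and> s q \<le> v \<and> v < u q \<and>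
     left_lim (s q) (\<lambda>w. Z q w \<omega>) v = fst e \<and> Z q v \<omega> = snd e}"

abbreviation obs :: "real \<Rightarrow> 'a measure" where
  "obs \<equiv> observed_filtration M p (jump_count Q s u Z)"

definition rate :: "nat \<Rightarrow> nat \<Rightarrow> real \<Rightarrow> 'a \<Rightarrow> real" where
  "rate i j t \<omega> = exposure Q s u Z i t \<omega> * (\<Sum>r=1..m. ell r i j * of_bool (left_lim 0 (\<lambda>w. \<Theta> w \<omega>) t = r))"

lemma movesD: "(i, j) \<in> moves \<Longrightarrow> i \<in> {1..p} \<and> j \<in> {1..p} \<and> i \<noteq> j"
  by (simp add: moves_def)

lemma finite_moves: "finite moves"
  by (rule finite_subset[of _ "{1..p} \<times> {1..p}"]) (auto simp: moves_def)

lemma ratings_cadlag: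
  assumes "q \<in> Q" "\<omega> \<in> space M"
  shows "cadlag_on (s q) (u q) (\<lambda>t. Z q t \<omega>)"
proof -
  note d = bspec[OF ratings_chain assms(1), unfolded markov_chain_on_def]
  show ?thesis by (rule conjunct2[OF bspec[OF conjunct1[OF conjunct2[OF d]] assms(2)]])
qed

lemma factor_facts:
  shows "\<And>t. 0 \<le> t \<Longrightarrow> t \<le> T \<Longrightarrow> \<Theta> t \<in> measurable (F t) (count_space UNIV)"
    and "\<And>t \<omega>. 0 \<le> t \<Longrightarrow> t \<le> T \<Longrightarrow> \<omega> \<in> space M \<Longrightarrow> \<Theta> t \<omega> \<in> {1..m}"
    and "\<And>\<omega>. \<omega> \<in> space M \<Longrightarrow> cadlag_on 0 T (\<lambda>t. \<Theta> t \<omega>)"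
proof -
  note d = factor_chain[unfolded markov_chain_on_def]
  show "\<Theta> t \<in> measurable (F t) (count_space UNIV)" if "0 \<le> t" "t \<le> T" for t
    by (rule bspec[OF conjunct1[OF d]]) (use that in simp)
  show "\<Theta> t \<omega> \<in> {1..m}" if "0 \<le> t" "t \<le> T" "\<omega> \<in> space M" for t \<omega>
    by (rule bspec[OF conjunct1[OF bspec[OF conjunct1[OF conjunct2[OF d]] that(3)]]]) (use that in simp)
  show "cadlag_on 0 T (\<lambda>t. \<Theta> t \<omega>)" if "\<omega> \<in> space M" for \<omega>
    by (rule conjunct2[OF bspec[OF conjunct1[OF conjunct2[OF d]] that]])
qed

lemma jumps_sections_finite:
  assumes "q \<in> Q" "\<omega> \<in> space M" "i \<noteq> j"
  shows "finite {v. s q \<le> v \<and> v < u q \<and> left_lim (s q) (\<lambda>w. Z q w \<omega>) v = i \<and> Z q v \<omega> = j}"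
proof (rule finite_subset[OF _ cadlag_on_nat_finite_jumps[OF ratings_cadlag[OF assms(1,2)]]])
  \<comment> \<open>At the start of the observation period \<open>left_lim\<close> is the value
    itself, so with i and j distinct no jump can sit there.\<close>
  have "s q < v" if "s q \<le> v" "left_lim (s q) (\<lambda>w. Z q w \<omega>) v = i" "Z q v \<omega> = j" for v
    using that assms(3) by (cases "v = s q") (auto simp: left_lim_def)
  then show "{v. s q \<le> v \<and> v < u q \<and> left_lim (s q) (\<lambda>w. Z q w \<omega>) v = i \<and> Z q v \<omega> = j}
     \<subseteq> {v \<in> {s q<..u q}. left_lim (s q) (\<lambda>w. Z q w \<omega>) v \<noteq> Z q v \<omega>}"
    using assms(3) by auto
qed

lemma finite_jumps_moves:
  assumes "\<omega> \<in> space M" "e \<in> moves" shows "finite (jumps e \<omega>)"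
proof (rule finite_subset)
  have ne: "fst e \<noteq> snd e" using assms(2) by (auto simp: moves_def)
  show "finite (SIGMA q:Q. {v. s q \<le> v \<and> v < u q \<and> left_lim (s q) (\<lambda>w. Z q w \<omega>) v = fst e \<and> Z q v \<omega> = snd e})"
    by (rule finite_SigmaI[OF finite_bonds]) (rule jumps_sections_finite[OF _ assms(1) ne])
  show "jumps e \<omega> \<subseteq> (SIGMA q:Q. {v. s q \<le> v \<and> v < u q \<and> left_lim (s q) (\<lambda>w. Z q w \<omega>) v = fst e \<and> Z q v \<omega> = snd e})"
    by (auto simp: jumps_def)
qed

lemma jump_count_eq:
  assumes w: "\<omega> \<in> space M" and e: "(i, j) \<in> moves"
  shows "jump_count Q s u Z i j t \<omega> = jumps_upto (jumps (i, j) \<omega>) t"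
proof -
  let ?V = "\<lambda>q. {v\<in>{0<..t}. s q \<le> v \<and> v < u q \<and> left_lim (s q) (\<lambda>w. Z q w \<omega>) v = i \<and> Z q v \<omega> = j}"
  have fin: "finite (?V q)" if "q \<in> Q" for q
    by (rule finite_subset[OF _ jumps_sections_finite[OF that w, of i j]]) (use movesD[OF e] in auto)
  have "{x \<in> jumps (i, j) \<omega>. snd x \<le> t} = (SIGMA q:Q. ?V q)"
    by (auto simp: jumps_def)
  then have "jumps_upto (jumps (i, j) \<omega>) t = card (SIGMA q:Q. ?V q)" by (simp only: jumps_upto_def)
  also have "\<dots> = (\<Sum>q\<in>Q. card (?V q))"
    by (rule card_SigmaI[OF finite_bonds]) (use fin in blast)
  finally show ?thesis unfolding jump_count_def by simp
qed

lemma jump_times_moves: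
  assumes "x \<in> jumps e \<omega>" shows "0 < snd x \<and> snd x \<le> T"
  using assms observation by (force simp: jumps_def)

lemma model_filtration: "filtration_on M T F" and null_sets_F: "null_sets M \<subseteq> sets (F 0)"
  and model_complete: "complete_measure M"
proof -
  note d = usual[unfolded usual_conditions_def]
  show "complete_measure M" by (rule conjunct1[OF d])
  show "filtration_on M T F" unfolding filtration_on_def
    by (rule conjI[OF conjunct1[OF conjunct2[OF d]] conjunct1[OF conjunct2[OF conjunct2[OF d]]]])
  show "null_sets M \<subseteq> sets (F 0)"
    by (rule conjunct1[OF conjunct2[OF conjunct2[OF conjunct2[OF d]]]])
qed

lemma exposure_range: "0 \<le> exposure Q s u Z i t \<omega> \<and> exposure Q s u Z i t \<omega> \<le> real (card Q)"
  unfolding exposure_def using finite_bonds by (auto intro!: card_mono)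

lemma intensity_facts:
  assumes e: "(i, j) \<in> moves"
  shows "(\<lambda>(t, \<omega>). rate i j t \<omega>) \<in> borel_measurable (predictable_sigma M T F)"
    and "\<And>\<omega>. \<omega> \<in> space M \<Longrightarrow> set_integrable lborel {0..T} (\<lambda>t. rate i j t \<omega>)"
    and "\<And>\<omega> t. \<omega> \<in> space M \<Longrightarrow> 0 \<le> t \<Longrightarrow> t \<le> T \<Longrightarrow> 0 \<le> rate i j t \<omega>"
    and "\<And>t. 0 \<le> t \<Longrightarrow> t \<le> T \<Longrightarrow>
      (\<lambda>\<omega>. real (jump_count Q s u Z i j t \<omega>) - (LINT v:{0..t}|lborel. rate i j v \<omega>)) \<in> borel_measurable (F t)"
    and "\<And>t. 0 \<le> t \<Longrightarrow> t \<le> T \<Longrightarrow>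
      integrable M (\<lambda>\<omega>. real (jump_count Q s u Z i j t \<omega>) - (LINT v:{0..t}|lborel. rate i j v \<omega>))"
    and "\<And>v t. 0 \<le> v \<Longrightarrow> v \<le> t \<Longrightarrow> t \<le> T \<Longrightarrow>
      AE \<omega> in M. real_cond_exp M (F v) (\<lambda>\<omega>. real (jump_count Q s u Z i j t \<omega>) - (LINT v:{0..t}|lborel. rate i j v \<omega>)) \<omega>
        = real (jump_count Q s u Z i j v \<omega>) - (LINT v:{0..v}|lborel. rate i j v \<omega>)"
proof -
  have hi: "has_intensity M T F (jump_count Q s u Z i j) (\<lambda>t \<omega>. rate i j t \<omega>)"
    using intensity movesD[OF e] unfolding rate_def by simp
  note d = hi[unfolded has_intensity_def predictable_def martingale_on_def]
  note d1 = conjunct1[OF d] and d2 = conjunct1[OF conjunct2[OF d]]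
    and d3 = conjunct1[OF conjunct2[OF conjunct2[OF d]]] and d4 = conjunct2[OF conjunct2[OF conjunct2[OF d]]]
  show "(\<lambda>(t, \<omega>). rate i j t \<omega>) \<in> borel_measurable (predictable_sigma M T F)" by (rule d1)
  show "set_integrable lborel {0..T} (\<lambda>t. rate i j t \<omega>)" if "\<omega> \<in> space M" for \<omega>
    by (rule conjunct2[OF bspec[OF d2 that]])
  show "0 \<le> rate i j t \<omega>" if "\<omega> \<in> space M" "0 \<le> t" "t \<le> T" for \<omega> t
    by (rule bspec[OF conjunct1[OF bspec[OF d2 that(1)]]]) (use that in simp)
  show "(\<lambda>\<omega>. real (jump_count Q s u Z i j t \<omega>) - (LINT v:{0..t}|lborel. rate i j v \<omega>)) \<in> borel_measurable (F t)"
    if "0 \<le> t" "t \<le> T" for t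
    by (rule conjunct1[OF bspec[OF d3]]) (use that in simp)
  show "integrable M (\<lambda>\<omega>. real (jump_count Q s u Z i j t \<omega>) - (LINT v:{0..t}|lborel. rate i j v \<omega>))"
    if "0 \<le> t" "t \<le> T" for t
    by (rule conjunct2[OF bspec[OF d3]]) (use that in simp)
  show "AE \<omega> in M. real_cond_exp M (F v) (\<lambda>\<omega>. real (jump_count Q s u Z i j t \<omega>) - (LINT v:{0..t}|lborel. rate i j v \<omega>)) \<omega>
        = real (jump_count Q s u Z i j v \<omega>) - (LINT v:{0..v}|lborel. rate i j v \<omega>)"
    if "0 \<le> v" "v \<le> t" "t \<le> T" for v t
    by (rule bspec[OF bspec[OF d4]]) (use that in auto)
qed

lemma rate_le:
  assumes "(i, j) \<in> moves" shows "rate i j t \<omega> \<le> real (card Q) * (\<Sum>r=1..m. \<bar>ell r i j\<bar>)"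
proof -
  have "(\<Sum>r=1..m. ell r i j * of_bool (left_lim 0 (\<lambda>w. \<Theta> w \<omega>) t = r)) \<le> (\<Sum>r=1..m. \<bar>ell r i j\<bar>)"
    by (rule sum_mono) auto
  then have "rate i j t \<omega> \<le> exposure Q s u Z i t \<omega> * (\<Sum>r=1..m. \<bar>ell r i j\<bar>)"
    unfolding rate_def using exposure_range by (intro mult_left_mono) auto
  also have "\<dots> \<le> real (card Q) * (\<Sum>r=1..m. \<bar>ell r i j\<bar>)"
    using exposure_range by (intro mult_right_mono) (auto intro: sum_nonneg)
  finally show ?thesis .
qed

lemma compensator_measurable:
  assumes "(i, j) \<in> moves" "0 \<le> t" "t \<le> T"
  shows "(\<lambda>\<omega>. LINT v:{0..t}|lborel. rate i j v \<omega>) \<in> borel_measurable (F t)"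
  using progressive_integral_measurable[OF horizon model_filtration assms(2,3) intensity_facts(1)[OF assms(1)]] by simp

lemma rate_set_integrable:
  assumes "(i, j) \<in> moves" "\<omega> \<in> space M" "0 \<le> v" "t \<le> T"
  shows "set_integrable lborel {v..t} (\<lambda>t. rate i j t \<omega>)"
  by (rule set_integrable_subset[OF intensity_facts(2)[OF assms(1,2)]]) (use assms in auto)

lemma compensator_integrable:
  assumes e: "(i, j) \<in> moves" and t: "0 \<le> t" "t \<le> T"
  shows "integrable M (\<lambda>\<omega>. LINT v:{0..t}|lborel. rate i j v \<omega>)"
proof (rule integrable_const_bound)
  let ?B = "real (card Q) * (\<Sum>r=1..m. \<bar>ell r i j\<bar>)"
  show "(\<lambda>\<omega>. LINT v:{0..t}|lborel. rate i j v \<omega>) \<in> borel_measurable M"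
    by (rule filtration_on_measurable[OF model_filtration t compensator_measurable[OF e t]])
  show "AE \<omega> in M. norm (LINT v:{0..t}|lborel. rate i j v \<omega>) \<le> ?B * t"
  proof (rule AE_I2)
    fix \<omega> assume w: "\<omega> \<in> space M"
    have "0 \<le> (LINT v:{0..t}|lborel. rate i j v \<omega>)"
      unfolding set_lebesgue_integral_def
      by (rule Bochner_Integration.integral_nonneg) (use intensity_facts(3)[OF e w] t in \<open>auto simp: indicator_def\<close>)
    moreover have "(LINT v:{0..t}|lborel. rate i j v \<omega>) \<le> (LINT v:{0..t}|lborel. ?B)"
    proof (rule set_integral_mono)
      show "set_integrable lborel {0..t} (\<lambda>v. rate i j v \<omega>)" by (rule rate_set_integrable[OF e w order_refl t(2)])
      show "set_integrable lborel {0..t} (\<lambda>v. ?B)" by (intro borel_integrable_atLeastAtMost' continuous_on_const)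
    qed (rule rate_le[OF e])
    moreover have "(LINT v:{0..t}|lborel. ?B) = ?B * t" using t by (simp add: set_lebesgue_integral_def)
    ultimately show "norm (LINT v:{0..t}|lborel. rate i j v \<omega>) \<le> ?B * t"
      unfolding real_norm_def by linarith
  qed
qed

text \<open>The count is its martingale part plus its compensator, and both are adapted. This avoids
  a measurability argument for the jumps of the rating paths.\<close>

lemma jump_count_F_measurable:
  assumes e: "(i, j) \<in> moves" and t: "0 \<le> t" "t \<le> T"
  shows "(\<lambda>\<omega>. real (jump_count Q s u Z i j t \<omega>)) \<in> borel_measurable (F t)"
  using borel_measurable_add[OF intensity_facts(4)[OF e t] compensator_measurable[OF e t]] by simp

lemma jump_count_integrable:
  assumes e: "(i, j) \<in> moves" and t: "0 \<le> t" "t \<le> T"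
  shows "integrable M (\<lambda>\<omega>. real (jump_count Q s u Z i j t \<omega>))"
  using Bochner_Integration.integrable_add[OF intensity_facts(5)[OF e t] compensator_integrable[OF e t]] by simp

text \<open>The martingale property integrated over an event of the past: the form in which
  \<open>counting_filter\<close> takes the intensity.\<close>

lemma jump_count_intensity:
  assumes e: "(i, j) \<in> moves" and t: "0 \<le> v" "v \<le> t" "t \<le> T" and A: "A \<in> sets (F v)"
  shows "(LINT \<omega>|M. indicator A \<omega> * (real (jump_count Q s u Z i j t \<omega>) - real (jump_count Q s u Z i j v \<omega>)))
    = (LINT \<omega>|M. indicator A \<omega> * (LINT x:{v..t}|lborel. rate i j x \<omega>))"
proof -
  let ?C = "\<lambda>t \<omega>. LINT x:{0..t}|lborel. rate i j x \<omega>"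
  let ?N = "\<lambda>t \<omega>. real (jump_count Q s u Z i j t \<omega>)"
  let ?M = "\<lambda>t \<omega>. ?N t \<omega> - ?C t \<omega>"
  have v: "v \<le> T" "0 \<le> t" using t by auto
  have AM: "A \<in> sets M" using A filtration_onD(4)[OF model_filtration t(1) v(1)] by auto
  have ind: "(indicator A :: 'a \<Rightarrow> real) \<in> borel_measurable (F v)" using A by simp
  have int: "integrable M (\<lambda>\<omega>. indicator A \<omega> * f \<omega> :: real)" if "integrable M f" for f
    using integrable_mult_indicator[OF AM that] by simp
  interpret sub: finite_measure_subalgebra M "F v"
    by unfold_locales (rule filtration_onD(1)[OF model_filtration t(1) v(1)])
  note iM = int[OF intensity_facts(5)[OF e v(2) t(3)]] and iMv = int[OF intensity_facts(5)[OF e t(1) v(1)]]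
  have Mm: "?M v \<in> borel_measurable M"
    by (rule borel_measurable_integrable[OF intensity_facts(5)[OF e t(1) v(1)]])
  have "(LINT \<omega>|M. indicator A \<omega> * ?M t \<omega>) = (LINT \<omega>|M. indicator A \<omega> * real_cond_exp M (F v) (?M t) \<omega>)"
    by (rule sub.real_cond_exp_intg(2)[OF iM ind, symmetric])
      (rule borel_measurable_integrable[OF intensity_facts(5)[OF e v(2) t(3)]])
  also have "\<dots> = (LINT \<omega>|M. indicator A \<omega> * ?M v \<omega>)"
  proof (rule integral_cong_AE)
    show "AE \<omega> in M. indicator A \<omega> * real_cond_exp M (F v) (?M t) \<omega> = indicator A \<omega> * ?M v \<omega>"
      using intensity_facts(6)[OF e t] by eventually_elim (simp only:)
  qed (use AM Mm in auto)
  finally have mart: "(LINT \<omega>|M. indicator A \<omega> * ?M t \<omega>) = (LINT \<omega>|M. indicator A \<omega> * ?M v \<omega>)" .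
  note iC = compensator_integrable[OF e]
  have "(LINT \<omega>|M. indicator A \<omega> * (?N t \<omega> - ?N v \<omega>))
    = (LINT \<omega>|M. (indicator A \<omega> * ?M t \<omega> - indicator A \<omega> * ?M v \<omega>) + indicator A \<omega> * (?C t \<omega> - ?C v \<omega>))"
    by (rule Bochner_Integration.integral_cong) (auto simp: algebra_simps)
  also have "\<dots> = ((LINT \<omega>|M. indicator A \<omega> * ?M t \<omega>) - (LINT \<omega>|M. indicator A \<omega> * ?M v \<omega>))
     + (LINT \<omega>|M. indicator A \<omega> * (?C t \<omega> - ?C v \<omega>))"
    by (subst Bochner_Integration.integral_add[OF Bochner_Integration.integrable_diff[OF iM iMv]
          int[OF Bochner_Integration.integrable_diff[OF iC[OF v(2) t(3)] iC[OF t(1) v(1)]]]],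
        subst Bochner_Integration.integral_diff[OF iM iMv], rule refl)
  also have "\<dots> = (LINT \<omega>|M. indicator A \<omega> * (?C t \<omega> - ?C v \<omega>))" using mart by simp
  also have "\<dots> = (LINT \<omega>|M. indicator A \<omega> * (LINT x:{v..t}|lborel. rate i j x \<omega>))"
  proof (rule Bochner_Integration.integral_cong[OF refl])
    fix \<omega> assume w: "\<omega> \<in> space M"
    note si = rate_set_integrable[OF e w]
    have "integral {0..v} (\<lambda>x. rate i j x \<omega>) + integral {v..t} (\<lambda>x. rate i j x \<omega>) = integral {0..t} (\<lambda>x. rate i j x \<omega>)"
      by (rule Henstock_Kurzweil_Integration.integral_combine[OF t(1,2)])
        (rule set_borel_integral_eq_integral(1)[OF si[OF order_refl t(3)]])
    then have "?C t \<omega> - ?C v \<omega> = (LINT x:{v..t}|lborel. rate i j x \<omega>)"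
      using set_borel_integral_eq_integral(2)[OF si[OF order_refl t(3)]]
        set_borel_integral_eq_integral(2)[OF si[OF order_refl v(1)]]
        set_borel_integral_eq_integral(2)[OF si[OF t(1,3)]] by simp
    then show "indicator A \<omega> * (?C t \<omega> - ?C v \<omega>) = indicator A \<omega> * (LINT x:{v..t}|lborel. rate i j x \<omega>)" by simp
  qed
  finally show ?thesis .
qed

section \<open>The observed filtration and the exclusion of common jumps\<close>

definition obs_generators :: "real \<Rightarrow> 'a set set" where
  "obs_generators t = {(\<lambda>\<omega>. jumps_upto (jumps e \<omega>) v) -` B \<inter> space M | e v B. e \<in> moves \<and> 0 \<le> v \<and> v \<le> t} \<union> null_sets M"

lemma null_sets_Pow: "null_sets M \<subseteq> Pow (space M)"
  using sets.sets_into_space null_setsD2 by blast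

lemma space_obs_eq: "space (obs t) = space M"
  unfolding observed_filtration_def by (rule space_measure_of) (use null_sets_Pow in blast)

lemma sets_obs_eq: "sets (obs t) = sigma_sets (space M) (obs_generators t)"
proof -
  let ?g = "{jump_count Q s u Z i j v -` B \<inter> space M | i j v B. i \<in> {1..p} \<and> j \<in> {1..p} \<and> i \<noteq> j \<and> v \<in> {0..t}}"
  have pre: "jump_count Q s u Z i j v -` B \<inter> space M = (\<lambda>\<omega>. jumps_upto (jumps (i, j) \<omega>) v) -` B \<inter> space M"
    if "(i, j) \<in> moves" for i j v B
    using jump_count_eq[OF _ that] by auto
  have "?g = {(\<lambda>\<omega>. jumps_upto (jumps e \<omega>) v) -` B \<inter> space M | e v B. e \<in> moves \<and> 0 \<le> v \<and> v \<le> t}"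
  proof (rule set_eqI, rule iffI)
    fix S assume "S \<in> ?g"
    then obtain i j v B where S: "S = jump_count Q s u Z i j v -` B \<inter> space M"
      and ij: "(i, j) \<in> moves" and v: "0 \<le> v" "v \<le> t" by (auto simp: moves_def)
    then show "S \<in> {(\<lambda>\<omega>. jumps_upto (jumps e \<omega>) v) -` B \<inter> space M | e v B. e \<in> moves \<and> 0 \<le> v \<and> v \<le> t}"
      unfolding S pre[OF ij] by blast
  next
    fix S assume "S \<in> {(\<lambda>\<omega>. jumps_upto (jumps e \<omega>) v) -` B \<inter> space M | e v B. e \<in> moves \<and> 0 \<le> v \<and> v \<le> t}"
    then obtain e v B where S: "S = (\<lambda>\<omega>. jumps_upto (jumps e \<omega>) v) -` B \<inter> space M"
      and e: "e \<in> moves" and v: "0 \<le> v" "v \<le> t" by blast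
    obtain i j where ij: "e = (i, j)" by (cases e)
    have "S = jump_count Q s u Z i j v -` B \<inter> space M" unfolding S ij using pre e ij by simp
    moreover have "i \<in> {1..p} \<and> j \<in> {1..p} \<and> i \<noteq> j \<and> v \<in> {0..t}" using movesD e ij v by simp
    ultimately show "S \<in> ?g" by blast
  qed
  moreover have "obs_generators t \<subseteq> Pow (space M)"
    unfolding obs_generators_def using null_sets_Pow by blast
  ultimately show ?thesis
    unfolding observed_filtration_def obs_generators_def by simp
qed

lemma obs_sub_F:
  assumes t: "0 \<le> t" "t \<le> T" shows "sets (obs t) \<subseteq> sets (F t)"
proof -
  have sp: "space (F t) = space M" by (rule filtration_onD(2)[OF model_filtration t])
  have "obs_generators t \<subseteq> sets (F t)"
  proof
    fix S assume "S \<in> obs_generators t"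
    then consider (null) "S \<in> null_sets M"
      | (count) e v B where "S = (\<lambda>\<omega>. jumps_upto (jumps e \<omega>) v) -` B \<inter> space M" "e \<in> moves" "0 \<le> v" "v \<le> t"
      unfolding obs_generators_def by blast
    then show "S \<in> sets (F t)"
    proof cases
      case null
      then show ?thesis using null_sets_F filtration_onD(3)[OF model_filtration order_refl t] by blast
    next
      case count
      obtain i j where ij: "e = (i, j)" by (cases e)
      have m: "(\<lambda>\<omega>. real (jump_count Q s u Z i j v \<omega>)) \<in> borel_measurable (F t)"
        by (rule filtration_on_measurable_mono[OF model_filtration count(3,4) t(2) jump_count_F_measurable])
          (use count t ij in auto)
      have "real ` B \<in> sets borel" by (rule sets.countable) auto
      from measurable_sets[OF m this]
      have "(\<lambda>\<omega>. real (jump_count Q s u Z i j v \<omega>)) -` (real ` B) \<inter> space M \<in> sets (F t)" by (simp add: sp)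
      also have "(\<lambda>\<omega>. real (jump_count Q s u Z i j v \<omega>)) -` (real ` B) \<inter> space M = S"
        unfolding count(1) ij using jump_count_eq count(2) ij by auto
      finally show ?thesis .
    qed
  qed
  then show ?thesis unfolding sets_obs_eq sp[symmetric] by (rule sets.sigma_sets_subset)
qed

lemma obs_filtration_on: "filtration_on M T obs"
  unfolding filtration_on_def subalgebra_def
proof (intro conjI ballI)
  show "space (obs t) = space M" for t by (rule space_obs_eq)
  show "sets (obs t) \<subseteq> sets M" if "t \<in> {0..T}" for t
    using obs_sub_F[of t] filtration_onD(4)[OF model_filtration, of t] that by auto
  show "sets (obs v) \<subseteq> sets (obs t)" if "v \<in> {0..T}" "t \<in> {v..T}" for v t
  proof -
    have "obs_generators v \<subseteq> obs_generators t"
      unfolding obs_generators_def using that by fastforce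
    then show ?thesis unfolding sets_obs_eq by (rule sigma_sets_mono')
  qed
qed

lemma null_sets_obs: "null_sets M \<subseteq> sets (obs t)"
  unfolding sets_obs_eq obs_generators_def by (auto intro: sigma_sets.Basic)

text \<open>Jumps at the same time must belong to the same bond, and the path of that bond then
  determines the type.\<close>

lemma no_simultaneous_moves:
  "AE \<omega> in M. \<forall>e\<in>moves. \<forall>e'\<in>moves. \<forall>x\<in>jumps e \<omega>. \<forall>x'\<in>jumps e' \<omega>. snd x = snd x' \<longrightarrow> e = e' \<and> x = x'"
  using no_simultaneous_rating_jumps
proof eventually_elim
  case (elim \<omega>)
  show ?case
  proof (intro ballI impI)
    fix e e' x x' assume e: "e \<in> moves" "e' \<in> moves" and x: "x \<in> jumps e \<omega>" "x' \<in> jumps e' \<omega>" and eq: "snd x = snd x'"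
    obtain q v where qv: "x = (q, v)" by (cases x)
    obtain q' where qv': "x' = (q', v)" using eq qv by (cases x') simp
    have a: "q \<in> Q" "s q \<le> v" "v < u q" "left_lim (s q) (\<lambda>w. Z q w \<omega>) v = fst e" "Z q v \<omega> = snd e"
      using x(1) by (auto simp: jumps_def qv)
    have b: "q' \<in> Q" "s q' \<le> v" "v < u q'" "left_lim (s q') (\<lambda>w. Z q' w \<omega>) v = fst e'" "Z q' v \<omega> = snd e'"
      using x(2) by (auto simp: jumps_def qv')
    have ne: "fst e \<noteq> snd e" "fst e' \<noteq> snd e'" using e by (auto simp: moves_def)
    have "q = q'"
    proof (rule ccontr)
      assume "q \<noteq> q'"
      moreover have "v \<in> {s q..u q} \<inter> {s q'..u q'}" using a b by simp
      ultimately have "left_lim (s q) (\<lambda>w. Z q w \<omega>) v = Z q v \<omega> \<or> left_lim (s q') (\<lambda>w. Z q' w \<omega>) v = Z q' v \<omega>"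
        using elim a(1) b(1) by blast
      then show False using a b ne by simp
    qed
    then show "e = e' \<and> x = x'" using a b by (simp add: qv qv' prod_eq_iff)
  qed
qed

text \<open>\<open>no_common_jumps\<close> speaks of the counting path. Just before a jump time the
  count misses at least that jump, so its left limit is strictly below its value and the other
  alternative must hold.\<close>

lemma no_common_moves:
  "AE \<omega> in M. \<forall>e\<in>moves. \<forall>x\<in>jumps e \<omega>. left_lim 0 (\<lambda>w. \<Theta> w \<omega>) (snd x) = \<Theta> (snd x) \<omega>"
  using no_common_jumps AE_space
proof eventually_elim
  case (elim \<omega>)
  show ?case
  proof (intro ballI)
    fix e x assume e: "e \<in> moves" and x: "x \<in> jumps e \<omega>"
    obtain i j where ij: "e = (i, j)" by (cases e)
    let ?t = "snd x"
    have t: "0 < ?t" "?t \<le> T" using jump_times_moves[OF x] by auto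
    have fin: "finite (jumps e \<omega>)" by (rule finite_jumps_moves[OF elim(2) e])
    have cnt: "jump_count Q s u Z i j v \<omega> = jumps_upto (jumps e \<omega>) v" for v
      using jump_count_eq[OF elim(2), of i j v] e ij by simp
    have "\<forall>\<^sub>F v in at_left ?t. \<forall>y\<in>{y\<in>jumps e \<omega>. snd y < ?t}. snd y \<le> v"
    proof (rule eventually_ball_finite)
      show "finite {y\<in>jumps e \<omega>. snd y < ?t}" using fin by auto
      show "\<forall>y\<in>{y \<in> jumps e \<omega>. snd y < ?t}. \<forall>\<^sub>F v in at_left ?t. snd y \<le> v"
        by (auto simp: eventually_at_left_field intro!: exI)
    qed
    moreover have "\<forall>\<^sub>F v in at_left ?t. v < ?t" by (simp add: eventually_at_filter)
    ultimately have "\<forall>\<^sub>F v in at_left ?t. jump_count Q s u Z i j v \<omega> = card {y\<in>jumps e \<omega>. snd y < ?t}"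
    proof eventually_elim
      case (elim v)
      then have "{y\<in>jumps e \<omega>. snd y \<le> v} = {y\<in>jumps e \<omega>. snd y < ?t}" by force
      then show ?case unfolding cnt jumps_upto_def by (simp only:)
    qed
    then have "((\<lambda>v. jump_count Q s u Z i j v \<omega>) \<longlongrightarrow> card {y\<in>jumps e \<omega>. snd y < ?t}) (at_left ?t)"
      by (rule tendsto_eventually)
    then have "left_lim 0 (\<lambda>v. jump_count Q s u Z i j v \<omega>) ?t = card {y\<in>jumps e \<omega>. snd y < ?t}"
      using t by (simp add: left_lim_def tendsto_Lim)
    moreover have "card {y\<in>jumps e \<omega>. snd y < ?t} < card {y\<in>jumps e \<omega>. snd y \<le> ?t}"
      by (rule psubset_card_mono) (use fin x in auto)
    ultimately have "left_lim 0 (\<lambda>v. jump_count Q s u Z i j v \<omega>) ?t \<noteq> jump_count Q s u Z i j ?t \<omega>"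
      unfolding cnt jumps_upto_def by simp
    then show "left_lim 0 (\<lambda>w. \<Theta> w \<omega>) ?t = \<Theta> ?t \<omega>"
      using elim(1) movesD[of i j] e ij t by (metis atLeastAtMost_iff less_imp_le)
  qed
qed

text \<open>The given versions of the filter are cadlag and \<open>[0, 1]\<close>-valued only almost surely.\<close>

definition regular :: "(nat \<Rightarrow> real \<Rightarrow> 'a \<Rightarrow> real) \<Rightarrow> 'a \<Rightarrow> bool" where
  "regular Ihat \<omega> \<longleftrightarrow> (\<forall>h\<in>{1..m}. cadlag_on 0 T (\<lambda>t. Ihat h t \<omega>) \<and> (\<forall>t\<in>{0..T}. Ihat h t \<omega> \<in> {0..1}))"

definition regularized :: "(nat \<Rightarrow> real \<Rightarrow> 'a \<Rightarrow> real) \<Rightarrow> nat \<Rightarrow> real \<Rightarrow> 'a \<Rightarrow> real" where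
  "regularized Ihat h t \<omega> = (if regular Ihat \<omega> then Ihat h t \<omega> else 0)"

text \<open>At each fixed time a conditional expectation of an indicator lies in [0, 1] almost
  surely. The rationals and T are countably many times, and \<open>cadlag_on_rational_bounds\<close>
  extends the range to all times.\<close>

lemma AE_regular:
  assumes Ihat: "\<And>h. h \<in> {1..m} \<Longrightarrow> filtered_indicator M T obs \<Theta> h (Ihat h)"
  shows "AE \<omega> in M. regular Ihat \<omega>"
proof -
  have range: "AE \<omega> in M. Ihat h t \<omega> \<in> {0..1}" if h: "h \<in> {1..m}" and t: "0 \<le> t" "t \<le> T" for h t
  proof -
    interpret sub: finite_measure_subalgebra M "obs t"
      by unfold_locales (rule filtration_onD(1)[OF obs_filtration_on t])
    have Im: "(\<lambda>\<omega>. of_bool (\<Theta> t \<omega> = h) :: real) \<in> borel_measurable M"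
      by (rule measurable_compose[OF filtration_on_measurable[OF model_filtration t factor_facts(1)[OF t]]]) simp
    have int: "integrable M (\<lambda>\<omega>. of_bool (\<Theta> t \<omega> = h) :: real)"
      by (rule integrable_const_bound[of _ 1]) (use Im in auto)
    have "AE \<omega> in M. 0 \<le> real_cond_exp M (obs t) (\<lambda>\<omega>. of_bool (\<Theta> t \<omega> = h)) \<omega>"
      by (rule sub.real_cond_exp_ge_c[OF int]) simp
    moreover have "AE \<omega> in M. real_cond_exp M (obs t) (\<lambda>\<omega>. of_bool (\<Theta> t \<omega> = h)) \<omega> \<le> 1"
      by (rule sub.real_cond_exp_le_c[OF int]) simp
    moreover have "AE \<omega> in M. Ihat h t \<omega> = real_cond_exp M (obs t) (\<lambda>\<omega>'. of_bool (\<Theta> t \<omega>' = h)) \<omega>"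
      using Ihat[OF h] t unfolding filtered_indicator_def by simp
    ultimately show ?thesis by eventually_elim simp
  qed
  have "AE \<omega> in M. \<forall>h\<in>{1..m}. \<forall>q\<in>insert T (\<rat> \<inter> {0..T}). Ihat h q \<omega> \<in> {0..1}"
    by (intro AE_ball_countable[THEN iffD2] ballI range countable_insert countable_Int1 countable_rat countable_finite)
      (use horizon in auto)
  moreover have "AE \<omega> in M. \<forall>h\<in>{1..m}. cadlag_on 0 T (\<lambda>t. Ihat h t \<omega>)"
    by (intro AE_ball_countable[THEN iffD2] ballI countable_finite)
      (use Ihat in \<open>auto simp: filtered_indicator_def\<close>)
  ultimately show ?thesis
  proof eventually_elim
    case (elim \<omega>)
    show ?case unfolding regular_def
    proof (intro ballI conjI)
      fix h assume h: "h \<in> {1..m}"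
      show cad: "cadlag_on 0 T (\<lambda>t. Ihat h t \<omega>)" using elim(2) h by blast
      show "Ihat h t \<omega> \<in> {0..1}" if "t \<in> {0..T}" for t
        by (rule cadlag_on_rational_bounds[OF cad]) (use elim(1) h that in auto)
    qed
  qed
qed

lemma counting_filter_regularized:
  assumes Ihat: "\<And>h. h \<in> {1..m} \<Longrightarrow> filtered_indicator M T obs \<Theta> h (Ihat h)"
  shows "counting_filter M T F obs m k \<Theta> moves (\<lambda>r e. ell r (fst e) (snd e))
    (\<lambda>e. exposure Q s u Z (fst e)) (real (card Q)) jumps (regularized Ihat)"
proof (intro counting_filter.intro counting_filter_axioms.intro)
  show "prob_space M" by unfold_locales
  show "0 \<le> T" by (rule horizon)
  show "filtration_on M T F" by (rule model_filtration)
  show "null_sets M \<subseteq> sets (F 0)" by (rule null_sets_F)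
  show "finite moves" by (rule finite_moves)
  show "finite (jumps e \<omega>)" if "\<omega> \<in> space M" "e \<in> moves" for \<omega> e by (rule finite_jumps_moves[OF that])
  show "0 < snd x \<and> snd x \<le> T" if "\<omega> \<in> space M" "e \<in> moves" "x \<in> jumps e \<omega>" for \<omega> e x
    by (rule jump_times_moves[OF that(3)])
  show "sets (obs t) = sigma_sets (space M)
      ({(\<lambda>\<omega>. jumps_upto (jumps e \<omega>) v) -` B \<inter> space M | e v B. e \<in> moves \<and> 0 \<le> v \<and> v \<le> t} \<union> null_sets M)" for t
    using sets_obs_eq unfolding obs_generators_def .
  show "space (obs t) = space M" for t by (rule space_obs_eq)
  show "filtration_on M T obs" by (rule obs_filtration_on)
  show "sets (obs t) \<subseteq> sets (F t)" if "0 \<le> t" "t \<le> T" for t by (rule obs_sub_F[OF that])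
  show "(\<lambda>(t, \<omega>). exposure Q s u Z (fst e) t \<omega>) \<in> borel_measurable (predictable_sigma M T obs)" if "e \<in> moves" for e
    using exposure_predictable that unfolding predictable_def moves_def by auto
  show "0 \<le> exposure Q s u Z (fst e) t \<omega> \<and> exposure Q s u Z (fst e) t \<omega> \<le> real (card Q)" for e t \<omega>
    by (rule exposure_range)
  show "0 \<le> ell r (fst e) (snd e)" if "e \<in> moves" "r \<in> {1..m}" for e r
    using rating_rates that unfolding intensity_matrix_def moves_def by auto
  show "\<Theta> t \<in> measurable (F t) (count_space UNIV)" if "0 \<le> t" "t \<le> T" for t by (rule factor_facts(1)[OF that])
  show "\<Theta> t \<omega> \<in> {1..m}" if "0 \<le> t" "t \<le> T" "\<omega> \<in> space M" for t \<omega> by (rule factor_facts(2)[OF that])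
  show "cadlag_on 0 T (\<lambda>t. \<Theta> t \<omega>)" if "\<omega> \<in> space M" for \<omega> by (rule factor_facts(3)[OF that])
  show "(LINT \<omega>|M. indicator A \<omega> * of_bool (\<Theta> t \<omega> = h)) - (LINT \<omega>|M. indicator A \<omega> * of_bool (\<Theta> v \<omega> = h)) =
      (LINT w:{v..t}|lborel. (\<Sum>r=1..m. k r h * (LINT \<omega>|M. indicator A \<omega> * of_bool (\<Theta> w \<omega> = r))))"
    if "h \<in> {1..m}" "0 \<le> v" "v \<le> t" "t \<le> T" "A \<in> sets (F v)" for h v t A
    by (rule markov_chain_forward[OF prob_space_axioms model_filtration factor_chain _ that]) simp
  show "integrable M (\<lambda>\<omega>. real (jumps_upto (jumps e \<omega>) T))" if "e \<in> moves" for e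
  proof -
    obtain i j where ij: "e = (i, j)" by (cases e)
    show ?thesis
      using jump_count_integrable[OF that[unfolded ij] horizon order_refl] jump_count_eq[OF _ that[unfolded ij]]
      unfolding ij by (simp cong: Bochner_Integration.integrable_cong)
  qed
  show "(LINT \<omega>|M. indicator A \<omega> * (real (jumps_upto (jumps e \<omega>) t) - real (jumps_upto (jumps e \<omega>) v))) =
      (LINT \<omega>|M. indicator A \<omega> * (LINT w:{v..t}|lborel. exposure Q s u Z (fst e) w \<omega> *
        (\<Sum>r=1..m. ell r (fst e) (snd e) * of_bool (left_lim 0 (\<lambda>w. \<Theta> w \<omega>) w = r))))"
    if "e \<in> moves" "0 \<le> v" "v \<le> t" "t \<le> T" "A \<in> sets (F v)" for e v t A
  proof -
    obtain i j where ij: "e = (i, j)" by (cases e)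
    have e: "(i, j) \<in> moves" using that(1) ij by simp
    have "(LINT \<omega>|M. indicator A \<omega> * (real (jumps_upto (jumps e \<omega>) t) - real (jumps_upto (jumps e \<omega>) v)))
      = (LINT \<omega>|M. indicator A \<omega> * (real (jump_count Q s u Z i j t \<omega>) - real (jump_count Q s u Z i j v \<omega>)))"
      by (rule Bochner_Integration.integral_cong) (simp_all add: jump_count_eq[OF _ e] ij)
    also have "\<dots> = (LINT \<omega>|M. indicator A \<omega> * (LINT x:{v..t}|lborel. rate i j x \<omega>))"
      by (rule jump_count_intensity[OF e that(2-5)])
    finally show ?thesis unfolding rate_def ij fst_conv snd_conv .
  qed
  show "AE \<omega> in M. \<forall>e\<in>moves. \<forall>e'\<in>moves. \<forall>x\<in>jumps e \<omega>. \<forall>x'\<in>jumps e' \<omega>. snd x = snd x' \<longrightarrow> e = e' \<and> x = x'"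
    by (rule no_simultaneous_moves)
  show "AE \<omega> in M. \<forall>e\<in>moves. \<forall>x\<in>jumps e \<omega>. left_lim 0 (\<lambda>w. \<Theta> w \<omega>) (snd x) = \<Theta> (snd x) \<omega>"
    by (rule no_common_moves)
  have ae: "AE \<omega> in M. regularized Ihat h t \<omega> = real_cond_exp M (obs t) (\<lambda>\<omega>. of_bool (\<Theta> t \<omega> = h)) \<omega>"
    if h: "h \<in> {1..m}" and t: "0 \<le> t" "t \<le> T" for h t
  proof -
    have "AE \<omega> in M. Ihat h t \<omega> = real_cond_exp M (obs t) (\<lambda>\<omega>'. of_bool (\<Theta> t \<omega>' = h)) \<omega>"
      using Ihat[OF h] t unfolding filtered_indicator_def by simp
    moreover have "AE \<omega> in M. regular Ihat \<omega>" by (rule AE_regular) (rule Ihat)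
    ultimately show ?thesis by eventually_elim (simp add: regularized_def)
  qed
  then show "AE \<omega> in M. regularized Ihat h t \<omega> = real_cond_exp M (obs t) (\<lambda>\<omega>. of_bool (\<Theta> t \<omega> = h)) \<omega>"
    if "h \<in> {1..m}" "0 \<le> t" "t \<le> T" for h t using that by blast
  \<comment> \<open>Regularity is a property of the whole path, so adaptedness is not visible from
    the definition; it follows from almost sure equality with a conditional expectation.\<close>
  show "regularized Ihat h t \<in> borel_measurable (obs t)" if "h \<in> {1..m}" "0 \<le> t" "t \<le> T" for h t
    by (rule borel_measurable_AE_eq[OF model_complete filtration_onD(1)[OF obs_filtration_on that(2,3)]
          null_sets_obs borel_measurable_cond_exp ae[OF that]])
  show "cadlag_on 0 T (\<lambda>t. regularized Ihat h t \<omega>)" if "h \<in> {1..m}" for h \<omega>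
  proof (cases "regular Ihat \<omega>")
    case True
    then have "cadlag_on 0 T (\<lambda>t. Ihat h t \<omega>)" using that unfolding regular_def by blast
    then show ?thesis using True by (simp add: regularized_def)
  next
    case False
    then show ?thesis by (auto simp: regularized_def cadlag_on_def)
  qed
  show "0 \<le> regularized Ihat h t \<omega> \<and> regularized Ihat h t \<omega> \<le> 1" if "h \<in> {1..m}" "0 \<le> t" "t \<le> T" for h t \<omega>
    using that by (auto simp: regularized_def regular_def)
qed

end

theorem proposition4:
  fixes M :: "'a measure" and T :: real and F :: "real \<Rightarrow> 'a measure"
    and m p :: nat and k :: "nat \<Rightarrow> nat \<Rightarrow> real" and ell :: "nat \<Rightarrow> nat \<Rightarrow> nat \<Rightarrow> real"
    and \<Theta> :: "real \<Rightarrow> 'a \<Rightarrow> nat"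
    and Q :: "'q set" and s u :: "'q \<Rightarrow> real" and Z :: "'q \<Rightarrow> real \<Rightarrow> 'a \<Rightarrow> nat"
    and N :: "nat \<Rightarrow> nat \<Rightarrow> real \<Rightarrow> 'a \<Rightarrow> nat" and Y :: "nat \<Rightarrow> real \<Rightarrow> 'a \<Rightarrow> real"
    and Ihat Iminus :: "nat \<Rightarrow> real \<Rightarrow> 'a \<Rightarrow> real"
  assumes model: "hidden_factor_model M T F m k \<Theta> p ell Q s u Z"
    and N: "N = jump_count Q s u Z"
    and Y: "Y = exposure Q s u Z"
    and Ihat: "\<And>h. h \<in> {1..m} \<Longrightarrow>
      filtered_indicator M T (observed_filtration M p N) \<Theta> h (Ihat h)"
    and Iminus: "Iminus = (\<lambda>h t \<omega>. left_lim 0 (\<lambda>v. Ihat h v \<omega>) t)"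
  shows "\<forall>h\<in>{1..m}. AE \<omega> in M. \<forall>t\<in>{0..T}.
    Ihat h t \<omega> = Ihat h 0 \<omega>
      + (LINT v:{0..t}|lborel. \<Sum>r=1..m. k r h * Iminus r v \<omega>)
      + (\<Sum>(i, j)\<in>{(i, j). i \<in> {1..p} \<and> j \<in> {1..p} \<and> i \<noteq> j}.
          (LINT v:{0<..t}|interval_measure (\<lambda>w. real (N i j w \<omega>)).
             ell h i j * Iminus h v \<omega> / (\<Sum>r=1..m. ell r i j * Iminus r v \<omega>) - Iminus h v \<omega>)
        - (LINT v:{0..t}|lborel.
             (ell h i j * Iminus h v \<omega> / (\<Sum>r=1..m. ell r i j * Iminus r v \<omega>) - Iminus h v \<omega>)
             * (Y i v \<omega> * (\<Sum>r=1..m. ell r i j * Iminus r v \<omega>))))"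
    (is "\<forall>h\<in>_. AE \<omega> in M. \<forall>t\<in>_. _ = _ + ?D h t \<omega> + sum (?S h t \<omega>) _")
proof
  interpret H: hidden_factor_model M T F m k \<Theta> p ell Q s u Z by (rule model)
  have reg: "AE \<omega> in M. H.regular Ihat \<omega>"
    by (rule H.AE_regular) (use Ihat N in simp)
  interpret C: counting_filter M T F H.obs m k \<Theta> H.moves "\<lambda>r e. ell r (fst e) (snd e)"
    "\<lambda>e. exposure Q s u Z (fst e)" "real (card Q)" H.jumps "H.regularized Ihat"
    by (rule H.counting_filter_regularized) (use Ihat N in simp)
  fix h assume h: "h \<in> {1..m}"
  show "AE \<omega> in M. \<forall>t\<in>{0..T}. Ihat h t \<omega> = Ihat h 0 \<omega> + ?D h t \<omega> + sum (?S h t \<omega>) {(i, j). i \<in> {1..p} \<and> j \<in> {1..p} \<and> i \<noteq> j}"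
    using C.filter_equation[OF h] reg AE_space
  proof eventually_elim
    case (elim \<omega>)
    \<comment> \<open>Regularization leaves regular paths unchanged, and almost every path is
      regular, so the equation carries over to the given version.\<close>
    have R: "H.regularized Ihat r v \<omega> = Ihat r v \<omega>" for r v
      using elim(2) by (simp add: H.regularized_def)
    have pl: "C.pi_left r v \<omega> = Iminus r v \<omega>" for r v
      unfolding C.pi_left_def R Iminus ..
    have gain: "C.gain h (i, j) v \<omega> = ell h i j * Iminus h v \<omega> / (\<Sum>r=1..m. ell r i j * Iminus r v \<omega>) - Iminus h v \<omega>" for i j v
      unfolding C.gain_def C.lam_def pl fst_conv snd_conv ..
    show ?case
    proof
      fix t assume t: "t \<in> {0..T}"
      have "Ihat h t \<omega> = C.X h t \<omega>" using elim(1) t R by simp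
      \<comment> \<open>Here the sums over jumps in \<open>C.X\<close> become the Stieltjes
        integrals of the statement.\<close>
      also have "\<dots> = Ihat h 0 \<omega> + ?D h t \<omega>
        + (\<Sum>e\<in>H.moves. (LINT v:{0<..t}|interval_measure (\<lambda>w. real (jumps_upto (H.jumps e \<omega>) w)). C.gain h e v \<omega>)
          - (LINT v:{0..t}|lborel. C.gain h e v \<omega> * (exposure Q s u Z (fst e) v \<omega> * C.lam e v \<omega>)))"
        unfolding C.X_def C.drift_def R pl
        by (intro arg_cong2[of _ _ _ _ "(+)"] sum.cong refl arg_cong2[of _ _ _ _ "(-)"] C.gain_integral_eq[symmetric] h elim(3))
          (use t in auto)
      also have "(\<Sum>e\<in>H.moves. (LINT v:{0<..t}|interval_measure (\<lambda>w. real (jumps_upto (H.jumps e \<omega>) w)). C.gain h e v \<omega>)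
          - (LINT v:{0..t}|lborel. C.gain h e v \<omega> * (exposure Q s u Z (fst e) v \<omega> * C.lam e v \<omega>)))
        = sum (?S h t \<omega>) {(i, j). i \<in> {1..p} \<and> j \<in> {1..p} \<and> i \<noteq> j}"
        unfolding H.moves_def[symmetric]
      proof (rule sum.cong[OF refl])
        fix e assume e: "e \<in> H.moves"
        obtain i j where ij: "e = (i, j)" by (cases e)
        have cnt: "jumps_upto (H.jumps (i, j) \<omega>) w = N i j w \<omega>" for w
          using H.jump_count_eq[OF elim(3), of i j w] e ij N by simp
        show "(LINT v:{0<..t}|interval_measure (\<lambda>w. real (jumps_upto (H.jumps e \<omega>) w)). C.gain h e v \<omega>)
          - (LINT v:{0..t}|lborel. C.gain h e v \<omega> * (exposure Q s u Z (fst e) v \<omega> * C.lam e v \<omega>))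
          = ?S h t \<omega> e"
          unfolding ij prod.case gain cnt C.lam_def pl fst_conv snd_conv Y ..
      qed
      finally show "Ihat h t \<omega> = Ihat h 0 \<omega> + ?D h t \<omega> + sum (?S h t \<omega>) {(i, j). i \<in> {1..p} \<and> j \<in> {1..p} \<and> i \<noteq> j}" .
    qed
  qed
qed

end
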